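(* Let $T>0$, let $B\in\mathbb{R}^{n\times m}$, $C\in\mathbb{R}^{m\times n}$, $D\in\mathbb{R}^{m\times m}$ be matrices, let $g:[0,T]\times\mathbb{R}^n\to\mathbb{R}^n$, and for each $(t,x)\in[0,T]\times\mathbb{R}^n$ let $F_{t,x}:\mathbb{R}^m\rightrightarrows\mathbb{R}^m$ be a maximal monotone operator. Assume: (3) there exist $L_{F1}\ge0$ and $0\le L_{F2}<\frac{c_2}{\|C\|}$ such that $\mathrm{dis}(F_{t,x},F_{s,y})\le L_{F1}|t-s|+L_{F2}\|x-y\|$ for all $t,s\in[0,T]$, $x,y\in\mathbb{R}^n$, where $c_2$ is the smallest positive eigenvalue of $C^TC$; (4) $D$ is positive semidefinite (i.e. $\langle Dz,z\rangle\ge0$ for all $z$), $CC^T$ is full-rank, and $\ker(D+D^T)\subset\ker(PB-C^T)$ for some symmetric positive definite matrix $P\in\mathbb{R}^{n\times n}$; (5) for all $t\in[0,T]$ and $x,y\in\mathbb{R}^n$, if $(F_{t,y}^{-1}+D)^{-1}Cx\ne\emptyset$ then $\mathrm{rge}(D+D^T)\cap(F_{t,y}^{-1}+D)^{-1}Cx\neq\emptyset$; (6) $\mathrm{rge}(C)\cap\mathrm{rint}(\mathrm{rge}(F_{t,x}^{-1}+D))\ne\emptyset$ for all $t\in[0,T]$, $x\in\mathbb{R}^n$; (7) $g$ is continuous and there exists $c_f>0$ with $\|g(t,x)\|\le c_f(1+\|x\|)$ for all $(t,x)\in[0,T]\times\mathbb{R}^n$. In addition, suppose that $F_{t,x}(\cdot)=G_t(\cdot+g_1(t,x))$,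 where $G_t:\mathbb{R}^m\rightrightarrows\mathbb{R}^m$ is a maximal monotone operator for each $t\in[0,T]$, and that $g_1:[0,T]\times\mathbb{R}^n\to\mathrm{rge}(D+D^T)$ and $g$ are Lipschitz continuous on bounded sets with respect to the second variable. Then for each $(t_0,x_0)\in[0,T]\times\mathbb{R}^n$ with $(F_{t_0,x_0}^{-1}+D)^{-1}Cx_0\ne\emptyset$, the state-dependent Lur'e system $$\dot x(t)=g(t,x(t))+B\lambda(t),\quad y(t)=Cx(t)+D\lambda(t),\quad \lambda(t)\in-F_{t,x(t)}(y(t)),\quad x(t_0)=x_0,$$ for a.e. $t\in[t_0,T]$, has a unique solution.
   Context: For maximal monotone operators $F_1,F_2$ on $\mathbb{R}^m$, $$\mathrm{dis}(F_1,F_2):=\sup\Big\{\frac{\langle\eta_1-\eta_2,z_2-z_1\rangle}{1+\|\eta_1\|+\|\eta_2\|}: z_i\in\mathrm{dom}(F_i),\ \eta_i\in F_i(z_i),\ i=1,2\Big\}.$$ $\mathrm{rge}$ denotes range, $\mathrm{rint}$ relative interior. A function $h$ on $[0,T]\times\mathbb{R}^n$ is Lipschitz continuous on bounded sets with respect to the second variable if for each $M>0$ there is $l_M>0$ with $\|h(t,x_1)-h(t,x_2)\|\le l_M\|x_1-x_2\|$ for all $t\in[0,T]$ and $\|x_1\|,\|x_2\|\le M$. The Lur'e system is identified with the differential inclusion $\dot x(t)\in g(t,x(t))-B(F_{t,x(t)}^{-1}+D)^{-1}Cx(t)$ for a.e. $t\in[t_0,T]$, $x(t_0)=x_0$; a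 solution is an absolutely continuous function $x:[t_0,T]\to\mathbb{R}^n$ satisfying it, and uniqueness refers to $x(\cdot)$. *)

theory Defs
  imports "HOL-Analysis.Analysis"
begin

text \<open>A set-valued operator from \<^typ>\<open>'a\<close> to \<^typ>\<open>'b\<close> is a function \<^typ>\<open>'a \<Rightarrow> 'b set\<close>;
  its domain is the set of points with nonempty value.\<close>

definition op_dom :: "('a \<Rightarrow> 'b set) \<Rightarrow> 'a set"
  where "op_dom F = {z. F z \<noteq> {}}"

definition op_rge :: "('a \<Rightarrow> 'b set) \<Rightarrow> 'b set"
  where "op_rge F = (\<Union>z. F z)"

definition op_inv :: "('a \<Rightarrow> 'b set) \<Rightarrow> 'b \<Rightarrow> 'a set"
  where "op_inv F \<eta> = {z. \<eta> \<in> F z}"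

definition op_add_mat :: "(real^'m \<Rightarrow> (real^'m) set) \<Rightarrow> real^'m^'m \<Rightarrow> real^'m \<Rightarrow> (real^'m) set"
  where "op_add_mat F D z = {u + D *v z | u. u \<in> F z}"

definition monotone_op :: "('a::real_inner \<Rightarrow> 'a set) \<Rightarrow> bool"
  where "monotone_op F \<longleftrightarrow>
    (\<forall>z1 z2. \<forall>\<eta>1\<in>F z1. \<forall>\<eta>2\<in>F z2. (\<eta>1 - \<eta>2) \<bullet> (z1 - z2) \<ge> 0)"

definition maximal_monotone :: "('a::real_inner \<Rightarrow> 'a set) \<Rightarrow> bool"
  where "maximal_monotone F \<longleftrightarrow>
    monotone_op F \<and> (\<forall>H. monotone_op H \<and> (\<forall>z. F z \<subseteq> H z) \<longrightarrow> H = F)"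

text \<open>The supremum may be infinite, so it is taken in \<^typ>\<open>ereal\<close>.\<close>

definition dis :: "('a::real_inner \<Rightarrow> 'a set) \<Rightarrow> ('a \<Rightarrow> 'a set) \<Rightarrow> ereal"
  where "dis F1 F2 = Sup {ereal (((\<eta>1 - \<eta>2) \<bullet> (z2 - z1)) / (1 + norm \<eta>1 + norm \<eta>2)) | z1 z2 \<eta>1 \<eta>2.
    z1 \<in> op_dom F1 \<and> z2 \<in> op_dom F2 \<and> \<eta>1 \<in> F1 z1 \<and> \<eta>2 \<in> F2 z2}"

definition mat_ker :: "real^'n^'m \<Rightarrow> (real^'n) set"
  where "mat_ker A = {z. A *v z = 0}"

definition mat_rge :: "real^'n^'m \<Rightarrow> (real^'m) set"
  where "mat_rge A = range ((*v) A)"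

text \<open>The operator norm; \<^term>\<open>norm A\<close> would be the Frobenius norm.\<close>

definition mat_norm :: "real^'n^'m \<Rightarrow> real"
  where "mat_norm A = onorm ((*v) A)"

definition mat_eigenvalue :: "real^'n^'n \<Rightarrow> real \<Rightarrow> bool"
  where "mat_eigenvalue A c \<longleftrightarrow> (\<exists>v. v \<noteq> 0 \<and> A *v v = c *\<^sub>R v)"

definition smallest_pos_eigenvalue :: "real^'n^'n \<Rightarrow> real \<Rightarrow> bool"
  where "smallest_pos_eigenvalue A c \<longleftrightarrow>
    0 < c \<and> mat_eigenvalue A c \<and> (\<forall>d. 0 < d \<and> mat_eigenvalue A d \<longrightarrow> c \<le> d)"

text \<open>Positive semidefiniteness does not include symmetry.\<close>

definition pos_semidef_mat :: "real^'n^'n \<Rightarrow> bool"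
  where "pos_semidef_mat A \<longleftrightarrow> (\<forall>z. (A *v z) \<bullet> z \<ge> 0)"

definition sym_pos_def_mat :: "real^'n^'n \<Rightarrow> bool"
  where "sym_pos_def_mat A \<longleftrightarrow> transpose A = A \<and> (\<forall>z. z \<noteq> 0 \<longrightarrow> (A *v z) \<bullet> z > 0)"

definition lipschitz_on_bounded_sets ::
    "real \<Rightarrow> (real \<Rightarrow> 'a::real_normed_vector \<Rightarrow> 'b::real_normed_vector) \<Rightarrow> bool"
  where "lipschitz_on_bounded_sets T h \<longleftrightarrow>
    (\<forall>M>0. \<exists>l>0. \<forall>t\<in>{0..T}. \<forall>x1 x2. norm x1 \<le> M \<and> norm x2 \<le> M \<longrightarrow>
      norm (h t x1 - h t x2) \<le> l * norm (x1 - x2))"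

text \<open>The usual epsilon-delta definition: the elements of a \<^const>\<open>division_of\<close> are finitely many
  nonempty compact intervals with disjoint interiors.\<close>

definition abs_continuous_on :: "real \<Rightarrow> real \<Rightarrow> (real \<Rightarrow> 'a::real_normed_vector) \<Rightarrow> bool"
  where "abs_continuous_on a b x \<longleftrightarrow>
    (\<forall>\<epsilon>>0. \<exists>\<delta>>0. \<forall>d S. d division_of S \<and> S \<subseteq> {a..b} \<and> (\<Sum>k\<in>d. Sup k - Inf k) < \<delta> \<longrightarrow>
      (\<Sum>k\<in>d. norm (x (Sup k) - x (Inf k))) < \<epsilon>)"

text \<open>The operator \<open>(F\<^sup>-\<^sup>1 + D)\<^sup>-\<^sup>1\<close>.\<close>

definition lure_op :: "(real^'m \<Rightarrow> (real^'m) set) \<Rightarrow> real^'m^'m \<Rightarrow> real^'m \<Rightarrow> (real^'m) set"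
  where "lure_op F D = op_inv (op_add_mat (op_inv F) D)"

text \<open>The Lur'e system is read as a differential inclusion for the state. Values of the trajectory
  outside \<open>[t0, T]\<close> are irrelevant.\<close>

definition lure_solution ::
    "(real \<Rightarrow> real^'n \<Rightarrow> real^'n) \<Rightarrow> real^'m^'n \<Rightarrow> real^'n^'m \<Rightarrow> real^'m^'m \<Rightarrow>
     (real \<Rightarrow> real^'n \<Rightarrow> real^'m \<Rightarrow> (real^'m) set) \<Rightarrow> real \<Rightarrow> real \<Rightarrow> real^'n \<Rightarrow>
     (real \<Rightarrow> real^'n) \<Rightarrow> bool"
  where "lure_solution g B C D F T t0 x0 x \<longleftrightarrow>
    abs_continuous_on t0 T x \<and> x t0 = x0 \<and>
    (AE t in lebesgue. t \<in> {t0..T} \<longrightarrow>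
      (\<exists>v. (x has_vector_derivative v) (at t within {t0..T}) \<and>
        v \<in> {g t (x t) - B *v \<mu> | \<mu>. \<mu> \<in> lure_op (F t (x t)) D (C *v x t)}))"

lemma mat_vec_uminus: "A *v (- z) = - (A *v z)" for A :: "real^'n^'m"
  by (metis matrix_vector_mult_diff_distrib diff_0 matrix_vector_mult_0_right)

text \<open>Eliminating \<open>y\<close> and writing \<open>\<lambda> = - \<mu>\<close> turns the system into the inclusion.\<close>

lemma lure_inclusion_iff_system:
  fixes B :: "real^'m^'n" and C :: "real^'n^'m" and D :: "real^'m^'m"
  shows "v \<in> {w - B *v \<mu> | \<mu>. \<mu> \<in> lure_op F D (C *v x)} \<longleftrightarrow>
    (\<exists>l y. v = w + B *v l \<and> y = C *v x + D *v l \<and> l \<in> uminus ` F y)"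
proof
  assume "v \<in> {w - B *v \<mu> | \<mu>. \<mu> \<in> lure_op F D (C *v x)}"
  then obtain \<mu> u where "v = w - B *v \<mu>" "\<mu> \<in> F u" "C *v x = u + D *v \<mu>"
    by (auto simp: lure_op_def op_inv_def op_add_mat_def)
  then have "v = w + B *v (- \<mu>) \<and> u = C *v x + D *v (- \<mu>) \<and> - \<mu> \<in> uminus ` F u"
    by (simp add: mat_vec_uminus)
  then show "\<exists>l y. v = w + B *v l \<and> y = C *v x + D *v l \<and> l \<in> uminus ` F y"
    by blast
next
  assume "\<exists>l y. v = w + B *v l \<and> y = C *v x + D *v l \<and> l \<in> uminus ` F y"
  then obtain \<mu> y where "v = w + B *v (- \<mu>)" "y = C *v x + D *v (- \<mu>)" "\<mu> \<in> F y"
    by auto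
  then have "v = w - B *v \<mu>" "C *v x = y + D *v \<mu>" "\<mu> \<in> F y"
    by (simp_all add: mat_vec_uminus)
  then show "v \<in> {w - B *v \<mu> | \<mu>. \<mu> \<in> lure_op F D (C *v x)}"
    by (auto simp: lure_op_def op_inv_def op_add_mat_def)
qed

end

(* Since C C^T has full rank, C is onto. Let R be the range of D + D^T and K its kernel, the
   orthogonal complement of R. Monotonicity and coercivity of D on R make the value
   psi_{t,x}(w) in R of (F_{t,x}^{-1} + D)^{-1} w unique and Lipschitz continuous in w; Minty's
   theorem makes the domain Q of this operator closed and convex, and its values contain
   psi_{t,x}(w) + N_Q(w), where N_Q(w) is contained in K. Hence Q is invariant under translations
   by R, so Q = Q_t does not depend on x, because x only enters through a shift by g_1(t,x) in R.
   As P B = C^T on K, it suffices for existence to solve the sweeping process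
   x' in f(t,x) - P^{-1} N_{S_t}(x) with S_t = C^{-1}(Q_t) and f = g - B psi. The bound on dis makes
   Q_t Lipschitz continuous for the Hausdorff distance and f continuous of linear growth, so Moreau's
   catching-up scheme, with projections in the norm of P, converges along a subsequence to a solution.
   Uniqueness is Gronwall's inequality for the squared P-norm of the difference of two solutions. *)

theory Submission
  imports Defs "HOL-Complex_Analysis.Great_Picard"
begin

text \<open>Two obstacles shape the proof. A solution is only absolutely continuous and satisfies
  the inclusion almost everywhere. Existence therefore needs Lipschitz curves to be differentiable
  almost everywhere, and uniqueness needs a monotonicity principle for absolutely continuous
  functions whose derivative has a sign almost everywhere; both are obtained from covering
  arguments. The second obstacle is the modulus of \<open>\<psi>\<close>. The quotient in
  \<open>dis\<close> is normalised by the norms of the values, so comparing two pairs (t, x) leaves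
  an error that is not quadratic in the difference of the selections, and \<open>\<psi>\<close>
  inherits only a square-root modulus. This gives continuity and linear growth of \<open>f\<close>,
  enough for compactness but not for Gronwall. At equal times the shift by \<open>g1\<close> yields
  a second, Lipschitz estimate, and uniqueness rests on that one. There the multivalued part of the
  velocity is harmless: P B - C^T annihilates K, and \<open>g1\<close> takes values in R, orthogonal
  to K, so neither sees the component of a multiplier that \<open>\<psi>\<close> does not
  control.\<close>

section \<open>Almost everywhere differentiability of Lipschitz functions\<close>

text \<open>Two nested Vitali coverings of \<open>E\<close>, by intervals of slope at least \<open>q\<close> inside intervals of slope
  at most \<open>p\<close>, compare Lebesgue measure with the Stieltjes measure of \<open>f\<close> and give
  \<open>q |E| \<le> p |E|\<close>.\<close>

lemma negligible_straddled_slopes: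
  fixes f :: "real \<Rightarrow> real"
  assumes mono: "mono f" and cont: "continuous_on UNIV f"
    and pq: "0 \<le> p" "p < q" and E: "E \<in> lmeasurable"
    and low: "\<And>x d. x \<in> E \<Longrightarrow> 0 < d \<Longrightarrow>
      \<exists>a r. 0 < r \<and> r < d \<and> x \<in> cball a r \<and> f (a + r) - f (a - r) \<le> p * (2 * r)"
    and high: "\<And>x d. x \<in> E \<Longrightarrow> 0 < d \<Longrightarrow>
      \<exists>a r. 0 < r \<and> r < d \<and> x \<in> cball a r \<and> q * (2 * r) \<le> f (a + r) - f (a - r)"
  shows "negligible E"
proof -
  let ?\<nu> = "interval_measure f"
  let ?l = "lborel :: real measure"
  have mono': "\<And>x y. x \<le> y \<Longrightarrow> f x \<le> f y" using mono by (simp add: monoD)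
  have \<nu>: "emeasure ?\<nu> (cball a r) = ennreal (f (a + r) - f (a - r))" if "0 < r" for a r
    using emeasure_interval_measure_Icc[of "a - r" "a + r" f] that mono' cont
    by (simp add: cball_eq_atLeastAtMost)
  have \<l>: "emeasure ?l (cball a r) = ennreal (2 * r)" if "0 < r" for a r :: real
    using that by (simp add: cball_eq_atLeastAtMost)
  have bound: "ennreal q * emeasure lebesgue E \<le> ennreal p * (emeasure lebesgue E + ennreal e)"
    if e: "0 < e" for e
  proof -
    obtain U where U: "open U" "E \<subseteq> U" "emeasure lebesgue (U - E) < ennreal e"
      using sets_lebesgue_outer_open[OF fmeasurableD[OF E] e] by metis
    \<comment> \<open>Confinement to \<open>U\<close>, which exceeds \<open>E\<close> by measure
      below \<open>e\<close>, bounds the total length of the disjoint intervals chosen from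
      \<open>K1\<close> by that of \<open>U\<close>.\<close>
    define K1 where "K1 = {(a, r). 0 < r \<and> cball a r \<subseteq> U \<and> f (a + r) - f (a - r) \<le> p * (2 * r)}"
    have cov1: "\<exists>i. i \<in> K1 \<and> x \<in> cball (fst i) (snd i) \<and> snd i < d" if x: "x \<in> E" "0 < d" for x d
    proof -
      obtain \<rho> where \<rho>: "0 < \<rho>" "ball x \<rho> \<subseteq> U" using U x by (meson openE subsetD)
      obtain a r where ar: "0 < r" "r < min d (\<rho>/2)" "x \<in> cball a r"
        "f (a + r) - f (a - r) \<le> p * (2 * r)" using low[OF x(1), of "min d (\<rho>/2)"] x \<rho> by auto
      have "cball a r \<subseteq> ball x \<rho>" using ar(2,3)
        by (auto simp: dist_real_def)
      then show ?thesis using ar \<rho> by (intro exI[of _ "(a, r)"]) (auto simp: K1_def)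
    qed
    obtain C1 where C1: "countable C1" "C1 \<subseteq> K1"
      "pairwise (\<lambda>i j. disjnt (cball (fst i) (snd i)) (cball (fst j) (snd j))) C1"
      "negligible (E - (\<Union>i\<in>C1. cball (fst i) (snd i)))"
    proof (rule Vitali_covering_theorem_cballs[of K1 snd E fst])
      show "0 < snd i" if "i \<in> K1" for i using that by (auto simp: K1_def)
    qed (rule cov1, assumption+)
    \<comment> \<open>Passing to open balls loses only countably many endpoints and leaves an open
      set, inside which the second covering can be taken at arbitrarily small scale.\<close>
    define V where "V = (\<Union>i\<in>C1. ball (fst i) (snd i))"
    have "open V" by (auto simp: V_def)
    have "negligible (\<Union>i\<in>C1. sphere (fst i) (snd i))"
      using C1(1) by (intro negligible_countable_Union) (auto intro: negligible_sphere)
    from negligible_Un[OF C1(4) this] have negV: "negligible (E - V)"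
      by (rule negligible_subset) (force simp: V_def)
    define K2 where "K2 = {(a, r). 0 < r \<and> cball a r \<subseteq> V \<and> q * (2 * r) \<le> f (a + r) - f (a - r)}"
    have cov2: "\<exists>i. i \<in> K2 \<and> x \<in> cball (fst i) (snd i) \<and> snd i < d" if x: "x \<in> E \<inter> V" "0 < d" for x d
    proof -
      obtain \<rho> where \<rho>: "0 < \<rho>" "ball x \<rho> \<subseteq> V" using \<open>open V\<close> x by (meson IntD2 openE)
      obtain a r where ar: "0 < r" "r < min d (\<rho>/2)" "x \<in> cball a r"
        "q * (2 * r) \<le> f (a + r) - f (a - r)" using high[of x "min d (\<rho>/2)"] x \<rho> by auto
      have "cball a r \<subseteq> ball x \<rho>" using ar(2,3)
        by (auto simp: dist_real_def)
      then show ?thesis using ar \<rho> by (intro exI[of _ "(a, r)"]) (auto simp: K2_def)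
    qed
    obtain C2 where C2: "countable C2" "C2 \<subseteq> K2"
      "pairwise (\<lambda>i j. disjnt (cball (fst i) (snd i)) (cball (fst j) (snd j))) C2"
      "negligible (E \<inter> V - (\<Union>i\<in>C2. cball (fst i) (snd i)))"
    proof (rule Vitali_covering_theorem_cballs[of K2 snd "E \<inter> V" fst])
      show "0 < snd i" if "i \<in> K2" for i using that by (auto simp: K2_def)
    qed (rule cov2, assumption+)
    let ?W1 = "\<Union>i\<in>C1. cball (fst i) (snd i)" and ?W2 = "\<Union>i\<in>C2. cball (fst i) (snd i)"
    have disj: "disjoint_family_on (\<lambda>i. cball (fst i) (snd i)) C"
      if "pairwise (\<lambda>i j. disjnt (cball (fst i) (snd i)) (cball (fst j) (snd j))) C"
      for C :: "(real \<times> real) set"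
      using that by (auto simp: disjoint_family_on_def pairwise_def disjnt_def)
    have sum: "emeasure M (\<Union>i\<in>C. cball (fst i) (snd i)) =
        (\<integral>\<^sup>+ i. emeasure M (cball (fst i) (snd i)) \<partial>count_space C)"
      if "sets M = sets borel" "countable C"
        "pairwise (\<lambda>i j. disjnt (cball (fst i) (snd i)) (cball (fst j) (snd j))) C"
      for M :: "real measure" and C :: "(real \<times> real) set"
      using that by (intro emeasure_UN_countable disj) auto
    have "negligible (E - ?W2)"
      by (rule negligible_subset[OF negligible_Un[OF negV C2(4)]]) auto
    moreover have W2: "?W2 \<in> sets borel"
      using C2(1) by (intro sets.countable_UN') auto
    have W1: "?W1 \<in> sets borel"
      using C1(1) by (intro sets.countable_UN') auto
    ultimately have "emeasure lebesgue E \<le> emeasure lebesgue ?W2"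
    proof -
      have "E - ?W2 \<in> null_sets lebesgue" using \<open>negligible (E - ?W2)\<close> negligible_iff_null_sets by blast
      moreover have "?W2 \<in> sets lebesgue" using W2 by auto
      ultimately have "emeasure lebesgue (?W2 \<union> (E - ?W2)) = emeasure lebesgue ?W2"
        by (rule emeasure_Un_null_set[rotated])
      moreover have "emeasure lebesgue E \<le> emeasure lebesgue (?W2 \<union> (E - ?W2))"
        using W2 E by (intro emeasure_mono) auto
      ultimately show ?thesis by simp
    qed
    also have "\<dots> = emeasure ?l ?W2" using W2 by simp
    finally have 1: "emeasure lebesgue E \<le> emeasure ?l ?W2" .
    \<comment> \<open>Summing over the disjoint intervals of \<open>C2\<close> and enclosing them in
      those of \<open>C1\<close> gives q |W2| \<le> \<nu>(W2) \<le> \<nu>(W1) \<le> p |W1| \<le> p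
      |U|.\<close>
    have "ennreal q * emeasure ?l ?W2 = (\<integral>\<^sup>+ i. ennreal q * emeasure ?l (cball (fst i) (snd i)) \<partial>count_space C2)"
      by (subst sum[OF _ C2(1,3)]) (auto simp: nn_integral_cmult)
    also have "\<dots> \<le> (\<integral>\<^sup>+ i. emeasure ?\<nu> (cball (fst i) (snd i)) \<partial>count_space C2)"
      using C2(2) pq by (intro nn_integral_mono)
        (auto simp: \<l> \<nu> K2_def ennreal_mult[symmetric] intro!: ennreal_leI)
    also have "\<dots> = emeasure ?\<nu> ?W2" by (rule sum[symmetric, OF _ C2(1,3)]) simp
    also have "\<dots> \<le> emeasure ?\<nu> ?W1"
    proof (intro emeasure_mono)
      have "?W2 \<subseteq> V" using C2(2) by (fastforce simp: K2_def)
      also have "V \<subseteq> ?W1" by (force simp: V_def)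
      finally show "?W2 \<subseteq> ?W1" .
    qed (use W1 in simp)
    also have "\<dots> = (\<integral>\<^sup>+ i. emeasure ?\<nu> (cball (fst i) (snd i)) \<partial>count_space C1)"
      by (rule sum[OF _ C1(1,3)]) simp
    also have "\<dots> \<le> (\<integral>\<^sup>+ i. ennreal p * emeasure ?l (cball (fst i) (snd i)) \<partial>count_space C1)"
      using C1(2) pq by (intro nn_integral_mono)
        (auto simp: \<l> \<nu> K1_def ennreal_mult[symmetric] intro!: ennreal_leI)
    also have "\<dots> = ennreal p * emeasure ?l ?W1"
      by (subst sum[OF _ C1(1,3)]) (auto simp: nn_integral_cmult)
    also have "\<dots> \<le> ennreal p * emeasure ?l U"
    proof (intro mult_left_mono emeasure_mono)
      show "?W1 \<subseteq> U" using C1(2) by (fastforce simp: K1_def)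
    qed (use U in auto)
    also have "emeasure ?l U = emeasure lebesgue (E \<union> (U - E))"
    proof -
      have "E \<union> (U - E) = U" using U by auto
      then show ?thesis using U(1) by simp
    qed
    also have "\<dots> \<le> emeasure lebesgue E + emeasure lebesgue (U - E)"
      using U E by (intro emeasure_subadditive) auto
    also have "\<dots> \<le> emeasure lebesgue E + ennreal e"
      using U by (intro add_left_mono) auto
    finally show ?thesis
      using 1 by (meson mult_left_mono order_trans add_left_mono zero_le)
  qed
  define m where "m = measure lebesgue E"
  have Em: "emeasure lebesgue E = ennreal m" using E by (simp add: m_def emeasure_eq_measure2)
  have m0: "0 \<le> m" by (simp add: m_def)
  have "q * m \<le> p * (m + e)" if "0 < e" for e
  proof -
    have "ennreal (q * m) \<le> ennreal (p * (m + e))"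
      using bound[OF that] that pq m0 by (simp add: Em ennreal_mult)
    then show ?thesis using that pq m0 by (subst (asm) ennreal_le_iff) auto
  qed
  then have le: "(q - p) * m \<le> p * e" if "0 < e" for e using that by (auto simp: algebra_simps)
  have "(q - p) * m \<le> 0"
  proof (rule field_le_epsilon)
    fix e :: real assume "0 < e"
    have "p * (e / (p + 1)) \<le> e" using \<open>0 < e\<close> pq by (simp add: field_simps)
    then show "(q - p) * m \<le> 0 + e" using le[of "e / (p + 1)"] \<open>0 < e\<close> pq by simp
  qed
  moreover have "0 < q - p" using pq by simp
  ultimately have "m \<le> 0" by (metis mult_pos_pos not_le)
  then have "m = 0" using m0 by linarith
  then show ?thesis using E negligible_iff_measure unfolding m_def by blast
qed

lemma negligible_countable_UN:
  assumes "countable I" "\<And>i. i \<in> I \<Longrightarrow> negligible (A i)"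
  shows "negligible (\<Union>i\<in>I. A i)"
  using assms null_sets_UN'[of I A lebesgue] by (simp add: negligible_iff_null_sets)

text \<open>The limit is the supremum of the eventual lower bounds. Only rational \<open>p\<close>
  and \<open>q\<close> are tested, so that failure of convergence costs countably many exceptional
  sets.\<close>

lemma tendsto_slope_if_rational_bounds:
  fixes s :: "'b \<Rightarrow> real"
  assumes bdd: "eventually (\<lambda>h. \<bar>s h\<bar> \<le> K) F" and F: "F \<noteq> bot"
    and sep: "\<And>p q. p \<in> \<rat> \<Longrightarrow> q \<in> \<rat> \<Longrightarrow> p < q \<Longrightarrow>
      eventually (\<lambda>h. s h \<le> q) F \<or> eventually (\<lambda>h. p \<le> s h) F"
  shows "\<exists>l. (s \<longlongrightarrow> l) F"
proof -
  define A where "A = {p. eventually (\<lambda>h. p \<le> s h) F}"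
  have "-K \<in> A" unfolding A_def mem_Collect_eq using bdd by (rule eventually_mono) linarith
  have "p \<le> K" if "p \<in> A" for p
  proof -
    have "eventually (\<lambda>h. p \<le> s h \<and> \<bar>s h\<bar> \<le> K) F"
      using that bdd unfolding A_def mem_Collect_eq by (rule eventually_conj)
    then have "\<exists>h. p \<le> s h \<and> \<bar>s h\<bar> \<le> K" by (rule eventually_happens'[OF F])
    then obtain h where "p \<le> s h" "\<bar>s h\<bar> \<le> K" by blast
    then show ?thesis by auto
  qed
  then have bA: "bdd_above A" by (rule bdd_aboveI)
  have "(s \<longlongrightarrow> Sup A) F"
  proof (rule order_tendstoI)
    fix a assume "a < Sup A"
    then obtain p where "p \<in> A" "a < p" using less_cSup_iff[of A a] bA \<open>-K \<in> A\<close> by blast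
    then have "eventually (\<lambda>h. p \<le> s h) F" by (simp add: A_def)
    then show "eventually (\<lambda>h. a < s h) F"
      by (rule eventually_mono) (use \<open>a < p\<close> in auto)
  next
    fix a assume "Sup A < a"
    then obtain p where p: "p \<in> \<rat>" "Sup A < p" "p < a" using Rats_dense_in_real by blast
    obtain q where q: "q \<in> \<rat>" "p < q" "q < a" using Rats_dense_in_real[OF p(3)] by blast
    have "p \<notin> A" using p(2) cSup_upper[OF _ bA, of p] by auto
    then have "eventually (\<lambda>h. s h \<le> q) F" using sep[OF p(1) q(1,2)] by (simp add: A_def)
    then show "eventually (\<lambda>h. s h < a) F"
      by (rule eventually_mono) (use q(3) in auto)
  qed
  then show ?thesis by blast
qed

text \<open>The Lipschitz bound keeps the difference quotients bounded, so at a point without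
  derivative some rationals p < q are straddled by quotients at every scale. Such points form
  countably many sets \<open>E p q N\<close>, where \<open>N\<close> makes the measure
  finite.\<close>

lemma mono_lipschitz_AE_differentiable:
  fixes f :: "real \<Rightarrow> real"
  assumes mono: "mono f" and lip: "\<And>x y. \<bar>f x - f y\<bar> \<le> K * \<bar>x - y\<bar>"
  shows "AE t in lebesgue. \<exists>l. (f has_real_derivative l) (at t)"
proof -
  have "continuous_on UNIV f"
  proof (rule lipschitz_on_continuous_on)
    show "\<bar>K\<bar>-lipschitz_on UNIV f"
      by (rule lipschitz_onI)
        (auto simp: dist_real_def intro!: order_trans[OF lip] mult_right_mono)
  qed
  note cont = this
  let ?s = "\<lambda>t h. (f (t + h) - f t) / h"
  \<comment> \<open>The union runs over uncountably many \<open>h\<close>, but each member is open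
    by continuity of \<open>f\<close>; this is what makes \<open>E p q N\<close> measurable.\<close>
  define Hi where "Hi q n = (\<Union>h\<in>{h. 0 < \<bar>h\<bar> \<and> \<bar>h\<bar> < 1 / Suc n}. {t. q < ?s t h})" for q :: real and n :: nat
  define Lo where "Lo p n = (\<Union>h\<in>{h. 0 < \<bar>h\<bar> \<and> \<bar>h\<bar> < 1 / Suc n}. {t. ?s t h < p})" for p :: real and n :: nat
  have cs: "continuous_on UNIV (\<lambda>t. ?s t h)" for h
    by (cases "h = 0") (auto intro!: continuous_intros continuous_on_compose2[OF cont])
  have oHi: "open (Hi q n)" and oLo: "open (Lo q n)" for q n
    unfolding Hi_def Lo_def by (auto intro!: open_UN open_Collect_less cs continuous_intros)
  define E where "E p q N = ball 0 (real N) \<inter> (\<Inter>n. Hi q n \<inter> Lo p n)" for p q :: real and N :: nat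
  \<comment> \<open>The quotient over the interval between \<open>t\<close> and
    \<open>t + h\<close>, whichever sign \<open>h\<close> has, is the slope over a closed ball
    containing \<open>t\<close>, the shape that the covering argument asks for.\<close>
  have swap: "\<exists>a r. 0 < r \<and> r < d \<and> t \<in> cball a r \<and> (f (a + r) - f (a - r)) = ?s t h * (2 * r)"
    if "0 < \<bar>h\<bar>" "\<bar>h\<bar> < d" for t h d
  proof (intro exI conjI)
    let ?a = "t + h / 2" and ?r = "\<bar>h\<bar> / 2"
    show "0 < ?r" "?r < d" using that by auto
    show "t \<in> cball ?a ?r" by (auto simp: dist_real_def)
    show "f (?a + ?r) - f (?a - ?r) = ?s t h * (2 * ?r)"
    proof -
      have "?s t h * (2 * ?r) = sgn h * (f (t + h) - f t)"
        using that by (simp add: sgn_real_def)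
      moreover have "?a + ?r = (if 0 < h then t + h else t)" "?a - ?r = (if 0 < h then t else t + h)"
        by (auto simp: field_simps)
      ultimately show ?thesis using that by (simp only:) (simp add: sgn_real_def)
    qed
  qed
  have neg: "negligible (E p q N)" if "p < q" for p q N
  proof (cases "0 \<le> p")
    case True
    show ?thesis
    proof (rule negligible_straddled_slopes[OF mono cont True that])
      have "E p q N \<in> sets lebesgue" unfolding E_def
        by (intro sets.Int sets.countable_INT'' ) (auto intro!: borel_open oHi oLo)
      moreover have "bounded (E p q N)" unfolding E_def by (meson bounded_Int bounded_ball)
      ultimately show "E p q N \<in> lmeasurable" by (simp add: bounded_set_imp_lmeasurable)
    next
      fix x d :: real assume x: "x \<in> E p q N" "0 < d"
      obtain n where n: "1 / real (Suc n) < d" using x(2) nat_approx_posE by blast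
      have "x \<in> Lo p n" using x by (auto simp: E_def)
      then obtain h where h: "0 < \<bar>h\<bar>" "\<bar>h\<bar> < 1 / Suc n" "?s x h < p" by (auto simp: Lo_def)
      have hd: "\<bar>h\<bar> < d" using h n by linarith
      from swap[OF h(1) hd, of x] obtain a r where
        ar: "0 < r" "r < d" "x \<in> cball a r" "f (a + r) - f (a - r) = ?s x h * (2 * r)" by blast
      have "?s x h * (2 * r) \<le> p * (2 * r)" using h(3) ar(1) by (intro mult_right_mono) auto
      with ar show "\<exists>a r. 0 < r \<and> r < d \<and> x \<in> cball a r \<and> f (a + r) - f (a - r) \<le> p * (2 * r)"
        by metis
    next
      fix x d :: real assume x: "x \<in> E p q N" "0 < d"
      obtain n where n: "1 / real (Suc n) < d" using x(2) nat_approx_posE by blast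
      have "x \<in> Hi q n" using x by (auto simp: E_def)
      then obtain h where h: "0 < \<bar>h\<bar>" "\<bar>h\<bar> < 1 / Suc n" "q < ?s x h" by (auto simp: Hi_def)
      have hd: "\<bar>h\<bar> < d" using h n by linarith
      from swap[OF h(1) hd, of x] obtain a r where
        ar: "0 < r" "r < d" "x \<in> cball a r" "f (a + r) - f (a - r) = ?s x h * (2 * r)" by blast
      have "q * (2 * r) \<le> ?s x h * (2 * r)" using h(3) ar(1) by (intro mult_right_mono) auto
      with ar show "\<exists>a r. 0 < r \<and> r < d \<and> x \<in> cball a r \<and> q * (2 * r) \<le> f (a + r) - f (a - r)"
        by metis
    qed
  next
    \<comment> \<open>Quotients of a monotone function are nonnegative, so none lies below a
      negative \<open>p\<close>.\<close>
    case False
    have "0 \<le> ?s t h" if "h \<noteq> 0" for t h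
      using monoD[OF mono, of t "t + h"] monoD[OF mono, of "t + h" t] that
      by (cases "h > 0") (auto simp: divide_nonneg_nonneg divide_nonpos_nonpos)
    then have "\<not> ?s t h < p" if "h \<noteq> 0" for t h using that False by (meson less_trans not_le)
    then have "Lo p 0 = {}" unfolding Lo_def by fastforce
    then have "E p q N = {}" by (auto simp: E_def)
    then show ?thesis by simp
  qed
  let ?B = "\<Union>(p, q)\<in>{(p, q). p \<in> \<rat> \<and> q \<in> \<rat> \<and> p < q}. \<Union>N. E p q N"
  have "countable {(p, q). p \<in> \<rat> \<and> q \<in> \<rat> \<and> (p::real) < q}"
    by (rule countable_subset[of _ "\<rat> \<times> \<rat>"]) (auto simp: countable_rat)
  then have "negligible ?B"
  proof (rule negligible_countable_UN)
    fix i assume i: "i \<in> {(p, q). p \<in> \<rat> \<and> q \<in> \<rat> \<and> (p::real) < q}"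
    have "negligible (\<Union>N. E (fst i) (snd i) N)"
      using i by (intro negligible_countable_UN neg) auto
    then show "negligible (case i of (p, q) \<Rightarrow> \<Union>N. E p q N)" by (simp add: case_prod_beta)
  qed
  then have "AE t in lebesgue. t \<notin> ?B"
    using AE_not_in negligible_iff_null_sets by blast
  then show ?thesis
  proof (rule AE_mp, intro AE_I2 impI)
    fix t assume t: "t \<notin> ?B"
    obtain N :: nat where N: "\<bar>t\<bar> < N" using reals_Archimedean2 by blast
    have "\<exists>l. (?s t \<longlongrightarrow> l) (at 0)"
    proof (rule tendsto_slope_if_rational_bounds)
      have "\<bar>?s t h\<bar> \<le> K" if "h \<noteq> 0" for h
        using lip[of "t + h" t] that by (simp add: pos_divide_le_eq)
      then show "eventually (\<lambda>h. \<bar>?s t h\<bar> \<le> K) (at 0)"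
        by (simp add: eventually_at_filter)
      show "at (0::real) \<noteq> bot" by simp
      fix p q :: real assume pq: "p \<in> \<rat>" "q \<in> \<rat>" "p < q"
      then have "t \<notin> E p q N" using t by auto
      then obtain n where "t \<notin> Hi q n \<or> t \<notin> Lo p n" using N by (auto simp: E_def)
      then show "eventually (\<lambda>h. ?s t h \<le> q) (at 0) \<or> eventually (\<lambda>h. p \<le> ?s t h) (at 0)"
      proof
        assume "t \<notin> Hi q n"
        then have "\<forall>h. h \<noteq> 0 \<and> dist h 0 < 1 / Suc n \<longrightarrow> ?s t h \<le> q" by (fastforce simp: Hi_def)
        then show ?thesis unfolding eventually_at by (intro disjI1 exI[of _ "1 / Suc n"]) auto
      next
        assume "t \<notin> Lo p n"
        then have "\<forall>h. h \<noteq> 0 \<and> dist h 0 < 1 / Suc n \<longrightarrow> p \<le> ?s t h" by (fastforce simp: Lo_def)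
        then show ?thesis unfolding eventually_at by (intro disjI2 exI[of _ "1 / Suc n"]) auto
      qed
    qed
    then show "\<exists>l. (f has_real_derivative l) (at t)" by (simp add: DERIV_def)
  qed
qed

text \<open>Clamping the argument extends \<open>f\<close> to the whole line with the same constant
  \<open>L\<close>; adding \<open>L * t\<close> to a coordinate makes it monotone and keeps it
  Lipschitz.\<close>

lemma lipschitz_AE_vector_differentiable:
  fixes f :: "real \<Rightarrow> 'a::euclidean_space"
  assumes lip: "L-lipschitz_on {a..b} f"
  shows "AE t in lebesgue. t \<in> {a..b} \<longrightarrow> (\<exists>v. (f has_vector_derivative v) (at t within {a..b}))"
proof (cases "a \<le> b")
  case True
  have L0: "0 \<le> L" using lip by (rule lipschitz_on_nonneg)
  define F where "F t = f (max a (min b t))" for t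
  have F: "norm (F x - F y) \<le> L * \<bar>x - y\<bar>" for x y
  proof -
    have "norm (F x - F y) \<le> L * dist (max a (min b x)) (max a (min b y))"
      unfolding F_def dist_norm[symmetric] using True by (intro lipschitz_onD[OF lip]) auto
    also have "\<dots> \<le> L * \<bar>x - y\<bar>" using L0 by (intro mult_left_mono) (auto simp: dist_real_def)
    finally show ?thesis .
  qed
  have "AE t in lebesgue. \<forall>i\<in>Basis. \<exists>l. ((\<lambda>t. F t \<bullet> i + L * t) has_real_derivative l) (at t)"
  proof (rule AE_finite_allI)

      fix i :: 'a assume i: "i \<in> Basis"
      have c: "\<bar>F x \<bullet> i - F y \<bullet> i\<bar> \<le> L * \<bar>x - y\<bar>" for x y
        using F[of x y] Basis_le_norm[OF i, of "F x - F y"] by (simp add: inner_diff_left)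
      show "AE t in lebesgue. \<exists>l. ((\<lambda>t. F t \<bullet> i + L * t) has_real_derivative l) (at t)"
      proof (rule mono_lipschitz_AE_differentiable[where K = "2 * L"])
        show "mono (\<lambda>t. F t \<bullet> i + L * t)"
        proof (rule monoI)
          fix x y :: real assume "x \<le> y"
          then show "F x \<bullet> i + L * x \<le> F y \<bullet> i + L * y"
            using c[of x y] by (simp add: algebra_simps abs_if split: if_splits)
        qed
        fix x y
        have "L * x - L * y = L * (x - y)" by (simp add: algebra_simps)
        then show "\<bar>F x \<bullet> i + L * x - (F y \<bullet> i + L * y)\<bar> \<le> 2 * L * \<bar>x - y\<bar>"
          using c[of x y] abs_mult[of L "x - y"] L0 by linarith
      qed
  qed auto
  then show ?thesis
  proof (rule AE_mp, intro AE_I2 impI)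
    fix t assume der: "\<forall>i\<in>Basis. \<exists>l. ((\<lambda>t. F t \<bullet> i + L * t) has_real_derivative l) (at t)"
      and t: "t \<in> {a..b}"
    then obtain l where l: "\<And>i. i \<in> Basis \<Longrightarrow> ((\<lambda>t. F t \<bullet> i + L * t) has_real_derivative l i) (at t)"
      by metis
    have "((\<lambda>t. F t \<bullet> i) has_vector_derivative (l i - L)) (at t)" if "i \<in> Basis" for i
    proof -
      have "((\<lambda>t. (F t \<bullet> i + L * t) - L * t) has_real_derivative (l i - L)) (at t)"
        by (rule DERIV_diff[OF l[OF that]]) (auto intro!: derivative_eq_intros)
      then have "((\<lambda>t. F t \<bullet> i) has_real_derivative (l i - L)) (at t)" by simp
      then show ?thesis by (rule iffD1[OF has_real_derivative_iff_has_vector_derivative])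
    qed
    then have "(F has_vector_derivative (\<Sum>i\<in>Basis. (l i - L) *\<^sub>R i)) (at t)"
      unfolding has_vector_derivative_def
      by (subst has_derivative_componentwise_within) (auto simp: inner_sum_left_Basis inner_simps)
    then have "(F has_vector_derivative (\<Sum>i\<in>Basis. (l i - L) *\<^sub>R i)) (at t within {a..b})"
      by (rule has_vector_derivative_at_within)
    moreover have "F s = f s" if "s \<in> {a..b}" for s using that by (auto simp: F_def)
    ultimately show "\<exists>v. (f has_vector_derivative v) (at t within {a..b})"
      using has_vector_derivative_transform[OF t] by metis
  qed
qed auto

section \<open>Absolutely continuous functions\<close>

lemma division_of_realE:
  assumes "d division_of (S :: real set)" "k \<in> d"
  obtains u v where "k = {u..v}" "u \<le> v"
proof -
  obtain u v where k: "k = cbox u v" using division_ofD(4)[OF assms] by blast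
  moreover have "k \<noteq> {}" using division_ofD(3)[OF assms] .
  ultimately show thesis using that by auto
qed

lemma abs_continuous_onE:
  assumes "abs_continuous_on a b x" "0 < e"
  obtains \<delta> where "0 < \<delta>" "\<forall>d S. d division_of S \<and> S \<subseteq> {a..b} \<and> (\<Sum>k\<in>d. Sup k - Inf k) < \<delta>
    \<longrightarrow> (\<Sum>k\<in>d. norm (x (Sup k) - x (Inf k))) < e"
  using assms unfolding abs_continuous_on_def by blast

lemma abs_continuous_on_subset:
  assumes "abs_continuous_on a b x" "{c..d} \<subseteq> {a..b}"
  shows "abs_continuous_on c d x"
  using assms unfolding abs_continuous_on_def by (meson order_trans)

lemma lipschitz_imp_abs_continuous_on:
  assumes lip: "L-lipschitz_on {a..b} x"
  shows "abs_continuous_on a b x"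
  unfolding abs_continuous_on_def
proof (intro allI impI)
  fix e :: real assume e: "0 < e"
  have L0: "0 \<le> L" using lip by (rule lipschitz_on_nonneg)
  show "\<exists>\<delta>>0. \<forall>d S. d division_of S \<and> S \<subseteq> {a..b} \<and> (\<Sum>k\<in>d. Sup k - Inf k) < \<delta> \<longrightarrow>
    (\<Sum>k\<in>d. norm (x (Sup k) - x (Inf k))) < e"
  proof (intro exI[of _ "e / (L + 1)"] conjI allI impI)
    fix d S assume d: "d division_of S \<and> S \<subseteq> {a..b} \<and> (\<Sum>k\<in>d. Sup k - Inf k) < e / (L + 1)"
    have le: "norm (x (Sup k) - x (Inf k)) \<le> L * (Sup k - Inf k) \<and> 0 \<le> Sup k - Inf k"
      if kd: "k \<in> d" for k
    proof -
      obtain u v where k: "k = {u..v}" "u \<le> v"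
        using division_of_realE[OF conjunct1[OF d] kd] .
      then have "{u..v} \<subseteq> {a..b}" using division_ofD(2)[OF conjunct1[OF d] kd] d by blast
      then have "u \<in> {a..b}" "v \<in> {a..b}" using k by auto
      with lipschitz_onD[OF lip this(2,1)] k show ?thesis by (simp add: dist_norm)
    qed
    have "(\<Sum>k\<in>d. norm (x (Sup k) - x (Inf k))) \<le> (\<Sum>k\<in>d. L * (Sup k - Inf k))"
      using le by (intro sum_mono) auto
    also have "\<dots> = L * (\<Sum>k\<in>d. Sup k - Inf k)" by (simp add: sum_distrib_left)
    also have "\<dots> \<le> (L + 1) * (\<Sum>k\<in>d. Sup k - Inf k)"
      using le by (intro mult_right_mono sum_nonneg) auto
    also have "\<dots> < e" using d L0 by (simp add: field_simps)
    finally show "(\<Sum>k\<in>d. norm (x (Sup k) - x (Inf k))) < e" .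
  qed (use e L0 in auto)
qed

lemma abs_continuous_on_imp_continuous_on:
  assumes "abs_continuous_on a b x"
  shows "continuous_on {a..b} x"
  unfolding continuous_on_iff
proof (intro ballI allI impI)
  fix t e :: real assume t: "t \<in> {a..b}" and e: "0 < e"
  obtain \<delta> where \<delta>: "0 < \<delta>" and D': "\<forall>d S. d division_of S \<and> S \<subseteq> {a..b} \<and> (\<Sum>k\<in>d. Sup k - Inf k) < \<delta>
      \<longrightarrow> (\<Sum>k\<in>d. norm (x (Sup k) - x (Inf k))) < e"
    by (rule abs_continuous_onE[OF assms e])
  note D = D'[rule_format, OF conjI, OF _ conjI]
  have *: "norm (x v - x u) < e" if "u \<le> v" "u \<in> {a..b}" "v \<in> {a..b}" "v - u < \<delta>" for u v
  proof -
    have "{cbox u v} division_of cbox u v" using that by (intro division_of_self) auto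
    from D[OF this] that show ?thesis by simp
  qed
  show "\<exists>d>0. \<forall>s\<in>{a..b}. dist s t < d \<longrightarrow> dist (x s) (x t) < e"
  proof (intro exI[of _ \<delta>] conjI ballI impI \<delta>)
    fix s assume "s \<in> {a..b}" "dist s t < \<delta>"
    then show "dist (x s) (x t) < e"
      using *[of s t] *[of t s] t by (cases "s \<le> t") (auto simp: dist_norm norm_minus_commute)
  qed
qed

text \<open>One criterion for expressions built from absolutely continuous curves: it serves the
  product with an exponential in Gronwall's lemma and the squared P-distance of two
  solutions.\<close>

lemma abs_continuous_on_dominated:
  assumes x: "abs_continuous_on a b x" and y: "abs_continuous_on a b y"
    and C: "0 \<le> C"
    and W: "\<And>u v. u \<in> {a..b} \<Longrightarrow> v \<in> {a..b} \<Longrightarrow> u \<le> v \<Longrightarrow>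
      norm (W v - W u) \<le> C * (norm (x v - x u) + norm (y v - y u) + (v - u))"
  shows "abs_continuous_on a b W"
  unfolding abs_continuous_on_def
proof (intro allI impI)
  fix e :: real assume e: "0 < e"
  define e' where "e' = e / (3 * (C + 1))"
  have e': "0 < e'" using e C by (simp add: e'_def)
  obtain \<delta>1 where \<delta>1: "0 < \<delta>1" and D1': "\<forall>d S. d division_of S \<and> S \<subseteq> {a..b} \<and> (\<Sum>k\<in>d. Sup k - Inf k) < \<delta>1
      \<longrightarrow> (\<Sum>k\<in>d. norm (x (Sup k) - x (Inf k))) < e'"
    by (rule abs_continuous_onE[OF x e'])
  note D1 = D1'[rule_format, OF conjI, OF _ conjI]
  obtain \<delta>2 where \<delta>2: "0 < \<delta>2" and D2': "\<forall>d S. d division_of S \<and> S \<subseteq> {a..b} \<and> (\<Sum>k\<in>d. Sup k - Inf k) < \<delta>2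
      \<longrightarrow> (\<Sum>k\<in>d. norm (y (Sup k) - y (Inf k))) < e'"
    by (rule abs_continuous_onE[OF y e'])
  note D2 = D2'[rule_format, OF conjI, OF _ conjI]
  show "\<exists>\<delta>>0. \<forall>d S. d division_of S \<and> S \<subseteq> {a..b} \<and> (\<Sum>k\<in>d. Sup k - Inf k) < \<delta> \<longrightarrow>
    (\<Sum>k\<in>d. norm (W (Sup k) - W (Inf k))) < e"
  proof (intro exI[of _ "min e' (min \<delta>1 \<delta>2)"] conjI allI impI)
    fix d S assume d: "d division_of S \<and> S \<subseteq> {a..b} \<and> (\<Sum>k\<in>d. Sup k - Inf k) < min e' (min \<delta>1 \<delta>2)"
    have le: "norm (W (Sup k) - W (Inf k)) \<le>
        C * (norm (x (Sup k) - x (Inf k)) + norm (y (Sup k) - y (Inf k)) + (Sup k - Inf k))"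
      if kd: "k \<in> d" for k
    proof -
      obtain u v where k: "k = {u..v}" "u \<le> v"
        using division_of_realE[OF conjunct1[OF d] kd] .
      then have "{u..v} \<subseteq> {a..b}" using division_ofD(2)[OF conjunct1[OF d] kd] d by blast
      then have "u \<in> {a..b}" "v \<in> {a..b}" using k by auto
      with W[OF this k(2)] k show ?thesis by simp
    qed
    have "(\<Sum>k\<in>d. norm (W (Sup k) - W (Inf k))) \<le>
      (\<Sum>k\<in>d. C * (norm (x (Sup k) - x (Inf k)) + norm (y (Sup k) - y (Inf k)) + (Sup k - Inf k)))"
      using le by (intro sum_mono) auto
    also have "\<dots> = C * ((\<Sum>k\<in>d. norm (x (Sup k) - x (Inf k))) +
        (\<Sum>k\<in>d. norm (y (Sup k) - y (Inf k))) + (\<Sum>k\<in>d. Sup k - Inf k))"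
      by (simp only: sum_distrib_left[symmetric] sum.distrib)
    also have "\<dots> \<le> C * (e' + e' + e')"
      using C D1[of d S] D2[of d S] d by (intro mult_left_mono) auto
    also have "\<dots> < (C + 1) * (3 * e')" using C e' by (simp add: algebra_simps)
    also have "\<dots> = e" using C by (simp add: e'_def field_simps)
    finally show "(\<Sum>k\<in>d. norm (W (Sup k) - W (Inf k))) < e" .
  qed (use e' \<delta>1 \<delta>2 in auto)
qed

text \<open>By Cousin's lemma there is a tagged division whose intervals with tag in the exceptional null set
  lie in an open set of small measure; the other intervals contribute almost nonpositive increments.\<close>

lemma abs_continuous_AE_nonpos_derivative_imp_le:
  fixes W :: "real \<Rightarrow> real"
  assumes ab: "a \<le> b" and ac: "abs_continuous_on a b W"
    and der: "AE t in lebesgue. t \<in> {a..b} \<longrightarrow>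
      (\<exists>v. (W has_real_derivative v) (at t within {a..b}) \<and> v \<le> 0)"
  shows "W b \<le> W a"
proof -
  obtain N where N: "{t \<in> space lebesgue. \<not> (t \<in> {a..b} \<longrightarrow>
      (\<exists>v. (W has_real_derivative v) (at t within {a..b}) \<and> v \<le> 0))} \<subseteq> N"
    "emeasure lebesgue N = 0" "N \<in> sets lebesgue"
    using AE_E[OF der] by blast
  have le: "W b - W a \<le> e * (b - a) + e" if e: "0 < e" for e
  proof -
    obtain \<delta> where \<delta>: "0 < \<delta>" and D': "\<forall>d S. d division_of S \<and> S \<subseteq> {a..b} \<and> (\<Sum>k\<in>d. Sup k - Inf k) < \<delta>
      \<longrightarrow> (\<Sum>k\<in>d. norm (W (Sup k) - W (Inf k))) < e"
      by (rule abs_continuous_onE[OF ac e])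
    note D = D'[rule_format, OF conjI, OF _ conjI]
    obtain U where U: "open U" "N \<subseteq> U" "U - N \<in> lmeasurable" "emeasure lebesgue (U - N) < ennreal \<delta>"
      using sets_lebesgue_outer_open[OF N(3) \<delta>] by metis
    have "N \<in> null_sets lebesgue" using N(2,3) by auto
    then have "emeasure lebesgue U = emeasure lebesgue (U - N)"
      using U(1) by (simp add: emeasure_Diff_null_set)
    then have U\<delta>: "emeasure lebesgue U < ennreal \<delta>" using U(4) by simp
    define Q where "Q t d \<longleftrightarrow> (\<forall>s\<in>{a..b}. \<bar>s - t\<bar> < d \<longrightarrow>
        (t \<le> s \<longrightarrow> W s - W t \<le> e * (s - t)) \<and> (s \<le> t \<longrightarrow> W t - W s \<le> e * (t - s)))" for t d
    have "\<exists>d>0. Q t d"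
      if tN: "t \<in> {a..b}" "t \<notin> N" for t
    proof -
      obtain v where v: "(W has_real_derivative v) (at t within {a..b})" "v \<le> 0"
        using N(1) tN by (auto simp: subset_iff)
      then have "((\<lambda>s. (W s - W t) / (s - t)) \<longlongrightarrow> v) (at t within {a..b})"
        by (simp add: has_field_derivative_iff)
      then have "eventually (\<lambda>s. (W s - W t) / (s - t) < e) (at t within {a..b})"
        by (rule order_tendstoD(2)) (use v(2) e in linarith)
      then obtain d where d: "0 < d" "\<And>s. s \<in> {a..b} \<Longrightarrow> s \<noteq> t \<Longrightarrow> dist s t < d \<Longrightarrow> (W s - W t) / (s - t) < e"
        unfolding eventually_at by blast
      show ?thesis
        unfolding Q_def
      proof (intro exI[of _ d] conjI ballI impI d(1))
        fix s assume s: "s \<in> {a..b}" "\<bar>s - t\<bar> < d"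
        show "W s - W t \<le> e * (s - t)" if "t \<le> s"
          using d(2)[of s] s that by (cases "s = t") (auto simp: dist_real_def field_simps)
        show "W t - W s \<le> e * (t - s)" if "s \<le> t"
          using d(2)[of s] s that by (cases "s = t") (auto simp: dist_real_def field_simps)
      qed
    qed
    then obtain r where r: "\<And>t. t \<in> {a..b} \<Longrightarrow> t \<notin> N \<Longrightarrow> 0 < r t \<and> Q t (r t)"
      by metis
    \<comment> \<open>Intervals tagged in \<open>N\<close> are forced into the small set
      \<open>U\<close>, those tagged elsewhere into the range of the derivative estimate. Radius 1
      outside \<open>{a..b}\<close> is a filler that keeps \<open>\<gamma>\<close> a gauge; no tag
      lies there.\<close>
    define \<gamma> where "\<gamma> t = (if t \<in> N then U else if t \<in> {a..b} then ball t (r t) else ball t 1)" for t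
    have "gauge \<gamma>" using U r by (auto simp: gauge_def \<gamma>_def)
    then obtain p where p: "p tagged_division_of {a..b}" "\<gamma> fine p"
      by (rule fine_division_exists_real)
    have fin: "finite p" using p by auto
    have box: "\<exists>u v. k = {u..v} \<and> a \<le> u \<and> u \<le> t \<and> t \<le> v \<and> v \<le> b" if "(t, k) \<in> p" for t k
      using tagged_division_ofD(2-4)[OF p(1) that] by auto
    define p1 where "p1 = {x \<in> p. fst x \<notin> N}"
    define p2 where "p2 = {x \<in> p. fst x \<in> N}"
    let ?f = "\<lambda>(t::real, k). W (Sup k) - W (Inf k)"
    have "W b - W a = sum ?f p" by (rule additive_tagged_division_1[OF ab p(1), symmetric])
    also have "\<dots> = sum ?f p1 + sum ?f p2"
      using fin by (subst sum.union_disjoint[symmetric]) (auto simp: p1_def p2_def intro!: sum.cong)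
    also have "sum ?f p1 \<le> (\<Sum>(t, k)\<in>p1. e * (Sup k - Inf k))"
    proof (rule sum_mono, clarify)
      fix t k assume tk: "(t, k) \<in> p1"
      then obtain u v where k: "k = {u..v}" "a \<le> u" "u \<le> t" "t \<le> v" "v \<le> b"
        using box[of t k] by (auto simp: p1_def)
      have t: "t \<in> {a..b}" "t \<notin> N" using k tk by (auto simp: p1_def)
      have "k \<subseteq> ball t (r t)" using fineD[OF p(2), of t k] tk t by (auto simp: p1_def \<gamma>_def)
      moreover have "u \<in> k" "v \<in> k" using k by auto
      ultimately have "u \<in> ball t (r t)" "v \<in> ball t (r t)" by blast+
      then have "\<bar>u - t\<bar> < r t" "\<bar>v - t\<bar> < r t" by (auto simp: dist_real_def)
      then have "W v - W t \<le> e * (v - t)" "W t - W u \<le> e * (t - u)"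
        using k t r[OF t] unfolding Q_def by auto
      then show "W (Sup k) - W (Inf k) \<le> e * (Sup k - Inf k)" using k by (simp add: algebra_simps)
    qed
    also have "\<dots> \<le> (\<Sum>(t, k)\<in>p. e * (Sup k - Inf k))"
      using fin box e by (intro sum_mono2) (fastforce simp: p1_def)+
    also have "\<dots> = e * (\<Sum>(t, k)\<in>p. Sup k - Inf k)"
      by (simp add: sum_distrib_left case_prod_beta)
    also have "(\<Sum>(t, k)\<in>p. Sup k - Inf k) = b - a"
      using additive_tagged_division_1[OF ab p(1), of "\<lambda>x. x"] by simp
    also have "sum ?f p2 \<le> e"
    proof -
      \<comment> \<open>Absolute continuity speaks of divisions, so the tags must be dropped. Since
        \<open>?g\<close> vanishes on the empty set and on single points, this is harmless even if a
        degenerate interval carries several tags.\<close>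
      let ?g = "\<lambda>k. if k = {} then 0 else norm (W (Sup k) - W (Inf k))"
      have part: "p2 tagged_partial_division_of {a..b}"
        using p(1) by (rule tagged_partial_division_subset[OF tagged_division_of_def[THEN iffD1, THEN conjunct1]])
          (auto simp: p2_def)
      have ne: "k \<noteq> {}" if "(t, k) \<in> p2" for t k using box[of t k] that by (auto simp: p2_def)
      note div = partial_division_of_tagged_division[OF part]
      have "sum ?f p2 \<le> (\<Sum>(t, k)\<in>p2. ?g k)"
        using ne by (intro sum_mono) auto
      also have "\<dots> = sum ?g (snd ` p2)"
      proof (rule sum.over_tagged_division_lemma[OF tagged_partial_division_of_Union_self[OF part]])
        fix u v :: real assume "box u v = {}"
        then show "?g (cbox u v) = 0" by (cases "u = v") auto
      qed
      also have "\<dots> = (\<Sum>k\<in>snd ` p2. norm (W (Sup k) - W (Inf k)))"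
        using ne by (intro sum.cong) auto
      also have "\<dots> < e"
      proof (rule D[OF div])
        have snd_p2: "\<exists>t. (t, k) \<in> p \<and> t \<in> N" if "k \<in> snd ` p2" for k
          using that by (auto simp: p2_def)
        show "\<Union> (snd ` p2) \<subseteq> {a..b}"
          using snd_p2 tagged_division_ofD(3)[OF p(1)] by (meson Union_least)
        have "(\<Sum>k\<in>snd ` p2. Sup k - Inf k) = (\<Sum>k\<in>snd ` p2. measure lebesgue k)"
        proof (rule sum.cong[OF refl])
          fix k assume "k \<in> snd ` p2"
          then obtain t where "(t, k) \<in> p" using snd_p2 by blast
          then obtain u v where "k = {u..v}" "u \<le> t" "t \<le> v" using box by blast
          then show "Sup k - Inf k = measure lebesgue k" by simp
        qed
        also have "\<dots> = measure lebesgue (\<Union> (snd ` p2))" by (rule content_division[OF div])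
        also have "\<dots> < \<delta>"
        proof -
          have "k \<subseteq> U" if k: "k \<in> snd ` p2" for k
          proof -
            obtain t where t: "(t, k) \<in> p" "t \<in> N" using snd_p2[OF k] by blast
            show ?thesis using fineD[OF p(2) t(1)] t(2) by (simp add: \<gamma>_def)
          qed
          then have sub: "\<Union> (snd ` p2) \<subseteq> U" by (rule Union_least)
          have "\<Union> (snd ` p2) \<in> lmeasurable" by (rule lmeasurable_division[OF div])
          have "emeasure lebesgue (\<Union> (snd ` p2)) \<le> emeasure lebesgue U"
            by (rule emeasure_mono[OF sub]) (use U(1) in simp)
          then have "emeasure lebesgue (\<Union> (snd ` p2)) < ennreal \<delta>" using U\<delta> by (rule le_less_trans)
          then show ?thesis using \<open>\<Union> (snd ` p2) \<in> lmeasurable\<close>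
            by (simp add: emeasure_eq_measure2 ennreal_less_iff)
        qed
        finally show "(\<Sum>k\<in>snd ` p2. Sup k - Inf k) < \<delta>" .
      qed
      finally show ?thesis by simp
    qed
    finally show ?thesis by simp
  qed
  show ?thesis
  proof (rule ccontr)
    assume "\<not> W b \<le> W a"
    then have "0 < W b - W a" by simp
    define e where "e = (W b - W a) / (2 * (b - a + 1))"
    have "0 < e" using \<open>0 < W b - W a\<close> ab by (simp add: e_def)
    then have "W b - W a \<le> e * (b - a + 1)" using le[of e] by (simp add: algebra_simps)
    also have "\<dots> = (W b - W a) / 2" using ab by (simp add: e_def field_simps)
    finally show False using \<open>0 < W b - W a\<close> by simp
  qed
qed

text \<open>The integrating factor \<open>exp (- (L * (t - a)))\<close> turns the hypothesis into a
  nonpositive derivative of \<open>W\<close> almost everywhere. The product stays absolutely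
  continuous because \<open>V\<close> is bounded on the compact interval.\<close>

lemma abs_continuous_gronwall_zero:
  fixes V :: "real \<Rightarrow> real"
  assumes ac: "abs_continuous_on a b V" and Va: "V a = 0" and V0: "\<And>t. 0 \<le> V t" and L: "0 \<le> L"
    and der: "AE t in lebesgue. t \<in> {a..b} \<longrightarrow>
      (\<exists>v. (V has_real_derivative v) (at t within {a..b}) \<and> v \<le> L * V t)"
    and t: "t \<in> {a..b}"
  shows "V t = 0"
proof -
  define W where "W t = exp (- (L * (t - a))) * V t" for t
  have "compact (V ` {a..b})"
    using abs_continuous_on_imp_continuous_on[OF ac] by (intro compact_continuous_image) auto
  then obtain M where M: "\<And>s. s \<in> {a..b} \<Longrightarrow> \<bar>V s\<bar> \<le> M"
    by (metis bounded_iff compact_imp_bounded imageI real_norm_def)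
  have M0: "0 \<le> M" using M[OF t] by linarith
  \<comment> \<open>In the constant \<open>1 + M * L\<close>, the 1 bounds the exponential factor
    and \<open>M * L\<close> is its Lipschitz constant times the bound for \<open>V\<close>.\<close>
  have "abs_continuous_on a b W"
  proof (rule abs_continuous_on_dominated[OF ac ac, where C = "1 + M * L"])
    fix u v assume uv: "u \<in> {a..b}" "v \<in> {a..b}" "u \<le> v"
    have ev: "exp (- (L * (v - a))) \<le> 1" using uv L by simp
    have "exp (- (L * (u - a))) - exp (- (L * (v - a))) =
        exp (- (L * (u - a))) * (1 - exp (- (L * (v - u))))"
      by (simp add: algebra_simps exp_add[symmetric] flip: exp_minus)
    also have "\<dots> \<le> 1 * (1 - exp (- (L * (v - u))))"
      using uv L by (intro mult_right_mono) auto
    also have "\<dots> \<le> L * (v - u)" using exp_ge_add_one_self[of "- (L * (v - u))"] by simp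
    finally have e2: "exp (- (L * (u - a))) - exp (- (L * (v - a))) \<le> L * (v - u)" .
    have e3: "exp (- (L * (v - a))) \<le> exp (- (L * (u - a)))"
      using uv L by (auto intro!: mult_left_mono)
    have "W v - W u = exp (- (L * (v - a))) * (V v - V u)
        - (exp (- (L * (u - a))) - exp (- (L * (v - a)))) * V u"
      by (simp add: W_def algebra_simps)
    then have "\<bar>W v - W u\<bar> \<le> \<bar>exp (- (L * (v - a))) * (V v - V u)\<bar>
        + \<bar>(exp (- (L * (u - a))) - exp (- (L * (v - a)))) * V u\<bar>"
      by linarith
    also have "\<dots> \<le> 1 * \<bar>V v - V u\<bar> + (L * (v - u)) * M"
      unfolding abs_mult using ev e2 e3 M[OF uv(1)] uv L
      by (intro add_mono mult_mono) auto
    also have "\<dots> \<le> (1 + M * L) * (\<bar>V v - V u\<bar> + \<bar>V v - V u\<bar> + (v - u))"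
    proof -
      have "0 \<le> M * L * \<bar>V v - V u\<bar>" using M0 L by simp
      then show ?thesis using uv by (simp add: algebra_simps)
    qed
    finally show "norm (W v - W u) \<le> (1 + M * L) * (norm (V v - V u) + norm (V v - V u) + (v - u))"
      by simp
  qed (use M0 L in simp)
  then have acW: "abs_continuous_on a t W" by (rule abs_continuous_on_subset) (use t in auto)
  have "W t \<le> W a"
  proof (rule abs_continuous_AE_nonpos_derivative_imp_le[OF _ acW])
    show "AE s in lebesgue. s \<in> {a..t} \<longrightarrow>
        (\<exists>v. (W has_real_derivative v) (at s within {a..t}) \<and> v \<le> 0)"
      using der
    proof (rule AE_mp, intro AE_I2 impI)
      fix s assume *: "s \<in> {a..b} \<longrightarrow> (\<exists>v. (V has_real_derivative v) (at s within {a..b}) \<and> v \<le> L * V s)"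
        and s: "s \<in> {a..t}"
      then obtain v where v: "(V has_real_derivative v) (at s within {a..b})" "v \<le> L * V s"
        using t by auto
      have v': "(V has_real_derivative v) (at s within {a..t})"
        using v(1) by (rule DERIV_subset) (use t in auto)
      have "(W has_real_derivative exp (- (L * (s - a))) * (v - L * V s)) (at s within {a..t})"
        unfolding W_def by (rule derivative_eq_intros v' refl)+ (simp add: algebra_simps)
      moreover have "exp (- (L * (s - a))) * (v - L * V s) \<le> 0"
        using v(2) by (simp add: mult_nonneg_nonpos)
      ultimately show "\<exists>v. (W has_real_derivative v) (at s within {a..t}) \<and> v \<le> 0" by blast
    qed
  qed (use t in auto)
  then have "V t \<le> 0" by (simp add: W_def Va mult_le_0_iff)
  then show ?thesis using V0[of t] by simp
qed

section \<open>Maximal monotone operators\<close>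

text \<open>Adjoining one point monotonically related to the graph yields a monotone extension,
  which maximality collapses back to \<open>F\<close>.\<close>

lemma maximal_monotone_memI:
  assumes F: "maximal_monotone F" and rel: "\<And>z' \<eta>'. \<eta>' \<in> F z' \<Longrightarrow> (\<eta> - \<eta>') \<bullet> (z - z') \<ge> 0"
  shows "\<eta> \<in> F z"
proof -
  define H where "H = F(z := insert \<eta> (F z))"
  have mono: "\<And>z1 z2 \<eta>1 \<eta>2. \<eta>1 \<in> F z1 \<Longrightarrow> \<eta>2 \<in> F z2 \<Longrightarrow> (\<eta>1 - \<eta>2) \<bullet> (z1 - z2) \<ge> 0"
    using F by (auto simp: maximal_monotone_def monotone_op_def)
  have HD: "\<zeta> \<in> F y \<or> (\<zeta> = \<eta> \<and> y = z)" if "\<zeta> \<in> H y" for \<zeta> y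
    using that by (auto simp: H_def split: if_splits)
  have rel': "(\<eta>' - \<eta>) \<bullet> (z' - z) \<ge> 0" if "\<eta>' \<in> F z'" for z' \<eta>'
    using rel[OF that] by (simp add: inner_diff_left inner_diff_right algebra_simps)
  have "monotone_op H"
    unfolding monotone_op_def
  proof (intro allI ballI)
    fix z1 z2 \<eta>1 \<eta>2 assume "\<eta>1 \<in> H z1" "\<eta>2 \<in> H z2"
    from HD[OF this(1)] HD[OF this(2)] show "(\<eta>1 - \<eta>2) \<bullet> (z1 - z2) \<ge> 0"
      using mono rel rel' by auto
  qed
  moreover have "\<forall>y. F y \<subseteq> H y" by (auto simp: H_def)
  ultimately have "H = F" using F by (simp add: maximal_monotone_def)
  then have "F z = insert \<eta> (F z)" by (metis H_def fun_upd_same)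
  then show ?thesis by blast
qed

text \<open>The point is the saddle point of a quadratic Lagrangian: the maximiser of the concave dual
  function over the convex hull of the finitely many data \<open>(\<eta>, z, \<eta> \<bullet> z)\<close> exists by compactness, and
  monotonicity of the data makes the dual function nonpositive.\<close>

lemma monotone_finite_extension:
  fixes E :: "'a::euclidean_space \<Rightarrow> 'a"
  assumes E: "linear E" and \<mu>: "0 < \<mu>" and pos: "\<And>x. \<mu> * (x \<bullet> x) \<le> E x \<bullet> x"
    and I: "finite I"
    and mono: "\<And>z1 \<eta>1 z2 \<eta>2. (z1, \<eta>1) \<in> I \<Longrightarrow> (z2, \<eta>2) \<in> I \<Longrightarrow> (\<eta>1 - \<eta>2) \<bullet> (z1 - z2) \<ge> 0"
  shows "\<exists>\<eta>. \<forall>(z', \<eta>')\<in>I. (\<eta> - \<eta>') \<bullet> (E \<eta> - w + z') \<le> 0"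
proof (cases "I = {}")
  case False
  have Epos: "0 \<le> E x \<bullet> x" for x
    using pos[of x] \<mu> by (meson inner_ge_zero less_imp_le mult_nonneg_nonneg order_trans)
  define E' where "E' = adjoint E"
  have E': "linear E'" unfolding E'_def by (rule adjoint_linear[OF E])
  have adj: "x \<bullet> E' y = E x \<bullet> y" for x y unfolding E'_def by (rule adjoint_works[OF E])
  \<comment> \<open>\<open>E\<close> need not be symmetric; the quadratic form it defines has
    gradient \<open>H\<close>, so inverting \<open>H\<close> locates the minimiser of the Lagrangian
    in \<open>\<eta>\<close>.\<close>
  define H where "H x = E x + E' x" for x
  have H: "linear H" unfolding H_def by (intro linear_compose_add E E')
  have "inj H"
    unfolding linear_injective_0[OF H]
  proof (intro allI impI)
    fix x assume "H x = 0"
    then have "x \<bullet> H x = 0" by simp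
    then have "E x \<bullet> x = 0" by (simp add: H_def inner_add_right adj inner_commute)
    then have "x \<bullet> x \<le> 0" using pos[of x] \<mu> by (simp add: mult_le_0_iff)
    then show "x = 0" by (metis antisym inner_eq_zero_iff inner_ge_zero)
  qed
  then obtain J where J: "linear J" "\<And>x. H (J x) = x"
    using linear_injective_isomorphism[OF H] by blast
  define v where "v p = E' (fst p) + w - fst (snd p)" for p :: "'a \<times> 'a \<times> real"
  \<comment> \<open>Arranged to be affine in the data \<open>p\<close> and to equal, at a data
    point, the product that has to be made nonpositive.\<close>
  define L where "L \<eta> p = \<eta> \<bullet> E \<eta> - \<eta> \<bullet> v p + fst p \<bullet> w - snd (snd p)" for \<eta> and p :: "'a \<times> 'a \<times> real"
  define \<psi> where "\<psi> p = L (J (v p)) p" for p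
  have min: "\<psi> p \<le> L \<eta> p" for \<eta> p
  proof -
    define \<zeta> where "\<zeta> = J (v p)"
    have vp: "v p = H \<zeta>" by (simp add: \<zeta>_def J)
    have "L \<eta> p - \<psi> p = E (\<eta> - \<zeta>) \<bullet> (\<eta> - \<zeta>)"
      unfolding \<psi>_def L_def \<zeta>_def[symmetric] unfolding vp H_def linear_diff[OF E]
      by (simp add: inner_add_right inner_diff_left inner_diff_right adj inner_commute algebra_simps)
    then show ?thesis using Epos[of "\<eta> - \<zeta>"] by simp
  qed
  define dat where "dat i = (snd i, fst i, snd i \<bullet> fst i)" for i :: "'a \<times> 'a"
  have Ldat: "L \<eta> (dat (z', \<eta>')) = (\<eta> - \<eta>') \<bullet> (E \<eta> - w + z')" for \<eta> z' \<eta>'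
    unfolding L_def v_def dat_def
    by (simp add: inner_add_right inner_diff_left inner_diff_right adj inner_commute algebra_simps)
  define S where "S = convex hull (dat ` I)"
  have S: "compact S" "S \<noteq> {}"
    using I False by (auto simp: S_def intro: compact_convex_hull finite_imp_compact)
  \<comment> \<open>Monotonicity of the data is affine in \<open>p\<close> and in \<open>q\<close>
    separately, so it passes to the hull one variable at a time. On the diagonal it reads
    \<open>a \<bullet> b \<le> c\<close>, the inequality behind
    \<open>\<psi> p \<le> 0\<close>.\<close>
  have datmono: "fst p \<bullet> fst (snd q) + fst q \<bullet> fst (snd p) \<le> snd (snd p) + snd (snd q)"
    if "p \<in> S" "q \<in> S" for p q
  proof -
    have cvx: "convex {p. fst p \<bullet> fst (snd q) + fst q \<bullet> fst (snd p) \<le> snd (snd p) + snd (snd q)}"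
      for q :: "'a \<times> 'a \<times> real"
    proof (rule convexI, unfold mem_Collect_eq)
      fix p1 p2 :: "'a \<times> 'a \<times> real" and s t :: real
      assume *: "0 \<le> s" "0 \<le> t" "s + t = 1"
        "fst p1 \<bullet> fst (snd q) + fst q \<bullet> fst (snd p1) \<le> snd (snd p1) + snd (snd q)"
        "fst p2 \<bullet> fst (snd q) + fst q \<bullet> fst (snd p2) \<le> snd (snd p2) + snd (snd q)"
      have "s * (fst p1 \<bullet> fst (snd q) + fst q \<bullet> fst (snd p1)) + t * (fst p2 \<bullet> fst (snd q) + fst q \<bullet> fst (snd p2))
        \<le> s * (snd (snd p1) + snd (snd q)) + t * (snd (snd p2) + snd (snd q))"
        by (rule add_mono[OF mult_left_mono[OF *(4) *(1)] mult_left_mono[OF *(5) *(2)]])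
      also have "\<dots> = s * snd (snd p1) + t * snd (snd p2) + (s + t) * snd (snd q)"
        by (simp add: algebra_simps)
      also have "\<dots> = s * snd (snd p1) + t * snd (snd p2) + snd (snd q)" using *(3) by simp
      finally show "fst (s *\<^sub>R p1 + t *\<^sub>R p2) \<bullet> fst (snd q) + fst q \<bullet> fst (snd (s *\<^sub>R p1 + t *\<^sub>R p2))
        \<le> snd (snd (s *\<^sub>R p1 + t *\<^sub>R p2)) + snd (snd q)"
        by (simp add: inner_add_left inner_add_right algebra_simps)
    qed
    have base: "fst p \<bullet> fst (snd q) + fst q \<bullet> fst (snd p) \<le> snd (snd p) + snd (snd q)"
      if pq: "p \<in> dat ` I" "q \<in> dat ` I" for p q
    proof -
      obtain z1 \<eta>1 z2 \<eta>2 where i: "(z1, \<eta>1) \<in> I" "(z2, \<eta>2) \<in> I" "p = dat (z1, \<eta>1)" "q = dat (z2, \<eta>2)"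
        using pq by auto
      from mono[OF i(1,2)] show ?thesis
        by (simp add: i dat_def inner_diff_left inner_diff_right inner_commute algebra_simps)
    qed
    have half: "fst p \<bullet> fst (snd q) + fst q \<bullet> fst (snd p) \<le> snd (snd p) + snd (snd q)"
      if "p \<in> S" "q \<in> dat ` I" for p q
    proof -
      have "S \<subseteq> {p. fst p \<bullet> fst (snd q) + fst q \<bullet> fst (snd p) \<le> snd (snd p) + snd (snd q)}"
        unfolding S_def using base that(2) by (intro hull_minimal cvx) auto
      with that show ?thesis by blast
    qed
    have "S \<subseteq> {q'. fst q' \<bullet> fst (snd p) + fst p \<bullet> fst (snd q') \<le> snd (snd q') + snd (snd p)}"
      unfolding S_def using half[OF that(1)] by (intro hull_minimal cvx) (auto simp: add.commute)
    with that show ?thesis by (auto simp: add.commute)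
  qed
  have nonpos: "\<psi> p \<le> 0" if "p \<in> S" for p
  proof -
    obtain a b c where p: "p = (a, b, c)" by (metis prod_cases3)
    have c: "a \<bullet> b \<le> c" using datmono[OF that that] by (simp add: p)
    define \<zeta> where "\<zeta> = J (v p)"
    have vp: "v p = H \<zeta>" by (simp add: \<zeta>_def J)
    have "a \<bullet> v p = a \<bullet> H \<zeta>" by (simp add: vp)
    then have "a \<bullet> (w - b) = E a \<bullet> \<zeta> + a \<bullet> E \<zeta> - E a \<bullet> a"
      unfolding v_def p H_def by (simp add: inner_add_right inner_diff_right adj algebra_simps)
    moreover have "\<psi> p = fst p \<bullet> w - snd (snd p) - E \<zeta> \<bullet> \<zeta>"
      unfolding \<psi>_def L_def \<zeta>_def[symmetric] unfolding vp H_def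
      by (simp add: inner_add_right adj inner_commute)
    ultimately have "\<psi> p \<le> - (E (\<zeta> - a) \<bullet> (\<zeta> - a))"
      using c unfolding linear_diff[OF E]
      by (simp add: p inner_diff_left inner_diff_right inner_commute algebra_simps)
    then show ?thesis using Epos[of "\<zeta> - a"] by linarith
  qed
  have contv: "continuous_on X v" for X
    unfolding v_def by (intro continuous_intros linear_continuous_on_compose[OF _ E'])
  have contJv: "continuous_on X (\<lambda>p. J (v p))" for X
    by (intro linear_continuous_on_compose[OF _ J(1)] contv)
  have "continuous_on S \<psi>"
    unfolding \<psi>_def L_def
    by (intro continuous_intros contv contJv linear_continuous_on_compose[OF _ E])
  then obtain p where p: "p \<in> S" "\<And>q. q \<in> S \<Longrightarrow> \<psi> q \<le> \<psi> p"
    using continuous_attains_sup[OF S] by blast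
  define \<eta> where "\<eta> = J (v p)"
  have "L \<eta> (dat i) \<le> 0" if i: "i \<in> I" for i
  proof -
    \<comment> \<open>Moving from the maximiser \<open>p\<close> towards a data point cannot
      increase \<open>\<psi>\<close>. As the Lagrangian is affine in the data, this bounds its value
      at \<open>dat i\<close> and the minimiser belonging to \<open>q t\<close>; letting
      \<open>t\<close> tend to 0 replaces that minimiser by the one belonging to
      \<open>p\<close>.\<close>
    define q where "q t = p + t *\<^sub>R (dat i - p)" for t :: real
    have qS: "q t \<in> S" if "0 \<le> t" "t \<le> 1" for t
    proof -
      have "dat i \<in> S" using i by (auto simp: S_def intro: hull_inc)
      then have "(1 - t) *\<^sub>R p + t *\<^sub>R dat i \<in> S"
        using p(1) that by (intro convexD) (auto simp: S_def)
      then show ?thesis by (simp add: q_def algebra_simps)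
    qed
    have aff: "L \<zeta> (q t) = (1 - t) * L \<zeta> p + t * L \<zeta> (dat i)" for \<zeta> t
      unfolding L_def q_def v_def linear_add[OF E'] linear_cmul[OF E'] linear_diff[OF E'] fst_add fst_scaleR fst_diff
      by (simp add: linear_add[OF E'] linear_cmul[OF E'] linear_diff[OF E'] inner_add_left inner_add_right inner_diff_left inner_diff_right algebra_simps)
    have le: "L (J (v (q t))) (dat i) \<le> \<psi> p" if t: "0 < t" "t \<le> 1" for t
    proof -
      have "(1 - t) * \<psi> p + t * L (J (v (q t))) (dat i) \<le> L (J (v (q t))) (q t)"
        unfolding aff using t by (intro add_mono mult_left_mono min) auto
      also have "\<dots> = \<psi> (q t)" by (simp add: \<psi>_def)
      also have "\<dots> \<le> \<psi> p" using qS t by (intro p(2)) auto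
      finally have "t * L (J (v (q t))) (dat i) \<le> t * \<psi> p" by (simp add: algebra_simps)
      then show ?thesis using t by simp
    qed
    have c1: "continuous_on UNIV (\<lambda>t. J (v (q t)))"
      by (rule continuous_on_compose2[OF contJv[of UNIV]]) (auto simp: q_def intro!: continuous_intros)
    have "continuous_on UNIV (\<lambda>t. L (J (v (q t))) (dat i))"
      unfolding L_def by (intro continuous_intros c1 linear_continuous_on_compose[OF _ E])
    then have "((\<lambda>t. L (J (v (q t))) (dat i)) \<longlongrightarrow> L (J (v (q 0))) (dat i)) (at_right 0)"
      by (meson UNIV_I continuous_on_def filterlim_at_within_If tendsto_within_subset subset_UNIV)
    then have "L (J (v (q 0))) (dat i) \<le> \<psi> p"
    proof (rule tendsto_upperbound)
      show "\<forall>\<^sub>F t in at_right 0. L (J (v (q t))) (dat i) \<le> \<psi> p"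
        unfolding eventually_at_right_field by (intro exI[of _ 1]) (auto intro: le)
    qed simp
    then show ?thesis using nonpos[OF p(1)] by (simp add: q_def \<eta>_def)
  qed
  then show ?thesis using Ldat by (intro exI[of _ \<eta>]) auto
qed auto

text \<open>Minty's theorem, with a not necessarily symmetric linear operator in place of the identity.\<close>

theorem maximal_monotone_solvable:
  fixes E :: "'a::euclidean_space \<Rightarrow> 'a"
  assumes E: "linear E" and \<mu>: "0 < \<mu>" and pos: "\<And>x. \<mu> * (x \<bullet> x) \<le> E x \<bullet> x"
    and F: "maximal_monotone F"
  shows "\<exists>z \<eta>. \<eta> \<in> F z \<and> z + E \<eta> = w"
proof -
  \<comment> \<open>With z = w - E \<eta> inserted, being monotonically related to a graph point is
    a condition on \<open>\<eta>\<close> alone. Coercivity of \<open>E\<close> makes each such set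
    compact, so the finite case passes to the whole graph.\<close>
  define K where "K i = {\<eta>. (\<eta> - snd i) \<bullet> (E \<eta> - w + fst i) \<le> 0}" for i :: "'a \<times> 'a"
  have closed: "closed (K i)" for i
    unfolding K_def by (intro closed_Collect_le continuous_intros linear_continuous_on_compose[OF _ E])
  have bdd: "bounded (K i)" for i
  proof -
    define k where "k = E (snd i) - w + fst i"
    have "norm (\<eta> - snd i) \<le> norm k / \<mu>" if "\<eta> \<in> K i" for \<eta>
    proof (cases "\<eta> = snd i")
      case False
      let ?d = "\<eta> - snd i"
      have eq: "E \<eta> - w + fst i = E ?d + k" by (simp add: k_def linear_diff[OF E])
      then have "?d \<bullet> E ?d + ?d \<bullet> k \<le> 0" using that unfolding K_def mem_Collect_eq eq
        by (simp only: inner_add_right)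
      then have "\<mu> * (norm ?d)\<^sup>2 \<le> norm ?d * norm k"
        using pos[of ?d] Cauchy_Schwarz_ineq2[of ?d k] by (simp add: power2_norm_eq_inner inner_commute)
      then have "\<mu> * norm ?d \<le> norm k" using False by (simp add: power2_eq_square)
      then show ?thesis using \<mu> by (simp add: field_simps)
    qed (use \<mu> in simp)
    then have "K i \<subseteq> cball (snd i) (norm k / \<mu>)" by (auto simp: dist_norm norm_minus_commute)
    then show ?thesis by (meson bounded_cball bounded_subset)
  qed
  let ?G = "{(z, \<eta>). \<eta> \<in> F z}"
  have "\<Inter> (K ` ?G) \<noteq> {}"
  proof (rule compact_fip_Heine_Borel)
    show "compact T" if "T \<in> K ` ?G" for T using that closed bdd by (auto simp: compact_eq_bounded_closed)
    fix \<F> assume "finite \<F>" "\<F> \<subseteq> K ` ?G"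
    then obtain I where I: "finite I" "I \<subseteq> ?G" "\<F> = K ` I" by (meson finite_subset_image)
    have "\<exists>\<eta>. \<forall>(z', \<eta>')\<in>I. (\<eta> - \<eta>') \<bullet> (E \<eta> - w + z') \<le> 0"
      using F I by (intro monotone_finite_extension[OF E \<mu> pos]) (auto simp: maximal_monotone_def monotone_op_def subset_iff)
    then show "\<Inter> \<F> \<noteq> {}" unfolding I(3) by (fastforce simp: K_def)
  qed
  then obtain \<eta> where \<eta>: "\<And>z' \<eta>'. \<eta>' \<in> F z' \<Longrightarrow> (\<eta> - \<eta>') \<bullet> (E \<eta> - w + z') \<le> 0"
    by (fastforce simp: K_def)
  have "\<eta> \<in> F (w - E \<eta>)"
  proof (rule maximal_monotone_memI[OF F])
    fix z' \<eta>' assume "\<eta>' \<in> F z'"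
    have "w - E \<eta> - z' = - (E \<eta> - w + z')" by simp
    then show "0 \<le> (\<eta> - \<eta>') \<bullet> (w - E \<eta> - z')" using \<eta>[OF \<open>\<eta>' \<in> F z'\<close>] by (simp only: inner_minus_right)
  qed
  then show ?thesis by (metis diff_add_cancel)
qed

section \<open>The sweeping process in a quadratic norm\<close>

text \<open>Minimise the squared P-distance over the compact part of \<open>C\<close> that is no
  farther from \<open>u\<close> than \<open>y\<close>; minimality along segments is the variational
  inequality.\<close>

lemma quadratic_projection_exists:
  fixes P :: "'a::euclidean_space \<Rightarrow> 'a"
  assumes P: "linear P" and sym: "\<And>x y. P x \<bullet> y = x \<bullet> P y"
    and \<alpha>: "0 < \<alpha>" and pos: "\<And>x. \<alpha> * (x \<bullet> x) \<le> P x \<bullet> x"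
    and C: "closed C" "convex C" and y: "y \<in> C"
  shows "\<exists>x\<in>C. P (u - x) \<bullet> (u - x) \<le> P (u - y) \<bullet> (u - y) \<and> (\<forall>z\<in>C. P (u - x) \<bullet> (z - x) \<le> 0)"
proof -
  define q where "q x = P (u - x) \<bullet> (u - x)" for x
  have cont: "continuous_on X q" for X
    unfolding q_def by (intro continuous_intros linear_continuous_on_compose[OF _ P])
  have "bounded {x. q x \<le> q y}"
  proof -
    have "norm (u - x) \<le> sqrt (q y / \<alpha>)" if "q x \<le> q y" for x
    proof -
      have "\<alpha> * (norm (u - x))\<^sup>2 \<le> q y"
        using pos[of "u - x"] that by (simp add: q_def power2_norm_eq_inner)
      then show ?thesis using \<alpha> by (intro real_le_rsqrt) (simp add: field_simps)
    qed
    then have "{x. q x \<le> q y} \<subseteq> cball u (sqrt (q y / \<alpha>))" by (auto simp: dist_norm)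
    then show ?thesis by (meson bounded_cball bounded_subset)
  qed
  moreover have "closed (C \<inter> {x. q x \<le> q y})"
    using C(1) cont by (intro closed_Int closed_Collect_le continuous_intros) auto
  ultimately have "compact (C \<inter> {x. q x \<le> q y})"
    by (meson bounded_Int compact_eq_bounded_closed)
  then obtain x where x: "x \<in> C" "q x \<le> q y" "\<And>z. z \<in> C \<Longrightarrow> q z \<le> q y \<Longrightarrow> q x \<le> q z"
    using continuous_attains_inf[of "C \<inter> {x. q x \<le> q y}" q] y cont by auto
  then have min: "q x \<le> q z" if "z \<in> C" for z using that by (meson linear order_trans)
  have "P (u - x) \<bullet> (z - x) \<le> 0" if z: "z \<in> C" for z
  proof (rule ccontr)
    define A where "A = P (u - x) \<bullet> (z - x)"
    define B where "B = P (z - x) \<bullet> (z - x)"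
    assume "\<not> P (u - x) \<bullet> (z - x) \<le> 0"
    then have A: "0 < A" by (simp add: A_def)
    have le: "2 * A \<le> t * B" if t: "0 < t" "t \<le> 1" for t
    proof -
      have "(1 - t) *\<^sub>R x + t *\<^sub>R z \<in> C" using C(2) x(1) z t by (intro convexD) auto
      then have "q x \<le> q (x + t *\<^sub>R (z - x))" using min by (simp add: algebra_simps)
      also have "u - (x + t *\<^sub>R (z - x)) = (u - x) - t *\<^sub>R (z - x)" by simp
      then have "q (x + t *\<^sub>R (z - x)) = q x - 2 * t * A + t * t * B"
        unfolding q_def A_def B_def
        by (simp only: linear_diff[OF P, of "u - x" "t *\<^sub>R (z - x)"] linear_cmul[OF P, of t "z - x"] inner_diff_left[of "P (u - x)"]
          inner_diff_right[of _ "u - x" "t *\<^sub>R (z - x)"] inner_scaleR_left inner_scaleR_right sym[of "z - x" "u - x"])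
          (simp add: inner_commute algebra_simps)
      finally have "t * (2 * A) \<le> t * (t * B)" by simp
      then show ?thesis using t by simp
    qed
    have B: "0 < B" using le[of 1] A by simp
    \<comment> \<open>Minimality gives \<open>2 * A \<le> t * B\<close> for every \<open>t\<close>
      up to 1, whereas this \<open>t\<close> makes \<open>t * B\<close> at most
      \<open>A\<close>.\<close>
    define t where "t = min 1 (A / B)"
    have "0 < t" "t \<le> 1" "t * B \<le> A" using A B by (auto simp: t_def min_def field_simps)
    then show False using le[of t] A by linarith
  qed
  then show ?thesis using x by (intro bexI[of _ x]) (auto simp: q_def)
qed

text \<open>\<open>f\<close> is controlled only on the graph of \<open>S\<close>, since the
  selection of the Lur'e operator is meaningful only there. The condition \<open>lip\<close> holds
  with \<open>s\<close> and \<open>t\<close> exchanged, so it bounds the Hausdorff distance of the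
  moving sets.\<close>

locale sweeping =
  fixes P :: "'a::euclidean_space \<Rightarrow> 'a" and S :: "real \<Rightarrow> 'a set" and f :: "real \<Rightarrow> 'a \<Rightarrow> 'a"
    and \<alpha> a b L c :: real and x0 :: 'a
  assumes P: "linear P" and sym: "\<And>x y. P x \<bullet> y = x \<bullet> P y"
    and \<alpha>: "0 < \<alpha>" and pos: "\<And>x. \<alpha> * (x \<bullet> x) \<le> P x \<bullet> x"
    and ab: "a < b"
    and closed: "\<And>t. t \<in> {a..b} \<Longrightarrow> closed (S t)"
    and convex: "\<And>t. t \<in> {a..b} \<Longrightarrow> convex (S t)"
    and L: "0 \<le> L" and lip: "\<And>s t x. s \<in> {a..b} \<Longrightarrow> t \<in> {a..b} \<Longrightarrow> x \<in> S s \<Longrightarrow>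
      \<exists>y\<in>S t. norm (x - y) \<le> L * \<bar>t - s\<bar>"
    and f_cont: "continuous_on (SIGMA t:{a..b}. S t) (\<lambda>(t, x). f t x)"
    and c: "0 \<le> c" and growth: "\<And>t x. t \<in> {a..b} \<Longrightarrow> x \<in> S t \<Longrightarrow> norm (f t x) \<le> c * (1 + norm x)"
    and x0: "x0 \<in> S a"
begin

lemma P_bound: obtains \<beta> where "0 < \<beta>" "\<And>x. norm (P x) \<le> \<beta> * norm x"
  using linear_bounded_pos[OF P] by blast

text \<open>The predicted point is compared with a point \<open>y\<close> of the next set within
  \<open>L * h\<close> of \<open>x\<close>. The P-projection is at least as close in the P-norm, and
  passing between this norm and the Euclidean one costs the factor
  \<open>sqrt (\<beta> / \<alpha>)\<close> in \<open>\<Gamma>\<close>; the summand 1 there accounts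
  for the drift.\<close>

lemma catching_up_step:
  obtains K where "0 \<le> K"
    "\<And>s h x. s \<in> {a..b} \<Longrightarrow> 0 \<le> h \<Longrightarrow> s + h \<in> {a..b} \<Longrightarrow> x \<in> S s \<Longrightarrow>
      \<exists>x'\<in>S (s + h). norm (x' - x) \<le> K * h * (1 + norm x) \<and>
        (\<forall>z\<in>S (s + h). P (x + h *\<^sub>R f s x - x') \<bullet> (z - x') \<le> 0)"
proof -
  obtain \<beta> where \<beta>: "0 < \<beta>" "\<And>x. norm (P x) \<le> \<beta> * norm x" using P_bound by blast
  define \<Gamma> where "\<Gamma> = 1 + sqrt (\<beta> / \<alpha>)"
  show thesis
  proof (rule that[of "\<Gamma> * (c + L)"])
    show "0 \<le> \<Gamma> * (c + L)" using \<beta> \<alpha> c L by (simp add: \<Gamma>_def)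
    fix s h x assume *: "s \<in> {a..b}" "0 \<le> h" "s + h \<in> {a..b}" "x \<in> S s"
    obtain y where y: "y \<in> S (s + h)" "norm (x - y) \<le> L * h"
      using lip[OF *(1,3,4)] *(2) by auto
    define u where "u = x + h *\<^sub>R f s x"
    obtain x' where x': "x' \<in> S (s + h)" "P (u - x') \<bullet> (u - x') \<le> P (u - y) \<bullet> (u - y)"
      "\<And>z. z \<in> S (s + h) \<Longrightarrow> P (u - x') \<bullet> (z - x') \<le> 0"
      using quadratic_projection_exists[OF P sym \<alpha> pos closed[OF *(3)] convex[OF *(3)] y(1)] by blast
    have "\<alpha> * (norm (u - x'))\<^sup>2 \<le> P (u - y) \<bullet> (u - y)"
      using pos[of "u - x'"] x'(2) by (simp add: power2_norm_eq_inner)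
    also have "\<dots> \<le> norm (P (u - y)) * norm (u - y)" by (rule norm_cauchy_schwarz)
    also have "\<dots> \<le> \<beta> * norm (u - y) * norm (u - y)" by (intro mult_right_mono \<beta>) auto
    finally have "(norm (u - x'))\<^sup>2 \<le> \<beta> / \<alpha> * (norm (u - y))\<^sup>2"
      using \<alpha> by (simp add: field_simps power2_eq_square)
    then have "norm (u - x') \<le> sqrt (\<beta> / \<alpha> * (norm (u - y))\<^sup>2)" by (rule real_le_rsqrt)
    then have 1: "norm (u - x') \<le> sqrt (\<beta> / \<alpha>) * norm (u - y)"
      unfolding real_sqrt_mult by simp
    have f: "norm (h *\<^sub>R f s x) \<le> h * (c * (1 + norm x))"
      using growth[OF *(1,4)] *(2) by (auto intro: mult_left_mono)
    have "norm (u - y) \<le> norm (h *\<^sub>R f s x) + norm (x - y)"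
      unfolding u_def by (metis add.commute add_diff_eq norm_triangle_ineq)
    also have "\<dots> \<le> h * (c * (1 + norm x)) + L * h" using f y by linarith
    also have "\<dots> \<le> h * (c * (1 + norm x)) + L * h * (1 + norm x)"
      using L *(2) by (simp add: mult_le_cancel_left1 algebra_simps)
    also have "\<dots> = (c + L) * h * (1 + norm x)" by (simp add: algebra_simps)
    finally have 2: "norm (u - y) \<le> (c + L) * h * (1 + norm x)" .
    have "norm (x' - x) \<le> norm (h *\<^sub>R f s x) + norm (u - x')"
      using norm_triangle_ineq4[of "h *\<^sub>R f s x" "u - x'"] by (simp add: u_def)
    also have "\<dots> \<le> (c + L) * h * (1 + norm x) + sqrt (\<beta> / \<alpha>) * ((c + L) * h * (1 + norm x))"
    proof (intro add_mono order_trans[OF 1] mult_left_mono 2)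
      have "0 \<le> L * h * (1 + norm x)" using L *(2) by simp
      then show "norm (h *\<^sub>R f s x) \<le> (c + L) * h * (1 + norm x)" using f by (simp add: algebra_simps)
    qed (use \<beta> \<alpha> in simp)
    also have "\<dots> = \<Gamma> * (c + L) * h * (1 + norm x)" by (simp add: \<Gamma>_def algebra_simps)
    finally show "\<exists>x'\<in>S (s + h). norm (x' - x) \<le> \<Gamma> * (c + L) * h * (1 + norm x) \<and>
        (\<forall>z\<in>S (s + h). P (x + h *\<^sub>R f s x - x') \<bullet> (z - x') \<le> 0)"
      using x' by (auto simp: u_def)
  qed
qed

section \<open>The catching-up discretisation and its limit\<close>

definition h :: "nat \<Rightarrow> real" where "h n = (b - a) / Suc n"

text \<open>There are \<open>Suc n\<close> steps, so the mesh is defined and positive also for n =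
  0, and node \<open>Suc n\<close> is the end point \<open>b\<close>.\<close>

definition \<tau> :: "nat \<Rightarrow> nat \<Rightarrow> real" where "\<tau> n k = a + k * h n"

lemma h_pos: "0 < h n" using ab by (simp add: h_def)

lemma h_tendsto: "h \<longlonglongrightarrow> 0"
  unfolding h_def using LIMSEQ_Suc[OF lim_const_over_n[of "b - a"]] by simp

lemma \<tau>_Suc: "\<tau> n (Suc k) = \<tau> n k + h n" by (simp add: \<tau>_def algebra_simps)

lemma \<tau>_mem: assumes "k \<le> Suc n" shows "\<tau> n k \<in> {a..b}"
proof -
  have "k * h n \<le> Suc n * h n" using assms h_pos[of n] by (intro mult_right_mono) auto
  also have "\<dots> = b - a" by (simp add: h_def)
  finally show ?thesis using h_pos[of n] by (simp add: \<tau>_def)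
qed

text \<open>Each step multiplies 1 + norm by at most 1 + K h \<le> exp(K h). Over the whole interval
  this gives a bound \<open>R\<close> free of \<open>n\<close>, whence steps of size at most K R
  h.\<close>

lemma catching_up_scheme:
  obtains X :: "nat \<Rightarrow> nat \<Rightarrow> 'a" and M R where "0 \<le> M" "0 \<le> R" "\<forall>n. X n 0 = x0"
    "\<forall>n k. k \<le> Suc n \<longrightarrow> X n k \<in> S (\<tau> n k)"
    "\<forall>n k. k \<le> Suc n \<longrightarrow> norm (X n k) \<le> R"
    "\<forall>n k. k \<le> n \<longrightarrow> norm (X n (Suc k) - X n k) \<le> M * h n"
    "\<forall>n k z. k \<le> n \<longrightarrow> z \<in> S (\<tau> n (Suc k)) \<longrightarrow>
      P (X n k + h n *\<^sub>R f (\<tau> n k) (X n k) - X n (Suc k)) \<bullet> (z - X n (Suc k)) \<le> 0"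
proof -
  obtain K where K: "0 \<le> K" and step: "\<And>s h x. s \<in> {a..b} \<Longrightarrow> 0 \<le> h \<Longrightarrow> s + h \<in> {a..b} \<Longrightarrow> x \<in> S s \<Longrightarrow>
      \<exists>x'\<in>S (s + h). norm (x' - x) \<le> K * h * (1 + norm x) \<and>
        (\<forall>z\<in>S (s + h). P (x + h *\<^sub>R f s x - x') \<bullet> (z - x') \<le> 0)"
    using catching_up_step by blast
  have "\<exists>X. X 0 = x0 \<and> (\<forall>k. (k \<le> Suc n \<longrightarrow> X k \<in> S (\<tau> n k)) \<and>
      (k \<le> n \<longrightarrow> norm (X (Suc k) - X k) \<le> K * h n * (1 + norm (X k)) \<and>
        (\<forall>z\<in>S (\<tau> n (Suc k)). P (X k + h n *\<^sub>R f (\<tau> n k) (X k) - X (Suc k)) \<bullet> (z - X (Suc k)) \<le> 0)))" for n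
  proof -
    \<comment> \<open>Dependent choice runs over all natural indices; the guards on \<open>k\<close>
      leave the values after the last node unconstrained.\<close>
    have "\<exists>X. \<forall>k. ((k = 0 \<longrightarrow> X k = x0) \<and> (k \<le> Suc n \<longrightarrow> X k \<in> S (\<tau> n k))) \<and>
      (k \<le> n \<longrightarrow> norm (X (Suc k) - X k) \<le> K * h n * (1 + norm (X k)) \<and>
        (\<forall>z\<in>S (\<tau> n (Suc k)). P (X k + h n *\<^sub>R f (\<tau> n k) (X k) - X (Suc k)) \<bullet> (z - X (Suc k)) \<le> 0))"
    proof (rule dependent_nat_choice)
      show "\<exists>x. (0 = 0 \<longrightarrow> x = x0) \<and> (0 \<le> Suc n \<longrightarrow> x \<in> S (\<tau> n 0))" using x0 by (simp add: \<tau>_def)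
    next
      fix x k assume x: "(k = 0 \<longrightarrow> x = x0) \<and> (k \<le> Suc n \<longrightarrow> x \<in> S (\<tau> n k))"
      show "\<exists>y. ((Suc k = 0 \<longrightarrow> y = x0) \<and> (Suc k \<le> Suc n \<longrightarrow> y \<in> S (\<tau> n (Suc k)))) \<and>
        (k \<le> n \<longrightarrow> norm (y - x) \<le> K * h n * (1 + norm x) \<and>
        (\<forall>z\<in>S (\<tau> n (Suc k)). P (x + h n *\<^sub>R f (\<tau> n k) x - y) \<bullet> (z - y) \<le> 0))"
      proof (cases "k \<le> n")
        case True
        then show ?thesis
          using step[of "\<tau> n k" "h n" x] x \<tau>_mem[of k n] \<tau>_mem[of "Suc k" n] h_pos[of n]
          unfolding \<tau>_Suc by auto
      qed auto
    qed
    then show ?thesis by blast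
  qed
  then obtain X where X: "\<And>n. X n 0 = x0" "\<And>n k. k \<le> Suc n \<Longrightarrow> X n k \<in> S (\<tau> n k)"
    "\<And>n k. k \<le> n \<Longrightarrow> norm (X n (Suc k) - X n k) \<le> K * h n * (1 + norm (X n k))"
    "\<And>n k z. k \<le> n \<Longrightarrow> z \<in> S (\<tau> n (Suc k)) \<Longrightarrow>
      P (X n k + h n *\<^sub>R f (\<tau> n k) (X n k) - X n (Suc k)) \<bullet> (z - X n (Suc k)) \<le> 0"
    by metis
  define R where "R = exp (K * (b - a)) * (1 + norm x0)"
  have R1: "1 + norm (X n k) \<le> exp (K * h n * k) * (1 + norm x0)" if "k \<le> Suc n" for n k
    using that
  proof (induction k)
    case (Suc k)
    have "1 + norm (X n (Suc k)) \<le> (1 + norm (X n k)) + norm (X n (Suc k) - X n k)"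
      using norm_triangle_sub[of "X n (Suc k)" "X n k"] by simp
    also have "\<dots> \<le> (1 + K * h n) * (1 + norm (X n k))"
      using X(3)[of k n] Suc.prems by (simp add: algebra_simps)
    also have "\<dots> \<le> exp (K * h n) * (exp (K * h n * k) * (1 + norm x0))"
      using Suc K h_pos[of n] exp_ge_add_one_self[of "K * h n"] by (intro mult_mono) auto
    also have "\<dots> = exp (K * h n * Suc k) * (1 + norm x0)"
      by (simp add: exp_add[symmetric] algebra_simps flip: mult.assoc)
    finally show ?case .
  qed (simp add: X)
  have R: "1 + norm (X n k) \<le> R" if "k \<le> Suc n" for n k
  proof -
    have "h n * k \<le> b - a" using \<tau>_mem[OF that] by (simp add: \<tau>_def mult.commute)
    then have "K * h n * k \<le> K * (b - a)" using K by (simp add: mult.assoc mult_left_mono)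
    then have "exp (K * h n * k) * (1 + norm x0) \<le> R" unfolding R_def by (intro mult_right_mono) auto
    then show ?thesis using R1[OF that] by linarith
  qed
  have "0 \<le> R" by (simp add: R_def)
  show thesis
  proof (rule that[of "K * R" R X])
    show "0 \<le> K * R" "0 \<le> R" using K \<open>0 \<le> R\<close> by auto
    show "\<forall>n k. k \<le> Suc n \<longrightarrow> norm (X n k) \<le> R"
    proof (intro allI impI)
      fix n k :: nat assume "k \<le> Suc n"
      from R[OF this] show "norm (X n k) \<le> R" by simp
    qed
    show "\<forall>n k. k \<le> n \<longrightarrow> norm (X n (Suc k) - X n k) \<le> K * R * h n"
    proof (intro allI impI)
      fix n k :: nat assume that: "k \<le> n"
      have "K * h n * (1 + norm (X n k)) \<le> K * h n * R"
        using R[of k n] that K h_pos[of n] by (intro mult_left_mono) auto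
      then show "norm (X n (Suc k) - X n k) \<le> K * R * h n" using X(3)[OF that] by (simp add: mult_ac)
    qed
  qed (use X in auto)
qed

text \<open>Testing the variational inequalities of the scheme against a fixed \<open>z \<in> S s\<close> and telescoping bounds
  the increments of the squared \<open>P\<close>-distance to \<open>z\<close> after time \<open>s\<close>. The bound survives pointwise
  convergence, so no weak compactness of the derivatives is needed.\<close>

theorem solution_exists:
  obtains x M where "x a = x0" "M-lipschitz_on {a..b} x" "\<And>t. t \<in> {a..b} \<Longrightarrow> x t \<in> S t"
    "\<And>t z v. t \<in> {a..<b} \<Longrightarrow> z \<in> S t \<Longrightarrow> (x has_vector_derivative v) (at t within {a..b}) \<Longrightarrow>
      P (f t (x t) - v) \<bullet> (z - x t) \<le> 0"
proof -
  obtain \<beta> where \<beta>: "0 < \<beta>" "\<And>x. norm (P x) \<le> \<beta> * norm x" using P_bound by blast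
  obtain X :: "nat \<Rightarrow> nat \<Rightarrow> 'a" and M R where M: "0 \<le> M" and R: "0 \<le> R"
    and X: "\<forall>n. X n 0 = x0" "\<forall>n k. k \<le> Suc n \<longrightarrow> X n k \<in> S (\<tau> n k)"
      "\<forall>n k. k \<le> Suc n \<longrightarrow> norm (X n k) \<le> R"
      "\<forall>n k. k \<le> n \<longrightarrow> norm (X n (Suc k) - X n k) \<le> M * h n"
      "\<forall>n k z. k \<le> n \<longrightarrow> z \<in> S (\<tau> n (Suc k)) \<longrightarrow>
        P (X n k + h n *\<^sub>R f (\<tau> n k) (X n k) - X n (Suc k)) \<bullet> (z - X n (Suc k)) \<le> 0"
    by (rule catching_up_scheme)
  note X0 = X(1)[rule_format] and XS = X(2)[rule_format] and XR = X(3)[rule_format]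
    and XM = X(4)[rule_format] and XV = X(5)[rule_format]
  have h0: "0 < h n" for n by (rule h_pos)
  \<comment> \<open>Index of the last node not after \<open>t\<close>; it reaches
    \<open>Suc n\<close> exactly at \<open>t = b\<close>. The curves \<open>Y n\<close> are constant
    between nodes, so each value lies in the set at a node less than one mesh width before
    \<open>t\<close>.\<close>
  define \<kappa> where "\<kappa> n t = nat \<lfloor>(t - a) / h n\<rfloor>" for n t
  define Y where "Y n t = X n (\<kappa> n t)" for n t
  have \<kappa>1: "\<tau> n (\<kappa> n t) \<le> t" "t < \<tau> n (\<kappa> n t) + h n" if "t \<in> {a..b}" for n t
  proof -
    have "0 \<le> (t - a) / h n" using that h0[of n] by simp
    then have k: "real (\<kappa> n t) \<le> (t - a) / h n" "(t - a) / h n < real (\<kappa> n t) + 1"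
      unfolding \<kappa>_def by linarith+
    then show "\<tau> n (\<kappa> n t) \<le> t" "t < \<tau> n (\<kappa> n t) + h n"
      using h0[of n] by (simp_all add: \<tau>_def field_simps)
  qed
  have \<kappa>2: "\<kappa> n t \<le> Suc n" if "t \<in> {a..b}" for n t
  proof -
    have "\<kappa> n t * h n \<le> Suc n * h n" using \<kappa>1(1)[OF that, of n] that by (simp add: \<tau>_def h_def)
    then show ?thesis using h0[of n] by (simp only: mult_le_cancel_right_pos of_nat_le_iff)
  qed
  have \<kappa>mono: "\<kappa> n s \<le> \<kappa> n t" if "s \<le> t" for n s t
    unfolding \<kappa>_def using that h0[of n] by (intro nat_mono floor_mono divide_right_mono) auto
  have incr: "norm (X n k - X n j) \<le> M * ((real k - real j) * h n)" if "j \<le> k" "k \<le> Suc n" for n j k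
    using that
  proof (induction k rule: dec_induct)
    case (step k)
    have "norm (X n (Suc k) - X n j) \<le> norm (X n (Suc k) - X n k) + norm (X n k - X n j)"
      using norm_triangle_ineq[of "X n (Suc k) - X n k" "X n k - X n j"] by simp
    also have "\<dots> \<le> M * h n + M * ((real k - real j) * h n)" using step XM by (intro add_mono) auto
    also have "\<dots> = M * ((real (Suc k) - real j) * h n)" by (simp add: algebra_simps)
    finally show ?case .
  qed simp
  have diff\<tau>: "(real k - real j) * h n = \<tau> n k - \<tau> n j" for n k j by (simp add: \<tau>_def algebra_simps)
  have Ylip1: "norm (Y n t - Y n s) \<le> M * ((t - s) + h n)" if "s \<in> {a..b}" "t \<in> {a..b}" "s \<le> t" for n s t
  proof -
    have "norm (Y n t - Y n s) \<le> M * (\<tau> n (\<kappa> n t) - \<tau> n (\<kappa> n s))"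
      unfolding Y_def diff\<tau>[symmetric] by (intro incr \<kappa>mono \<kappa>2 that)
    also have "\<dots> \<le> M * ((t - s) + h n)"
      using \<kappa>1[OF that(1), of n] \<kappa>1[OF that(2), of n] M by (intro mult_left_mono) auto
    finally show ?thesis .
  qed
  have Ylip: "norm (Y n t - Y n s) \<le> M * (\<bar>t - s\<bar> + h n)" if "s \<in> {a..b}" "t \<in> {a..b}" for n s t
    using Ylip1[of s t n] Ylip1[of t s n] that by (cases "s \<le> t") (auto simp: norm_minus_commute)
  have YR: "norm (Y n t) \<le> R" if "t \<in> {a..b}" for n t unfolding Y_def by (intro XR \<kappa>2 that)
  have "countable (\<rat> \<inter> {a..b})" by (simp add: countable_rat)
  \<comment> \<open>A diagonal subsequence settles the rational times. The approximations are
    equicontinuous up to a jump of order \<open>h\<close>, which vanishes in the limit, so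
    convergence spreads to all times.\<close>
  then obtain \<sigma> :: "nat \<Rightarrow> nat" where \<sigma>: "strict_mono \<sigma>"
    "\<And>q. q \<in> \<rat> \<inter> {a..b} \<Longrightarrow> \<exists>l. (\<lambda>n. Y (\<sigma> n) q) \<longlonglongrightarrow> l"
    using function_convergent_subsequence[of "\<rat> \<inter> {a..b}" Y R] YR by (metis IntE)
  have h\<sigma>: "(\<lambda>n. h (\<sigma> n)) \<longlonglongrightarrow> 0"
    using LIMSEQ_subseq_LIMSEQ[OF h_tendsto \<sigma>(1)] by (simp add: o_def)
  have conv: "convergent (\<lambda>n. Y (\<sigma> n) t)" if t: "t \<in> {a..b}" for t
  proof (rule Cauchy_convergent, rule metric_CauchyI)
    fix e :: real assume e: "0 < e"
    define d where "d = e / (6 * (M + 1))"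
    have d: "0 < d" "M * d \<le> e / 6" using e M by (auto simp: d_def field_simps)
    obtain q where q: "q \<in> \<rat>" "max a (t - d) < q" "q < min b (t + d)"
      using Rats_dense_in_real[of "max a (t - d)" "min b (t + d)"] t ab d by auto
    have qab: "q \<in> {a..b}" "\<bar>t - q\<bar> \<le> d" using q by auto
    obtain l where l: "(\<lambda>n. Y (\<sigma> n) q) \<longlonglongrightarrow> l" using \<sigma>(2)[of q] q(1) qab by auto
    have "eventually (\<lambda>n. dist (Y (\<sigma> n) q) l < e / 6) sequentially" using l e by (intro tendstoD) auto
    moreover have "eventually (\<lambda>n. h (\<sigma> n) < d) sequentially" using h\<sigma> d by (intro order_tendstoD) auto
    ultimately have "eventually (\<lambda>n. dist (Y (\<sigma> n) t) l < e / 2) sequentially"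
    proof eventually_elim
      case (elim n)
      have "dist (Y (\<sigma> n) t) l \<le> dist (Y (\<sigma> n) t) (Y (\<sigma> n) q) + dist (Y (\<sigma> n) q) l" by (rule dist_triangle)
      also have "dist (Y (\<sigma> n) t) (Y (\<sigma> n) q) \<le> M * (\<bar>t - q\<bar> + h (\<sigma> n))"
        unfolding dist_norm by (rule Ylip[OF qab(1) t])
      also have "\<dots> \<le> M * (d + d)" using M qab(2) elim by (intro mult_left_mono) auto
      finally show ?case using elim(1) d by (simp add: algebra_simps)
    qed
    then obtain N where N: "\<And>n. n \<ge> N \<Longrightarrow> dist (Y (\<sigma> n) t) l < e / 2"
      unfolding eventually_sequentially by blast
    show "\<exists>N. \<forall>m\<ge>N. \<forall>n\<ge>N. dist (Y (\<sigma> m) t) (Y (\<sigma> n) t) < e"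
      using N dist_triangle_half_l by blast
  qed
  define x where "x t = lim (\<lambda>n. Y (\<sigma> n) t)" for t
  have Yx: "(\<lambda>n. Y (\<sigma> n) t) \<longlonglongrightarrow> x t" if "t \<in> {a..b}" for t
    using conv[OF that] by (simp add: x_def convergent_LIMSEQ_iff)
  have xlip: "norm (x t - x s) \<le> M * \<bar>t - s\<bar>" if "s \<in> {a..b}" "t \<in> {a..b}" for s t
  proof (rule LIMSEQ_le)
    show "(\<lambda>n. norm (Y (\<sigma> n) t - Y (\<sigma> n) s)) \<longlonglongrightarrow> norm (x t - x s)"
      by (intro tendsto_intros Yx that)
    have "(\<lambda>n. M * (\<bar>t - s\<bar> + h (\<sigma> n))) \<longlonglongrightarrow> M * (\<bar>t - s\<bar> + 0)" by (intro tendsto_intros h\<sigma>)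
    then show "(\<lambda>n. M * (\<bar>t - s\<bar> + h (\<sigma> n))) \<longlonglongrightarrow> M * \<bar>t - s\<bar>" by simp
    show "\<exists>N. \<forall>n\<ge>N. norm (Y (\<sigma> n) t - Y (\<sigma> n) s) \<le> M * (\<bar>t - s\<bar> + h (\<sigma> n))"
      using Ylip[OF that] by blast
  qed
  have "(\<lambda>n. Y (\<sigma> n) a) \<longlonglongrightarrow> x0" by (simp add: Y_def \<kappa>_def X0)
  then have xa: "x a = x0" using Yx[of a] ab LIMSEQ_unique by auto
  have xS: "x t \<in> S t" if t: "t \<in> {a..b}" for t
  proof -
    have "\<exists>y\<in>S t. norm (Y n t - y) \<le> L * h n" for n
    proof -
      have "Y n t \<in> S (\<tau> n (\<kappa> n t))" unfolding Y_def by (intro XS \<kappa>2 t)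
      with lip[OF \<tau>_mem[OF \<kappa>2[OF t]] t] obtain y where
        y: "y \<in> S t" "norm (Y n t - y) \<le> L * \<bar>t - \<tau> n (\<kappa> n t)\<bar>" by blast
      moreover have "L * \<bar>t - \<tau> n (\<kappa> n t)\<bar> \<le> L * h n"
        using \<kappa>1[OF t, of n] L by (intro mult_left_mono) auto
      ultimately show ?thesis by force
    qed
    then obtain y where y: "\<And>n. y n \<in> S t" "\<And>n. norm (Y n t - y n) \<le> L * h n" by metis
    have "(\<lambda>n. L * h (\<sigma> n)) \<longlonglongrightarrow> 0" using tendsto_mult_left[OF h\<sigma>, of L] by simp
    then have "(\<lambda>n. Y (\<sigma> n) t - y (\<sigma> n)) \<longlonglongrightarrow> 0"
      by (rule Lim_null_comparison[rotated]) (simp add: y)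
    from tendsto_diff[OF Yx[OF t] this] have "(\<lambda>n. y (\<sigma> n)) \<longlonglongrightarrow> x t" by simp
    then show ?thesis using closed_sequentially[OF closed[OF t], of "\<lambda>n. y (\<sigma> n)"] y(1) by blast
  qed
  define V where "V z y = P (y - z) \<bullet> (y - z)" for z y
  define F where "F = c * (1 + R)"
  have F0: "0 \<le> F" using c R by (simp add: F_def)
  have Ff: "norm (f (\<tau> n k) (X n k)) \<le> F" if "k \<le> Suc n" for n k
  proof -
    have "c * (1 + norm (X n k)) \<le> c * (1 + R)" using c XR[OF that] by (intro mult_left_mono) auto
    then show ?thesis using growth[OF \<tau>_mem[OF that] XS[OF that]] by (simp add: F_def)
  qed
  \<comment> \<open>The three products bound the drift against the motion within a step (F M), the
    drift against the displacement of the test point (F L), and the step against that displacement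
    (M L).\<close>
  define C where "C = \<beta> * (F * M + F * L + M * L)"
  have C0: "0 \<le> C" using \<beta> F0 M L by (simp add: C_def)
  have step: "V z (X n (Suc k)) - V z (X n k) \<le>
      2 * h n * (P (f (\<tau> n k) (X n k)) \<bullet> (X n k - z) + C * (h n + (\<tau> n (Suc k) - s)))"
    if s: "s \<in> {a..b}" "z \<in> S s" "s \<le> \<tau> n (Suc k)" and k: "k \<le> n" for s z n k
  proof -
    have "Suc k \<le> Suc n" using k by simp
    \<comment> \<open>The scheme admits only test points of the set at the next node, so
      \<open>z\<close> from \<open>S s\<close> is traded for a nearby \<open>z'\<close>
      there.\<close>
    from lip[OF s(1) \<tau>_mem[OF this] s(2)] obtain z' where
      z': "z' \<in> S (\<tau> n (Suc k))" "norm (z - z') \<le> L * (\<tau> n (Suc k) - s)" using s(3) by auto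
    define d where "d = X n (Suc k) - X n k"
    define g where "g = f (\<tau> n k) (X n k)"
    define \<Delta> where "\<Delta> = \<tau> n (Suc k) - s"
    have d: "norm d \<le> M * h n" unfolding d_def by (rule XM[OF k])
    have g: "norm g \<le> F" unfolding g_def using k by (intro Ff) auto
    have X': "X n (Suc k) = X n k + d" by (simp add: d_def)
    have v: "(h n *\<^sub>R P g - P d) \<bullet> (z' - (X n k + d)) \<le> 0"
      using XV[OF k z'(1)] unfolding X' g_def[symmetric]
      by (simp add: linear_diff[OF P, symmetric] linear_cmul[OF P, symmetric])
    have "V z (X n (Suc k)) - V z (X n k) = 2 * (P d \<bullet> (X n k + d - z)) - P d \<bullet> d"
      unfolding V_def X'
      using sym[of "X n k - z" d]
      by (simp add: linear_add[OF P] linear_diff[OF P] inner_add_left inner_add_right inner_diff_left inner_diff_right inner_commute algebra_simps)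
    also have "\<dots> \<le> 2 * (P d \<bullet> (X n k + d - z))"
      using pos[of d] \<alpha> by (smt (verit) inner_ge_zero mult_nonneg_nonneg)
    also have "P d \<bullet> (X n k + d - z) = (h n *\<^sub>R P g - P d) \<bullet> (z' - (X n k + d))
        + h n * (P g \<bullet> (X n k - z)) + h n * (P g \<bullet> (d + (z - z'))) + P d \<bullet> (z' - z)"
      by (simp add: inner_add_left inner_add_right inner_diff_left inner_diff_right algebra_simps)
    also have "\<dots> \<le> 0 + h n * (P g \<bullet> (X n k - z)) + h n * (\<beta> * F * (M * h n + L * \<Delta>))
        + \<beta> * (M * h n) * (L * \<Delta>)"
    proof (intro add_mono v order_refl mult_left_mono)
      have "P g \<bullet> (d + (z - z')) \<le> norm (P g) * norm (d + (z - z'))" by (rule norm_cauchy_schwarz)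
      also have "\<dots> \<le> (\<beta> * F) * (M * h n + L * \<Delta>)"
      proof (rule mult_mono)
        show "norm (P g) \<le> \<beta> * F" using \<beta>(2)[of g] mult_left_mono[OF g, of \<beta>] \<beta>(1) by linarith
        show "norm (d + (z - z')) \<le> M * h n + L * \<Delta>"
          using norm_triangle_ineq[of d "z - z'"] d z'(2) by (simp add: \<Delta>_def)
      qed (use \<beta> F0 in auto)
      finally show "P g \<bullet> (d + (z - z')) \<le> \<beta> * F * (M * h n + L * \<Delta>)" .
      have "P d \<bullet> (z' - z) \<le> norm (P d) * norm (z' - z)" by (rule norm_cauchy_schwarz)
      also have "\<dots> \<le> (\<beta> * (M * h n)) * (L * \<Delta>)"
      proof (rule mult_mono)
        show "norm (P d) \<le> \<beta> * (M * h n)" using \<beta>(2)[of d] mult_left_mono[OF d, of \<beta>] \<beta>(1) by linarith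
        show "norm (z' - z) \<le> L * \<Delta>" using z'(2) by (simp add: \<Delta>_def norm_minus_commute)
      qed (use \<beta> M h0[of n] in auto)
      finally show "P d \<bullet> (z' - z) \<le> \<beta> * (M * h n) * (L * \<Delta>)" .
    qed (use h0[of n] in simp)
    also have "\<dots> = h n * (P g \<bullet> (X n k - z) + \<beta> * (F * M) * h n + \<beta> * (F * L + M * L) * \<Delta>)"
      by (simp add: algebra_simps)
    also have "\<dots> \<le> h n * (P g \<bullet> (X n k - z) + C * (h n + \<Delta>))"
    proof (rule mult_left_mono)
      have "\<beta> * (F * M) \<le> C" "\<beta> * (F * L + M * L) \<le> C"
        unfolding C_def using \<beta>(1) F0 M L by (auto intro!: mult_left_mono)
      moreover have "0 \<le> \<Delta>" using s(3) by (simp add: \<Delta>_def)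
      ultimately have "\<beta> * (F * M) * h n + \<beta> * (F * L + M * L) * \<Delta> \<le> C * h n + C * \<Delta>"
        using h0[of n] by (intro add_mono mult_right_mono) auto
      then show "P g \<bullet> (X n k - z) + \<beta> * (F * M) * h n + \<beta> * (F * L + M * L) * \<Delta>
        \<le> P g \<bullet> (X n k - z) + C * (h n + \<Delta>)" by (simp add: algebra_simps)
    qed (use h0[of n] in simp)
    finally show ?thesis by (simp add: g_def \<Delta>_def mult.assoc)
  qed
  \<comment> \<open>The start \<open>j\<close> will be the last node not after \<open>s\<close>, so
    only node \<open>Suc j\<close> is known not to precede \<open>s\<close>.\<close>
  have telescope: "V z (X n m) - V z (X n j) \<le> 2 * (\<tau> n m - \<tau> n j) * (q + C * (h n + (t - s)))"
    if s: "s \<in> {a..b}" "z \<in> S s" "s \<le> \<tau> n (Suc j)" and jm: "j \<le> m" "m \<le> Suc n" "\<tau> n m \<le> t"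
      and q: "\<And>k. j \<le> k \<Longrightarrow> k < m \<Longrightarrow> P (f (\<tau> n k) (X n k)) \<bullet> (X n k - z) \<le> q"
    for s z n j m q t
    using jm q
  proof (induction m rule: dec_induct)
    case (step m)
    have mono\<tau>: "\<tau> n i \<le> \<tau> n k" if "i \<le> k" for i k
      using that h0[of n] by (simp add: \<tau>_def mult_right_mono)
    have "s \<le> \<tau> n (Suc m)" using s(3) mono\<tau>[of "Suc j" "Suc m"] step.hyps by simp
    from \<open>\<And>k n z s. s \<in> {a..b} \<Longrightarrow> z \<in> S s \<Longrightarrow> s \<le> \<tau> n (Suc k) \<Longrightarrow> k \<le> n \<Longrightarrow>
       V z (X n (Suc k)) - V z (X n k) \<le> 2 * h n * (P (f (\<tau> n k) (X n k)) \<bullet> (X n k - z) + C * (h n + (\<tau> n (Suc k) - s)))\<close>[OF s(1,2) this]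
    have "V z (X n (Suc m)) - V z (X n m) \<le>
      2 * h n * (P (f (\<tau> n m) (X n m)) \<bullet> (X n m - z) + C * (h n + (\<tau> n (Suc m) - s)))"
      using step.prems(1) by simp
    also have "\<dots> \<le> 2 * h n * (q + C * (h n + (t - s)))"
      using step h0[of n] C0 by (intro mult_left_mono add_mono) auto
    finally have 1: "V z (X n (Suc m)) - V z (X n m) \<le> 2 * h n * (q + C * (h n + (t - s)))" .
    have "V z (X n m) - V z (X n j) \<le> 2 * (\<tau> n m - \<tau> n j) * (q + C * (h n + (t - s)))"
      using step.IH step.prems mono\<tau>[of m "Suc m"] by (meson Suc_leD le_SucI less_SucI order_trans lessI nat_le_linear)
    with 1 show ?case by (simp add: \<tau>_Suc algebra_simps)
  qed simp
  have main: "P (f s (x s) - v) \<bullet> (z - x s) \<le> 0"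
    if s: "s \<in> {a..<b}" and z: "z \<in> S s" and v: "(x has_vector_derivative v) (at s within {a..b})" for s z v
  proof -
    have sab: "s \<in> {a..b}" using s by auto
    define q0 where "q0 = P (f s (x s)) \<bullet> (x s - z)"
    \<comment> \<open>For \<open>t\<close> slightly after \<open>s\<close> the bound on the
      increment of \<open>V\<close> passes to the limit curve. Dividing by \<open>t - s\<close> and
      letting \<open>t\<close> decrease to \<open>s\<close> compares the right derivative
      \<open>2 * (P v \<bullet> (x s - z))\<close> with \<open>2 * q0\<close>, up to
      \<open>e\<close>.\<close>
    have le: "2 * (P v \<bullet> (x s - z)) \<le> 2 * (q0 + e)" if e: "0 < e" for e
    proof -
      have "continuous_on (SIGMA t:{a..b}. S t) (\<lambda>p. P (f (fst p) (snd p)) \<bullet> (snd p - z))"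
        using f_cont by (intro continuous_intros linear_continuous_on_compose[OF _ P]) (simp add: case_prod_beta)
      then obtain \<rho> where \<rho>: "0 < \<rho>" "\<And>p. p \<in> (SIGMA t:{a..b}. S t) \<Longrightarrow> dist p (s, x s) < \<rho> \<Longrightarrow>
          dist (P (f (fst p) (snd p)) \<bullet> (snd p - z)) q0 < e"
        using sab xS[OF sab] e unfolding continuous_on_iff q0_def
        by (metis (no_types, lifting) SigmaI fst_conv snd_conv)
      have near: "P (f t y) \<bullet> (y - z) \<le> q0 + e"
        if "t \<in> {a..b}" "y \<in> S t" "\<bar>t - s\<bar> < \<rho> / 2" "norm (y - x s) < \<rho> / 2" for t y
      proof -
        have "dist (t, y) (s, x s) \<le> dist t s + dist y (x s)"
          unfolding dist_Pair_Pair by (rule sqrt_sum_squares_le_sum) auto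
        also have "\<dots> < \<rho>" using that by (simp add: dist_norm)
        finally show ?thesis using \<rho>(2)[of "(t, y)"] that by (simp add: dist_real_def)
      qed
      \<comment> \<open>During a time \<open>\<delta>\<close> the discrete curve moves by at most
        \<open>M * (\<delta> + h (\<sigma> n))\<close>, eventually below 3/8 of
        \<open>\<rho>\<close>; with an initial error below 1/8 of \<open>\<rho>\<close> it stays in
        the ball of radius \<open>\<rho> / 2\<close> where \<open>near\<close> applies.\<close>
      define \<delta> where "\<delta> = \<rho> / (4 * (M + 1))"
      have \<delta>: "0 < \<delta>" "\<delta> \<le> \<rho> / 4" "M * \<delta> \<le> \<rho> / 4" using \<rho>(1) M by (auto simp: \<delta>_def field_simps)
      have Vle: "V z (x t) - V z (x s) \<le> 2 * (t - s) * (q0 + e + C * (0 + (t - s)))"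
        if t: "s < t" "t \<le> b" "t < s + \<delta>" for t
      proof (rule tendsto_le[OF sequentially_bot])
        have tab: "t \<in> {a..b}" using s t by auto
        have cV: "continuous_on UNIV (V z)"
          unfolding V_def by (intro continuous_intros linear_continuous_on_compose[OF _ P])
        have VY: "(\<lambda>n. V z (Y (\<sigma> n) r)) \<longlonglongrightarrow> V z (x r)" if "r \<in> {a..b}" for r
          by (rule continuous_on_tendsto_compose[OF cV Yx[OF that]]) auto
        show "(\<lambda>n. V z (Y (\<sigma> n) t) - V z (Y (\<sigma> n) s)) \<longlonglongrightarrow> V z (x t) - V z (x s)"
          by (intro tendsto_diff VY tab sab)
        have \<tau>t: "(\<lambda>n. \<tau> (\<sigma> n) (\<kappa> (\<sigma> n) r)) \<longlonglongrightarrow> r" if "r \<in> {a..b}" for r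
        proof (rule tendsto_sandwich)
          show "\<forall>\<^sub>F n in sequentially. r - h (\<sigma> n) \<le> \<tau> (\<sigma> n) (\<kappa> (\<sigma> n) r)"
            using \<kappa>1(2)[OF that] by (intro always_eventually allI) (simp add: less_imp_le diff_le_eq)
          show "\<forall>\<^sub>F n in sequentially. \<tau> (\<sigma> n) (\<kappa> (\<sigma> n) r) \<le> r"
            using \<kappa>1(1)[OF that] by (intro always_eventually allI)
          show "(\<lambda>n. r - h (\<sigma> n)) \<longlonglongrightarrow> r" using tendsto_diff[OF tendsto_const[of r] h\<sigma>] by simp
        qed auto
        show "(\<lambda>n. 2 * (\<tau> (\<sigma> n) (\<kappa> (\<sigma> n) t) - \<tau> (\<sigma> n) (\<kappa> (\<sigma> n) s)) * (q0 + e + C * (h (\<sigma> n) + (t - s))))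
          \<longlonglongrightarrow> 2 * (t - s) * (q0 + e + C * (0 + (t - s)))"
          by (intro tendsto_intros h\<sigma> \<tau>t tab sab)
        have "\<forall>\<^sub>F n in sequentially. h (\<sigma> n) < \<delta>" using h\<sigma> \<delta>(1) by (intro order_tendstoD) auto
        moreover have "\<forall>\<^sub>F n in sequentially. dist (Y (\<sigma> n) s) (x s) < \<rho> / 8"
          using Yx[OF sab] \<rho>(1) by (intro tendstoD) auto
        moreover have "\<forall>\<^sub>F n in sequentially. M * (\<delta> + h (\<sigma> n)) < \<rho> * 3 / 8"
        proof (rule order_tendstoD(2))
          show "(\<lambda>n. M * (\<delta> + h (\<sigma> n))) \<longlonglongrightarrow> M * (\<delta> + 0)" by (intro tendsto_intros h\<sigma>)
          show "M * (\<delta> + 0) < \<rho> * 3 / 8" using \<delta>(3) \<rho>(1) by simp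
        qed
        ultimately show "\<forall>\<^sub>F n in sequentially. V z (Y (\<sigma> n) t) - V z (Y (\<sigma> n) s) \<le>
          2 * (\<tau> (\<sigma> n) (\<kappa> (\<sigma> n) t) - \<tau> (\<sigma> n) (\<kappa> (\<sigma> n) s)) * (q0 + e + C * (h (\<sigma> n) + (t - s)))"
        proof eventually_elim
          case (elim n)
          let ?n = "\<sigma> n"
          show ?case unfolding Y_def
          proof (rule telescope[OF sab z])
            show "s \<le> \<tau> ?n (Suc (\<kappa> ?n s))" using \<kappa>1(2)[OF sab, of ?n] by (simp add: \<tau>_Suc)
            show "\<kappa> ?n s \<le> \<kappa> ?n t" using t by (intro \<kappa>mono) auto
            show "\<kappa> ?n t \<le> Suc ?n" by (rule \<kappa>2[OF tab])
            show "\<tau> ?n (\<kappa> ?n t) \<le> t" by (rule \<kappa>1(1)[OF tab])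
            fix k assume k: "\<kappa> ?n s \<le> k" "k < \<kappa> ?n t"
            have kn: "k \<le> Suc ?n" using k(2) \<kappa>2[OF tab, of ?n] by simp
            have lo: "\<tau> ?n (\<kappa> ?n s) \<le> \<tau> ?n k" and up: "\<tau> ?n k \<le> \<tau> ?n (\<kappa> ?n t)"
              using k h0[of ?n] by (simp_all add: \<tau>_def mult_right_mono)
            have r1: "s - h ?n < \<tau> ?n k" "\<tau> ?n k \<le> t"
              using lo up \<kappa>1(2)[OF sab, of ?n] \<kappa>1(1)[OF tab, of ?n] by linarith+
            have "norm (X ?n k - Y ?n s) \<le> M * (\<tau> ?n k - \<tau> ?n (\<kappa> ?n s))"
              unfolding Y_def diff\<tau>[symmetric] by (intro incr k kn)
            also have "\<dots> \<le> M * (\<delta> + h ?n)"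
              using M r1 t \<kappa>1(2)[OF sab, of ?n] by (intro mult_left_mono) auto
            finally have "norm (X ?n k - Y ?n s) < \<rho> * 3 / 8" using elim(3) by simp
            then have "norm (X ?n k - x s) < \<rho> / 2"
              using elim(2) norm_triangle_ineq[of "X ?n k - Y ?n s" "Y ?n s - x s"] by (simp add: dist_norm)
            moreover have "\<bar>\<tau> ?n k - s\<bar> < \<rho> / 2"
              using r1 t(3) elim(1) \<delta>(1,2) by linarith
            ultimately show "P (f (\<tau> ?n k) (X ?n k)) \<bullet> (X ?n k - z) \<le> q0 + e"
              by (intro near \<tau>_mem XS kn)
          qed
        qed
      qed
      have v': "(x has_vector_derivative v) (at s within {s..b})"
        using v by (rule has_vector_derivative_within_subset) (use s in auto)
      have "((\<lambda>t. V z (x t)) has_real_derivative 2 * (P v \<bullet> (x s - z))) (at s within {s..b})"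
      proof -
        have dv: "((\<lambda>t. x t - z) has_derivative (\<lambda>t. t *\<^sub>R v)) (at s within {s..b})"
          using v' unfolding has_vector_derivative_def by (auto intro!: derivative_eq_intros)
        have dP: "((\<lambda>t. P (x t - z)) has_derivative (\<lambda>t. P (t *\<^sub>R v))) (at s within {s..b})"
          using linear_conv_bounded_linear[of P] P by (intro bounded_linear.has_derivative[OF _ dv]) auto
        have "((\<lambda>t. V z (x t)) has_derivative (\<lambda>t. P (x s - z) \<bullet> (t *\<^sub>R v) + P (t *\<^sub>R v) \<bullet> (x s - z))) (at s within {s..b})"
          unfolding V_def by (rule has_derivative_inner[OF dP dv])
        moreover have "P (x s - z) \<bullet> (t *\<^sub>R v) + P (t *\<^sub>R v) \<bullet> (x s - z) = 2 * (P v \<bullet> (x s - z)) * t" for t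
          using sym[of "x s - z" v] by (simp add: linear_cmul[OF P] inner_commute)
        ultimately show ?thesis by (simp add: has_field_derivative_def)
      qed
      then have "((\<lambda>t. (V z (x t) - V z (x s)) / (t - s)) \<longlongrightarrow> 2 * (P v \<bullet> (x s - z))) (at s within {s..b})"
        by (simp add: has_field_derivative_iff)
      moreover have "((\<lambda>t. 2 * (q0 + e + C * (0 + (t - s)))) \<longlongrightarrow> 2 * (q0 + e + C * (0 + (s - s)))) (at s within {s..b})"
        by (intro tendsto_intros)
      moreover have "at s within {s..b} \<noteq> bot" using s by (simp add: trivial_limit_within islimpt_Icc)
      moreover have "\<forall>\<^sub>F t in at s within {s..b}. (V z (x t) - V z (x s)) / (t - s) \<le> 2 * (q0 + e + C * (0 + (t - s)))"
        unfolding eventually_at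
      proof (intro exI[of _ \<delta>] conjI ballI impI \<delta>(1))
        fix t assume t: "t \<in> {s..b}" "t \<noteq> s \<and> dist t s < \<delta>"
        then have "s < t" "t \<le> b" "t < s + \<delta>" by (auto simp: dist_real_def)
        from Vle[OF this] have "V z (x t) - V z (x s) \<le> 2 * (q0 + e + C * (0 + (t - s))) * (t - s)"
          by (simp only: mult_ac)
        then show "(V z (x t) - V z (x s)) / (t - s) \<le> 2 * (q0 + e + C * (0 + (t - s)))"
          using \<open>s < t\<close> by (subst pos_divide_le_eq) auto
      qed
      ultimately show ?thesis using tendsto_le[of "at s within {s..b}"] by force
    qed
    have "P v \<bullet> (x s - z) \<le> q0"
      by (rule field_le_epsilon) (use le in force)
    then show ?thesis
      by (simp add: q0_def linear_diff[OF P] inner_diff_left inner_diff_right)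
  qed
  show thesis
  proof (rule that[OF xa _ xS main])
    show "M-lipschitz_on {a..b} x"
      using xlip M by (intro lipschitz_onI) (auto simp: dist_norm)
  qed
qed

end

section \<open>The operator of a static Lur'e system\<close>

text \<open>The constant is the minimum of the form on the compact unit sphere of \<open>R\<close>,
  and homogeneity does the rest; for trivial \<open>R\<close> the sphere is empty and any constant
  serves.\<close>

lemma coercive_on_subspace:
  fixes A :: "'a::euclidean_space \<Rightarrow> 'a"
  assumes A: "linear A" and R: "subspace R" and pos: "\<And>x. x \<in> R \<Longrightarrow> x \<noteq> 0 \<Longrightarrow> 0 < A x \<bullet> x"
  shows "\<exists>c>0. \<forall>x\<in>R. c * (x \<bullet> x) \<le> A x \<bullet> x"
proof (cases "R \<subseteq> {0}")
  case True
  then show ?thesis by (intro exI[of _ 1]) (auto simp: linear_0[OF A])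
next
  case False
  then obtain r where r: "r \<in> R" "r \<noteq> 0" by auto
  let ?S = "sphere 0 1 \<inter> R"
  have "(1 / norm r) *\<^sub>R r \<in> ?S" using r R by (auto simp: subspace_scale)
  moreover have "compact ?S" by (intro compact_Int_closed compact_sphere closed_subspace R)
  moreover have "continuous_on ?S (\<lambda>x. A x \<bullet> x)"
    by (intro continuous_intros linear_continuous_on_compose[OF _ A])
  ultimately obtain e where e: "e \<in> ?S" "\<And>x. x \<in> ?S \<Longrightarrow> A e \<bullet> e \<le> A x \<bullet> x"
    using continuous_attains_inf[of ?S "\<lambda>x. A x \<bullet> x"] by blast
  show ?thesis
  proof (intro exI[of _ "A e \<bullet> e"] conjI ballI)
    show "0 < A e \<bullet> e" using e(1) by (intro pos) auto
    fix x assume x: "x \<in> R"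
    show "A e \<bullet> e * (x \<bullet> x) \<le> A x \<bullet> x"
    proof (cases "x = 0")
      case False
      have "(1 / norm x) *\<^sub>R x \<in> ?S" using x False R by (auto simp: subspace_scale)
      from e(2)[OF this] have "A e \<bullet> e \<le> A x \<bullet> x / (norm x * norm x)"
        by (simp add: linear_cmul[OF A])
      then show ?thesis using False by (simp add: pos_le_divide_eq dot_square_norm power2_eq_square)
    qed (simp add: linear_0[OF A])
  qed
qed

lemma inner_transpose_mult: "(transpose A *v x) \<bullet> y = x \<bullet> (A *v y)" for A :: "real^'n^'m"
  by (simp add: dot_lmul_matrix)

lemma mat_rge_subspace: "subspace (mat_rge A)" for A :: "real^'n^'m"
  unfolding mat_rge_def by (intro linear_subspace_image matrix_vector_mul_linear subspace_UNIV)

lemma inner_sym_part_commute: "((D + transpose D) *v y) \<bullet> z = y \<bullet> ((D + transpose D) *v z)" for D :: "real^'m^'m"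
  unfolding matrix_vector_mult_add_rdistrib inner_add_left inner_add_right inner_transpose_mult
  by (metis add.commute inner_commute inner_transpose_mult)

lemma rge_sym_part_orthogonal_ker:
  fixes D :: "real^'m^'m"
  assumes "r \<in> mat_rge (D + transpose D)" "k \<in> mat_ker (D + transpose D)"
  shows "r \<bullet> k = 0"
proof -
  obtain y where "r = (D + transpose D) *v y" using assms(1) by (auto simp: mat_rge_def)
  then show ?thesis using assms(2) by (simp add: inner_sym_part_commute mat_ker_def)
qed

text \<open>A nonnegative quadratic form has zero gradient where it vanishes. Here the gradient is
  \<open>H *v e\<close>, and testing the form at \<open>e - s *\<^sub>R (H *v e)\<close> for small
  \<open>s\<close> shows it.\<close>

lemma psd_inner_zero_imp_ker:
  fixes D :: "real^'m^'m"
  assumes D: "pos_semidef_mat D" and e: "(D *v e) \<bullet> e \<le> 0"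
  shows "e \<in> mat_ker (D + transpose D)"
proof -
  define H where "H = D + transpose D"
  define N where "N = (H *v e) \<bullet> (H *v e)"
  define q where "q = (D *v (H *v e)) \<bullet> (H *v e)"
  have q0: "0 \<le> q" using D by (simp add: q_def pos_semidef_mat_def)
  have le: "N \<le> s * q" if s: "0 < s" for s
  proof -
    have "0 \<le> (D *v (e - s *\<^sub>R (H *v e))) \<bullet> (e - s *\<^sub>R (H *v e))"
      using D by (simp add: pos_semidef_mat_def)
    also have "\<dots> = (D *v e) \<bullet> e - s * ((D *v e) \<bullet> (H *v e) + (D *v (H *v e)) \<bullet> e) + s * s * q"
      by (simp add: q_def matrix_vector_mult_diff_distrib matrix_vector_mult_scaleR inner_diff_left inner_diff_right algebra_simps)
    also have "(D *v e) \<bullet> (H *v e) + (D *v (H *v e)) \<bullet> e = N"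
    proof -
      have "((D + transpose D) *v e) \<bullet> y = (D *v e) \<bullet> y + (D *v y) \<bullet> e" for y
        unfolding matrix_vector_mult_add_rdistrib inner_add_left inner_transpose_mult
        by (simp add: inner_commute)
      then show ?thesis unfolding N_def by (simp only: H_def)
    qed
    finally have "s * N \<le> s * (s * q)" using e by simp
    then show ?thesis using s by simp
  qed
  have "N \<le> 0"
  proof (rule field_le_epsilon)
    fix \<epsilon> :: real assume "0 < \<epsilon>"
    then have "N \<le> \<epsilon> / (q + 1) * q" using q0 by (intro le) auto
    also have "\<dots> \<le> \<epsilon>" using q0 \<open>0 < \<epsilon>\<close> by (simp add: field_simps)
    finally show "N \<le> 0 + \<epsilon>" by simp
  qed
  then have "H *v e = 0" unfolding N_def by (metis inner_eq_zero_iff inner_ge_zero order_antisym)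
  then show ?thesis by (simp add: mat_ker_def H_def)
qed

text \<open>The form can vanish only on the kernel of the symmetric part, which is orthogonal to
  this range.\<close>

lemma psd_coercive_on_rge:
  fixes D :: "real^'m^'m"
  assumes D: "pos_semidef_mat D"
  shows "\<exists>c>0. \<forall>x\<in>mat_rge (D + transpose D). c * (x \<bullet> x) \<le> (D *v x) \<bullet> x"
proof (rule coercive_on_subspace[OF matrix_vector_mul_linear mat_rge_subspace])
  fix x assume x: "x \<in> mat_rge (D + transpose D)" "x \<noteq> 0"
  show "0 < (D *v x) \<bullet> x"
  proof (rule ccontr)
    assume "\<not> 0 < (D *v x) \<bullet> x"
    then have "x \<in> mat_ker (D + transpose D)" using psd_inner_zero_imp_ker[OF D] by simp
    from rge_sym_part_orthogonal_ker[OF x(1) this] have "x \<bullet> x = 0" .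
    with x(2) show False by simp
  qed
qed

lemma lure_op_iff: "\<eta> \<in> lure_op M D w \<longleftrightarrow> \<eta> \<in> M (w - D *v \<eta>)"
  by (auto simp: lure_op_def op_inv_def op_add_mat_def) (metis diff_add_cancel)

text \<open>For the operators considered here the choice is nominal. Two values over the same
  \<open>w\<close> differ by an element of the kernel of the symmetric part, orthogonal to its
  range, so the intersection has at most one point; it is the value of least norm.\<close>

definition lure_sel :: "(real^'m \<Rightarrow> (real^'m) set) \<Rightarrow> real^'m^'m \<Rightarrow> real^'m \<Rightarrow> real^'m"
  where "lure_sel M D w = (SOME \<eta>. \<eta> \<in> mat_rge (D + transpose D) \<inter> lure_op M D w)"

text \<open>The coercivity constant \<open>c\<close> depends on \<open>D\<close> alone and is a
  parameter, so the estimates are uniform over a whole family of operators \<open>M\<close>.\<close>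

locale lure_operator =
  fixes M :: "real^'m \<Rightarrow> (real^'m) set" and D :: "real^'m^'m" and c :: real
  assumes M: "maximal_monotone M" and D: "pos_semidef_mat D"
    and c: "0 < c" and coercive: "\<And>x. x \<in> mat_rge (D + transpose D) \<Longrightarrow> c * (x \<bullet> x) \<le> (D *v x) \<bullet> x"
    and meets_rge: "\<And>w. lure_op M D w \<noteq> {} \<Longrightarrow> mat_rge (D + transpose D) \<inter> lure_op M D w \<noteq> {}"
begin

abbreviation "\<Phi> \<equiv> lure_op M D"
abbreviation "\<psi> \<equiv> lure_sel M D"
abbreviation "Q \<equiv> op_dom \<Phi>"
abbreviation "R \<equiv> mat_rge (D + transpose D)"
abbreviation "K \<equiv> mat_ker (D + transpose D)"

lemma D_nonneg: "0 \<le> (D *v z) \<bullet> z" using D by (simp add: pos_semidef_mat_def)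

lemma sel: assumes "w \<in> Q" shows "\<psi> w \<in> R" "\<psi> w \<in> \<Phi> w"
proof -
  have "\<exists>\<eta>. \<eta> \<in> R \<inter> \<Phi> w" using assms meets_rge by (auto simp: op_dom_def)
  then have "\<psi> w \<in> R \<inter> \<Phi> w" unfolding lure_sel_def by (rule someI_ex)
  then show "\<psi> w \<in> R" "\<psi> w \<in> \<Phi> w" by auto
qed

lemma memQ: "\<eta> \<in> \<Phi> w \<Longrightarrow> w \<in> Q" by (auto simp: op_dom_def)

lemma lure_op_monotone:
  assumes "\<eta>1 \<in> \<Phi> w1" "\<eta>2 \<in> \<Phi> w2"
  shows "(D *v (\<eta>1 - \<eta>2)) \<bullet> (\<eta>1 - \<eta>2) \<le> (\<eta>1 - \<eta>2) \<bullet> (w1 - w2)"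
proof -
  have "0 \<le> (\<eta>1 - \<eta>2) \<bullet> ((w1 - D *v \<eta>1) - (w2 - D *v \<eta>2))"
    using M assms unfolding lure_op_iff maximal_monotone_def monotone_op_def by blast
  also have "(w1 - D *v \<eta>1) - (w2 - D *v \<eta>2) = (w1 - w2) - D *v (\<eta>1 - \<eta>2)"
    by (simp add: matrix_vector_mult_diff_distrib)
  finally show ?thesis by (simp add: inner_diff_right inner_commute)
qed

lemma diff_sel_ker: assumes "\<eta> \<in> \<Phi> w" shows "\<eta> - \<psi> w \<in> K"
  using lure_op_monotone[OF assms sel(2)[OF memQ[OF assms]]]
  by (intro psd_inner_zero_imp_ker[OF D]) simp

text \<open>Monotonicity controls only the D-form of the difference; since both selections lie in
  \<open>R\<close>, that form dominates the squared norm.\<close>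

lemma sel_lipschitz:
  assumes "w1 \<in> Q" "w2 \<in> Q"
  shows "norm (\<psi> w1 - \<psi> w2) \<le> norm (w1 - w2) / c"
proof (cases "\<psi> w1 = \<psi> w2")
  case False
  let ?d = "\<psi> w1 - \<psi> w2"
  have "?d \<in> R" using sel(1) assms by (intro subspace_diff[OF mat_rge_subspace])
  then have "c * (norm ?d)\<^sup>2 \<le> (D *v ?d) \<bullet> ?d" using coercive by (simp add: power2_norm_eq_inner)
  also have "\<dots> \<le> ?d \<bullet> (w1 - w2)" using sel assms by (intro lure_op_monotone)
  also have "\<dots> \<le> norm ?d * norm (w1 - w2)" by (rule norm_cauchy_schwarz)
  finally have "c * norm ?d \<le> norm (w1 - w2)" using False by (simp add: power2_eq_square)
  then show ?thesis using c by (simp add: field_simps)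
qed (use c in simp)

text \<open>Along a convergent sequence of arguments the selections converge by the Lipschitz
  estimate, and the limit pair remains monotonically related to the graph of
  \<open>M\<close>.\<close>

lemma closed_Q: "closed Q"
  unfolding closed_sequential_limits
proof (intro allI impI, elim conjE)
  fix w l assume w: "\<forall>n. w n \<in> Q" "w \<longlonglongrightarrow> l"
  have "Cauchy (\<lambda>n. \<psi> (w n))"
  proof (rule metric_CauchyI)
    fix e :: real assume "0 < e"
    then obtain N where N: "\<forall>m\<ge>N. \<forall>n\<ge>N. dist (w m) (w n) < e * c"
      using metric_CauchyD[OF LIMSEQ_imp_Cauchy[OF w(2)], of "e * c"] c by auto
    show "\<exists>N. \<forall>m\<ge>N. \<forall>n\<ge>N. dist (\<psi> (w m)) (\<psi> (w n)) < e"
    proof (intro exI[of _ N] allI impI)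
      fix m n assume "N \<le> m" "N \<le> n"
      then have "norm (w m - w n) / c < e" using N c by (simp add: dist_norm pos_divide_less_eq)
      then show "dist (\<psi> (w m)) (\<psi> (w n)) < e"
        using sel_lipschitz[of "w m" "w n"] w(1) by (simp add: dist_norm)
    qed
  qed
  then obtain \<eta> where \<eta>: "(\<lambda>n. \<psi> (w n)) \<longlonglongrightarrow> \<eta>" using Cauchy_convergent convergent_def by blast
  have D\<eta>: "(\<lambda>n. D *v \<psi> (w n)) \<longlonglongrightarrow> D *v \<eta>"
    by (intro bounded_linear.tendsto[OF matrix_vector_mul_bounded_linear] \<eta>)
  have "\<eta> \<in> M (l - D *v \<eta>)"
  proof (rule maximal_monotone_memI[OF M])
    fix z' \<eta>' assume z': "\<eta>' \<in> M z'"
    have "(\<lambda>n. (\<psi> (w n) - \<eta>') \<bullet> (w n - D *v \<psi> (w n) - z')) \<longlonglongrightarrow> (\<eta> - \<eta>') \<bullet> (l - D *v \<eta> - z')"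
      by (intro tendsto_intros \<eta> D\<eta> w)
    then show "0 \<le> (\<eta> - \<eta>') \<bullet> (l - D *v \<eta> - z')"
    proof (rule LIMSEQ_le_const, intro exI[of _ 0] allI impI)
      fix n
      have "\<psi> (w n) \<in> M (w n - D *v \<psi> (w n))" using sel(2) w(1) lure_op_iff by blast
      then show "0 \<le> (\<psi> (w n) - \<eta>') \<bullet> (w n - D *v \<psi> (w n) - z')"
        using M z' unfolding maximal_monotone_def monotone_op_def by blast
    qed
  qed
  then show "l \<in> Q" by (intro memQ[of \<eta>]) (simp add: lure_op_iff)
qed

text \<open>Applying Minty's theorem to \<open>M\<close> with the operator D + t I yields the
  resolvent of \<open>\<Phi>\<close> directly, before \<open>\<Phi>\<close> is known to be
  maximal.\<close>

lemma resolvent_exists: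
  assumes "0 < t" shows "\<exists>x \<eta>. \<eta> \<in> \<Phi> x \<and> x + t *\<^sub>R \<eta> = w"
proof -
  have "linear (\<lambda>\<eta>. D *v \<eta> + t *\<^sub>R \<eta>)" by (intro linear_compose_add matrix_vector_mul_linear linear_scale_self)
  moreover have "t * (x \<bullet> x) \<le> (D *v x + t *\<^sub>R x) \<bullet> x" for x
    using D_nonneg[of x] by (simp add: inner_add_left)
  ultimately obtain z \<eta> where z: "\<eta> \<in> M z" "z + (D *v \<eta> + t *\<^sub>R \<eta>) = w"
    using maximal_monotone_solvable[of _ t M w] assms M by blast
  then have "\<eta> \<in> \<Phi> (z + D *v \<eta>)" by (simp add: lure_op_iff)
  then show ?thesis using z(2) by (metis add.assoc)
qed

text \<open>Solvability of x + \<zeta> = w + \<eta> forces a monotonically related pair to coincide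
  with a graph point.\<close>

lemma lure_op_maximal:
  assumes "\<And>w' \<eta>'. \<eta>' \<in> \<Phi> w' \<Longrightarrow> 0 \<le> (\<eta> - \<eta>') \<bullet> (w - w')"
  shows "\<eta> \<in> \<Phi> w"
proof -
  obtain x \<zeta> where x: "\<zeta> \<in> \<Phi> x" "x + 1 *\<^sub>R \<zeta> = w + \<eta>" using resolvent_exists[of 1 "w + \<eta>"] by auto
  have "\<eta> - \<zeta> = - (w - x)" using x(2) by (simp add: algebra_simps)
  then have "0 \<le> - ((w - x) \<bullet> (w - x))" using assms[OF x(1)] by (simp only: inner_minus_left)
  then have "(w - x) \<bullet> (w - x) \<le> 0" by linarith
  then have "w = x" by (metis eq_iff_diff_eq_0 inner_eq_zero_iff inner_ge_zero order_antisym)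
  then show ?thesis using x by simp
qed

text \<open>The resolvents of a convex combination \<open>w\<close> of two points of
  \<open>Q\<close> lie in \<open>Q\<close> and tend to \<open>w\<close> as the parameter tends to 0;
  closedness then puts \<open>w\<close> into \<open>Q\<close>.\<close>

lemma convex_Q: "convex Q"
proof (rule convexI)
  fix w1 w2 and s1 s2 :: real
  assume w: "w1 \<in> Q" "w2 \<in> Q" and s: "0 \<le> s1" "0 \<le> s2" "s1 + s2 = 1"
  define w where "w = s1 *\<^sub>R w1 + s2 *\<^sub>R w2"
  define t where "t n = 1 / real (Suc n)" for n
  have t: "0 < t n" for n by (simp add: t_def)
  have "\<forall>n. \<exists>x \<eta>. \<eta> \<in> \<Phi> x \<and> x + t n *\<^sub>R \<eta> = w" using resolvent_exists[OF t] by blast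
  then obtain x \<eta> where x: "\<And>n. \<eta> n \<in> \<Phi> (x n)" "\<And>n. x n + t n *\<^sub>R \<eta> n = w"
    by metis
  \<comment> \<open>Monotonicity is tested against both end points, and the weighted sum of the
    differences to them is \<open>x n - w\<close>. This leaves a quadratic inequality for its norm
    whose coefficients vanish with \<open>t n\<close>.\<close>
  define A where "A = s1 * norm (\<psi> w1) + s2 * norm (\<psi> w2)"
  define B where "B = s1 * (norm (\<psi> w1) * norm (w - w1)) + s2 * (norm (\<psi> w2) * norm (w - w2))"
  have bound: "(norm (x n - w))\<^sup>2 \<le> (t n * A)\<^sup>2 + 2 * (t n * B)" for n
  proof -
    let ?d = "x n - w"
    have dn: "t n *\<^sub>R \<eta> n = - ?d" using x(2)[of n] by (simp add: algebra_simps)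
    have le: "?d \<bullet> (x n - z) \<le> t n * (norm (\<psi> z) * norm ?d + norm (\<psi> z) * norm (w - z))" if z: "z \<in> Q" for z
    proof -
      have "0 \<le> (\<eta> n - \<psi> z) \<bullet> (x n - z)"
        using lure_op_monotone[OF x(1)[of n] sel(2)[OF z]] D_nonneg order_trans by blast
      then have "0 \<le> t n * ((\<eta> n - \<psi> z) \<bullet> (x n - z))" using t[of n] by simp
      also have "\<dots> = (t n *\<^sub>R \<eta> n) \<bullet> (x n - z) - t n * (\<psi> z \<bullet> (x n - z))"
        by (simp add: inner_diff_left algebra_simps)
      finally have "?d \<bullet> (x n - z) \<le> t n * (- (\<psi> z \<bullet> (x n - z)))"
        unfolding dn inner_minus_left by linarith
      also have "\<dots> \<le> t n * (norm (\<psi> z) * norm (x n - z))"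
        using t[of n] Cauchy_Schwarz_ineq2[of "\<psi> z" "x n - z"] by (intro mult_left_mono) auto
      also have "\<dots> \<le> t n * (norm (\<psi> z) * (norm ?d + norm (w - z)))"
        using t[of n] norm_triangle_ineq[of ?d "w - z"] by (intro mult_left_mono) auto
      finally show ?thesis by (simp add: algebra_simps)
    qed
    have "s1 *\<^sub>R (x n - w1) + s2 *\<^sub>R (x n - w2) = (s1 + s2) *\<^sub>R x n - w" by (simp add: w_def algebra_simps)
    also have "\<dots> = ?d" using s(3) by simp
    finally have "?d = s1 *\<^sub>R (x n - w1) + s2 *\<^sub>R (x n - w2)" by (rule sym)
    then have "?d \<bullet> ?d = ?d \<bullet> (s1 *\<^sub>R (x n - w1) + s2 *\<^sub>R (x n - w2))" by (rule arg_cong)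
    also have "\<dots> = s1 * (?d \<bullet> (x n - w1)) + s2 * (?d \<bullet> (x n - w2))"
      by (simp only: inner_add_right inner_scaleR_right)
    also have "\<dots> \<le> s1 * (t n * (norm (\<psi> w1) * norm ?d + norm (\<psi> w1) * norm (w - w1)))
        + s2 * (t n * (norm (\<psi> w2) * norm ?d + norm (\<psi> w2) * norm (w - w2)))"
      using s le[OF w(1)] le[OF w(2)] by (intro add_mono mult_left_mono) auto
    also have "\<dots> = (t n * A) * norm ?d + t n * B" by (simp add: A_def B_def algebra_simps)
    finally have "(norm ?d)\<^sup>2 \<le> (t n * A) * norm ?d + t n * B" by (simp add: power2_norm_eq_inner)
    moreover have "2 * ((t n * A) * norm ?d) \<le> (t n * A)\<^sup>2 + (norm ?d)\<^sup>2"
      using sum_squares_bound[of "t n * A" "norm ?d"] by simp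
    ultimately show ?thesis by linarith
  qed
  have t0: "t \<longlonglongrightarrow> 0" unfolding t_def using LIMSEQ_Suc[OF lim_const_over_n[of "1::real"]] by simp
  have "(\<lambda>n. sqrt ((t n * A)\<^sup>2 + 2 * (t n * B))) \<longlonglongrightarrow> sqrt ((0 * A)\<^sup>2 + 2 * (0 * B))"
    by (intro tendsto_intros t0)
  then have "(\<lambda>n. x n - w) \<longlonglongrightarrow> 0"
    by (intro Lim_null_comparison[of "\<lambda>n. x n - w"]) (auto intro!: always_eventually real_le_rsqrt bound)
  then have "x \<longlonglongrightarrow> w" by (simp add: LIM_zero_iff)
  moreover have "x n \<in> Q" for n using x(1) by (rule memQ)
  ultimately show "s1 *\<^sub>R w1 + s2 *\<^sub>R w2 \<in> Q"
    using closed_sequentially[OF closed_Q] unfolding w_def by blast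
qed

text \<open>Adding a normal to \<open>Q\<close> keeps the value monotonically related to the whole
  graph, so maximality retains it; and two values over one point differ by an element of
  \<open>K\<close>.\<close>

lemma sel_add_normal:
  assumes w: "w \<in> Q" and n: "\<And>w'. w' \<in> Q \<Longrightarrow> n \<bullet> (w' - w) \<le> 0"
  shows "\<psi> w + n \<in> \<Phi> w" "n \<in> K"
proof -
  show *: "\<psi> w + n \<in> \<Phi> w"
  proof (rule lure_op_maximal)
    fix w' \<eta>' assume \<eta>': "\<eta>' \<in> \<Phi> w'"
    have "0 \<le> (\<psi> w - \<eta>') \<bullet> (w - w')"
      using lure_op_monotone[OF sel(2)[OF w] \<eta>'] D_nonneg order_trans by blast
    moreover have "0 \<le> n \<bullet> (w - w')" using n[OF memQ[OF \<eta>']] by (simp add: inner_diff_right)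
    ultimately show "0 \<le> (\<psi> w + n - \<eta>') \<bullet> (w - w')"
      by (simp add: inner_add_left inner_diff_left)
  qed
  show "n \<in> K" using diff_sel_ker[OF *] by simp
qed

lemma Q_nonempty: "Q \<noteq> {}"
  using resolvent_exists[of 1 undefined] memQ by fastforce

text \<open>The residual of projecting \<open>w + r\<close> onto \<open>Q\<close> is normal, hence
  in \<open>K\<close> and orthogonal to \<open>r\<close>. Testing its normality with
  \<open>w\<close> itself makes it vanish.\<close>

lemma Q_add_rge:
  assumes w: "w \<in> Q" and r: "r \<in> R"
  shows "w + r \<in> Q"
proof -
  define p where "p = closest_point Q (w + r)"
  define n where "n = w + r - p"
  have p: "p \<in> Q" unfolding p_def using closed_Q Q_nonempty by (rule closest_point_in_set)
  have nn: "n \<bullet> (w' - p) \<le> 0" if "w' \<in> Q" for w'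
    unfolding n_def p_def by (rule closest_point_dot[OF convex_Q closed_Q that])
  have "n \<in> K" by (rule sel_add_normal(2)[OF p nn])
  then have "n \<bullet> r = 0" using rge_sym_part_orthogonal_ker[OF r] by (simp add: inner_commute)
  moreover have "w - p = n - r" by (simp add: n_def)
  ultimately have "n \<bullet> n \<le> 0" using nn[OF w] by (simp add: inner_diff_right)
  then have "n = 0" by (metis inner_eq_zero_iff inner_ge_zero order_antisym)
  then show ?thesis using p by (simp add: n_def)
qed

end

section \<open>The state-dependent Lur'e system\<close>

lemma dis_le_imp:
  assumes "dis F1 F2 \<le> ereal \<delta>" "\<eta>1 \<in> F1 z1" "\<eta>2 \<in> F2 z2"
  shows "(\<eta>1 - \<eta>2) \<bullet> (z2 - z1) \<le> \<delta> * (1 + norm \<eta>1 + norm \<eta>2)"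
proof -
  have "ereal (((\<eta>1 - \<eta>2) \<bullet> (z2 - z1)) / (1 + norm \<eta>1 + norm \<eta>2)) \<le> dis F1 F2"
    unfolding dis_def using assms(2,3)
    by (intro Sup_upper CollectI exI[of _ z1] exI[of _ z2] exI[of _ \<eta>1] exI[of _ \<eta>2]) (auto simp: op_dom_def)
  then have "ereal (((\<eta>1 - \<eta>2) \<bullet> (z2 - z1)) / (1 + norm \<eta>1 + norm \<eta>2)) \<le> ereal \<delta>"
    using assms(1) by (rule order_trans)
  then have "((\<eta>1 - \<eta>2) \<bullet> (z2 - z1)) / (1 + norm \<eta>1 + norm \<eta>2) \<le> \<delta>" by simp
  moreover have "0 < 1 + norm \<eta>1 + norm \<eta>2" by (simp add: add_pos_nonneg)
  ultimately show ?thesis by (simp add: pos_divide_le_eq)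
qed

text \<open>The constants carry the analytic content of the matrix hypotheses: \<open>C'\<close> is
  a linear right inverse of \<open>C\<close> with bound \<open>\<sigma>\<close>, \<open>c\<close> is
  the coercivity of \<open>D\<close> on the range of its symmetric part, \<open>\<alpha>\<close> and
  \<open>\<beta>\<close> compare the P-norm with the Euclidean one. Condition
  \<open>meets_rge\<close> ranges over all \<open>w\<close>, each of which has the form C x.\<close>

locale lure_system =
  fixes T c L1 L2 :: real
    and B :: "real^'m^'n" and C :: "real^'n^'m" and D :: "real^'m^'m" and P :: "real^'n^'n"
    and g :: "real \<Rightarrow> real^'n \<Rightarrow> real^'n"
    and F :: "real \<Rightarrow> real^'n \<Rightarrow> real^'m \<Rightarrow> (real^'m) set"
    and G :: "real \<Rightarrow> real^'m \<Rightarrow> (real^'m) set"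
    and g1 :: "real \<Rightarrow> real^'n \<Rightarrow> real^'m"
    and C' :: "real^'m \<Rightarrow> real^'n" and \<sigma> \<alpha> \<beta> cg :: real
  assumes F_max: "\<And>t x. t \<in> {0..T} \<Longrightarrow> maximal_monotone (F t x)"
    and L: "0 \<le> L1" "0 \<le> L2"
    and F_dis: "\<And>t s x y. t \<in> {0..T} \<Longrightarrow> s \<in> {0..T} \<Longrightarrow>
        dis (F t x) (F s y) \<le> ereal (L1 * \<bar>t - s\<bar> + L2 * norm (x - y))"
    and D_psd: "pos_semidef_mat D"
    and c: "0 < c" "\<And>x. x \<in> mat_rge (D + transpose D) \<Longrightarrow> c * (x \<bullet> x) \<le> (D *v x) \<bullet> x"
    and C': "linear C'" "\<And>y. C *v C' y = y" and \<sigma>: "0 < \<sigma>" "\<And>y. norm (C' y) \<le> \<sigma> * norm y"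
    and P_sym: "\<And>x y. (P *v x) \<bullet> y = x \<bullet> (P *v y)"
    and \<alpha>: "0 < \<alpha>" "\<And>x. \<alpha> * (x \<bullet> x) \<le> (P *v x) \<bullet> x"
    and \<beta>: "0 < \<beta>" "\<And>x. norm (P *v x) \<le> \<beta> * norm x"
    and P_ker: "mat_ker (D + transpose D) \<subseteq> mat_ker (P ** B - transpose C)"
    and meets_rge: "\<And>t y w. t \<in> {0..T} \<Longrightarrow> lure_op (F t y) D w \<noteq> {} \<Longrightarrow>
      mat_rge (D + transpose D) \<inter> lure_op (F t y) D w \<noteq> {}"
    and g_cont: "continuous_on ({0..T} \<times> UNIV) (\<lambda>(t, x). g t x)"
    and cg: "0 \<le> cg" "\<And>t x. t \<in> {0..T} \<Longrightarrow> norm (g t x) \<le> cg * (1 + norm x)"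
    and F_G: "\<And>t x z. t \<in> {0..T} \<Longrightarrow> F t x z = G t (z + g1 t x)"
    and g1_rge: "\<And>t x. t \<in> {0..T} \<Longrightarrow> g1 t x \<in> mat_rge (D + transpose D)"
    and g1_lip: "lipschitz_on_bounded_sets T g1"
    and g_lip: "lipschitz_on_bounded_sets T g"
begin

abbreviation "R \<equiv> mat_rge (D + transpose D)"
abbreviation "K \<equiv> mat_ker (D + transpose D)"

lemma op: assumes "t \<in> {0..T}" shows "lure_operator (F t x) D c"
  by unfold_locales (rule F_max[OF assms] D_psd c meets_rge[OF assms]; assumption)+

text \<open>State 0 is a mere reference; by \<open>Q_eq\<close> any other state gives the same
  domain.\<close>

definition Q :: "real \<Rightarrow> (real^'m) set" where "Q t = op_dom (lure_op (F t 0) D)"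

definition \<psi> :: "real \<Rightarrow> real^'n \<Rightarrow> real^'m \<Rightarrow> real^'m" where "\<psi> t x = lure_sel (F t x) D"

lemma lure_op_shift:
  assumes "t \<in> {0..T}"
  shows "lure_op (F t x) D w = lure_op (F t y) D (w + (g1 t x - g1 t y))"
proof -
  have eq: "w - D *v \<eta> + g1 t x = w + (g1 t x - g1 t y) - D *v \<eta> + g1 t y" for \<eta> by simp
  show ?thesis by (rule set_eqI) (simp only: lure_op_iff F_G[OF assms] eq)
qed

lemma Q_eq:
  assumes t: "t \<in> {0..T}" shows "op_dom (lure_op (F t x) D) = Q t"
proof -
  have sub: "op_dom (lure_op (F t x) D) \<subseteq> op_dom (lure_op (F t y) D)" for x y
  proof
    fix w assume "w \<in> op_dom (lure_op (F t x) D)"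
    moreover have "g1 t y - g1 t x \<in> R" using g1_rge[OF t] by (intro subspace_diff[OF mat_rge_subspace])
    ultimately have "w + (g1 t y - g1 t x) \<in> op_dom (lure_op (F t x) D)"
      by (rule lure_operator.Q_add_rge[OF op[OF t]])
    then show "w \<in> op_dom (lure_op (F t y) D)"
      using lure_op_shift[OF t, of y w x] by (simp add: op_dom_def)
  qed
  show ?thesis unfolding Q_def by (intro antisym sub)
qed

lemma sel:
  assumes "t \<in> {0..T}" "w \<in> Q t" shows "\<psi> t x w \<in> R" "\<psi> t x w \<in> lure_op (F t x) D w"
  using lure_operator.sel[OF op[OF assms(1)], of w x] assms by (auto simp: \<psi>_def Q_eq)

text \<open>Changing the state amounts to translating the argument by a vector of \<open>R\<close>,
  which keeps it in \<open>Q t\<close>. At equal times this gives the genuine Lipschitz estimate on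
  which uniqueness rests.\<close>

lemma sel_lipschitz:
  assumes t: "t \<in> {0..T}" and w: "w \<in> Q t" "w' \<in> Q t"
  shows "norm (\<psi> t x w - \<psi> t y w') \<le> (norm (w - w') + norm (g1 t x - g1 t y)) / c"
proof -
  have eq: "\<psi> t x w = \<psi> t y (w + (g1 t x - g1 t y))"
    unfolding \<psi>_def lure_sel_def lure_op_shift[OF t, of x w y] ..
  have "g1 t x - g1 t y \<in> R" using g1_rge[OF t] by (intro subspace_diff[OF mat_rge_subspace])
  with w(1) have "w + (g1 t x - g1 t y) \<in> Q t"
    using lure_operator.Q_add_rge[OF op[OF t], of w y] by (simp add: Q_eq[OF t])
  with w(2) have "norm (\<psi> t x w - \<psi> t y w') \<le> norm (w + (g1 t x - g1 t y) - w') / c"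
    unfolding eq using lure_operator.sel_lipschitz[OF op[OF t], of _ y w'] by (simp add: \<psi>_def Q_eq[OF t])
  also have "\<dots> \<le> (norm (w - w') + norm (g1 t x - g1 t y)) / c"
    using norm_triangle_ineq[of "w - w'" "g1 t x - g1 t y"] c(1)
    by (intro divide_right_mono) (auto simp: algebra_simps)
  finally show ?thesis .
qed

text \<open>The D-term is kept on the left: coercivity of the selections is read off from it,
  whereas for the distance of domains its sign suffices.\<close>

lemma lure_op_dis:
  assumes ts: "t \<in> {0..T}" "s \<in> {0..T}" and \<eta>: "\<eta>1 \<in> lure_op (F t x) D w1" "\<eta>2 \<in> lure_op (F s y) D w2"
  shows "(\<eta>1 - \<eta>2) \<bullet> (w2 - w1) + (D *v (\<eta>1 - \<eta>2)) \<bullet> (\<eta>1 - \<eta>2) \<le>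
    (L1 * \<bar>t - s\<bar> + L2 * norm (x - y)) * (1 + norm \<eta>1 + norm \<eta>2)"
proof -
  have eq: "(w2 - D *v \<eta>2) - (w1 - D *v \<eta>1) = (w2 - w1) + D *v (\<eta>1 - \<eta>2)"
    by (simp add: matrix_vector_mult_diff_distrib)
  have "(\<eta>1 - \<eta>2) \<bullet> ((w2 - D *v \<eta>2) - (w1 - D *v \<eta>1)) \<le>
      (L1 * \<bar>t - s\<bar> + L2 * norm (x - y)) * (1 + norm \<eta>1 + norm \<eta>2)"
    by (rule dis_le_imp[OF F_dis[OF ts]]) (use \<eta> in \<open>simp_all add: lure_op_iff\<close>)
  then show ?thesis
    unfolding eq inner_add_right by (simp only: inner_commute[of "D *v (\<eta>1 - \<eta>2)"])
qed

text \<open>Large multiples of a normal vector are values of the operator over the projected point, so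
  dividing the estimate for \<open>dis\<close> by the multiple bounds the distance of the domains.\<close>

lemma Q_lipschitz:
  assumes ts: "t \<in> {0..T}" "s \<in> {0..T}" and w: "w \<in> Q s"
  shows "\<exists>p\<in>Q t. norm (w - p) \<le> L1 * \<bar>t - s\<bar>"
proof -
  interpret lo: lure_operator "F t 0" D c by (rule op[OF ts(1)])
  have Qt: "Q t = op_dom (lure_op (F t 0) D)" by (simp add: Q_def)
  define p where "p = closest_point (Q t) w"
  define n where "n = w - p"
  define l where "l = L1 * \<bar>t - s\<bar>"
  have l0: "0 \<le> l" using L by (simp add: l_def)
  have p: "p \<in> Q t" unfolding p_def Qt using lo.closed_Q lo.Q_nonempty by (rule closest_point_in_set)
  have nn: "n \<bullet> (w' - p) \<le> 0" if "w' \<in> Q t" for w'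
    unfolding n_def p_def by (rule closest_point_dot) (use that lo.convex_Q lo.closed_Q in \<open>auto simp: Qt\<close>)
  define \<eta>2 where "\<eta>2 = \<psi> s 0 w"
  \<comment> \<open>Everything in the estimate that does not scale with the multiple
    \<open>r\<close> of the normal.\<close>
  define k where "k = l * (1 + norm (\<psi> t 0 p) + norm \<eta>2) - (\<psi> t 0 p - \<eta>2) \<bullet> n"
  have le: "r * ((norm n)\<^sup>2 - l * norm n) \<le> k" if r: "0 \<le> r" for r
  proof -
    have "(r *\<^sub>R n) \<bullet> (w' - p) \<le> 0" if "w' \<in> Q t" for w'
      using nn[OF that] r by (simp add: mult_nonneg_nonpos)
    then have "\<psi> t 0 p + r *\<^sub>R n \<in> lure_op (F t 0) D p"
      using lo.sel_add_normal(1)[of p "r *\<^sub>R n"] p by (simp add: Qt \<psi>_def)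
    moreover have "\<eta>2 \<in> lure_op (F s 0) D w" unfolding \<eta>2_def by (rule sel(2)[OF ts(2) w])
    ultimately have "(\<psi> t 0 p + r *\<^sub>R n - \<eta>2) \<bullet> n \<le> l * (1 + norm (\<psi> t 0 p + r *\<^sub>R n) + norm \<eta>2)"
      using lure_op_dis[OF ts, of "\<psi> t 0 p + r *\<^sub>R n" 0 p \<eta>2 0 w] lo.D_nonneg[of "\<psi> t 0 p + r *\<^sub>R n - \<eta>2"]
      by (simp add: n_def l_def)
    also have "\<dots> \<le> l * (1 + (norm (\<psi> t 0 p) + r * norm n) + norm \<eta>2)"
      using l0 r norm_triangle_ineq[of "\<psi> t 0 p" "r *\<^sub>R n"] by (intro mult_left_mono) auto
    finally show ?thesis
      by (simp add: k_def inner_add_left inner_diff_left power2_norm_eq_inner algebra_simps)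
  qed
  have "(norm n)\<^sup>2 \<le> l * norm n"
  proof (rule ccontr)
    assume "\<not> ?thesis"
    then have pos: "0 < (norm n)\<^sup>2 - l * norm n" by simp
    have "0 \<le> k" using le[of 0] by simp
    have "(k + 1) / ((norm n)\<^sup>2 - l * norm n) * ((norm n)\<^sup>2 - l * norm n) \<le> k"
      by (rule le) (use pos \<open>0 \<le> k\<close> in simp)
    then show False using pos by simp
  qed
  then have "norm n \<le> l" using l0 by (cases "n = 0") (auto simp: power2_eq_square)
  then show ?thesis using p by (auto simp: n_def l_def)
qed

text \<open>Coercivity yields d^2 \<le> d e + k once the norm of the first selection is bounded by
  that of the second plus \<open>d\<close>, and Young's inequality absorbs d e. The term
  \<open>k\<close>, of first order in \<open>\<delta>\<close>, causes the square-root modulus. Only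
  the second selection appears on the right, so it can be frozen as a reference.\<close>

lemma sel_estimate:
  fixes x y :: "real^'n"
  assumes ts: "t \<in> {0..T}" "s \<in> {0..T}" and w: "w \<in> Q t" "w' \<in> Q s"
  defines "\<delta> \<equiv> L1 * \<bar>t - s\<bar> + L2 * norm (x - y)"
  shows "(norm (\<psi> t x w - \<psi> s y w'))\<^sup>2 \<le>
    ((norm (w - w') + \<delta>) / c)\<^sup>2 + 2 * (\<delta> * (1 + 2 * norm (\<psi> s y w')) / c)"
proof -
  let ?\<eta>1 = "\<psi> t x w" and ?\<eta>2 = "\<psi> s y w'"
  define d where "d = norm (?\<eta>1 - ?\<eta>2)"
  define e where "e = (norm (w - w') + \<delta>) / c"
  define k where "k = \<delta> * (1 + 2 * norm ?\<eta>2) / c"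
  have \<delta>0: "0 \<le> \<delta>" using L by (simp add: \<delta>_def)
  have "?\<eta>1 - ?\<eta>2 \<in> R" using sel(1) ts w by (intro subspace_diff[OF mat_rge_subspace])
  then have "c * d\<^sup>2 \<le> (D *v (?\<eta>1 - ?\<eta>2)) \<bullet> (?\<eta>1 - ?\<eta>2)" using c(2) by (simp add: d_def power2_norm_eq_inner)
  also have "\<dots> \<le> \<delta> * (1 + norm ?\<eta>1 + norm ?\<eta>2) - (?\<eta>1 - ?\<eta>2) \<bullet> (w' - w)"
    using lure_op_dis[OF ts sel(2)[OF ts(1) w(1)] sel(2)[OF ts(2) w(2)], of x y] by (simp add: \<delta>_def)
  also have "\<dots> \<le> \<delta> * (1 + (norm ?\<eta>2 + d) + norm ?\<eta>2) + d * norm (w - w')"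
  proof -
    have "\<delta> * (1 + norm ?\<eta>1 + norm ?\<eta>2) \<le> \<delta> * (1 + (norm ?\<eta>2 + d) + norm ?\<eta>2)"
      unfolding d_def using \<delta>0 norm_triangle_sub[of ?\<eta>1 ?\<eta>2] by (intro mult_left_mono) auto
    moreover have "- ((?\<eta>1 - ?\<eta>2) \<bullet> (w' - w)) \<le> d * norm (w - w')"
      using norm_cauchy_schwarz[of "?\<eta>1 - ?\<eta>2" "w - w'"] by (simp add: d_def inner_diff_right)
    ultimately show ?thesis by linarith
  qed
  also have "\<dots> = c * (d * e + k)" using c(1) by (simp add: e_def k_def field_simps)
  finally have "d\<^sup>2 \<le> d * e + k" using c(1) by simp
  moreover have "2 * (d * e) \<le> d\<^sup>2 + e\<^sup>2" using sum_squares_bound[of d e] by simp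
  ultimately have "d\<^sup>2 \<le> e\<^sup>2 + 2 * k" by linarith
  then show ?thesis by (simp add: d_def e_def k_def)
qed

section \<open>The reduced sweeping process and existence\<close>

definition S :: "real \<Rightarrow> (real^'n) set" where "S t = {x. C *v x \<in> Q t}"

definition f :: "real \<Rightarrow> real^'n \<Rightarrow> real^'n" where "f t x = g t x - B *v \<psi> t x (C *v x)"

lemma S_closed: "t \<in> {0..T} \<Longrightarrow> closed (S t)"
  unfolding S_def Q_def
  using continuous_closed_vimage[OF lure_operator.closed_Q[OF op], of t "\<lambda>x. C *v x"]
  by (simp add: vimage_def linear_continuous_at[unfolded linear_conv_bounded_linear[symmetric]])

lemma S_convex: "t \<in> {0..T} \<Longrightarrow> convex (S t)"
  unfolding S_def Q_def
  using convex_linear_vimage[OF matrix_vector_mul_linear[of C] lure_operator.convex_Q[OF op], of t]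
  by (simp add: vimage_def)

lemma S_lipschitz:
  assumes "s \<in> {0..T}" "t \<in> {0..T}" "x \<in> S s"
  shows "\<exists>y\<in>S t. norm (x - y) \<le> \<sigma> * L1 * \<bar>t - s\<bar>"
proof -
  obtain p where p: "p \<in> Q t" "norm (C *v x - p) \<le> L1 * \<bar>t - s\<bar>"
    using Q_lipschitz[OF assms(2,1), of "C *v x"] assms(3) by (auto simp: S_def)
  let ?y = "x + C' (p - C *v x)"
  have "?y \<in> S t" using p(1) by (simp add: S_def matrix_vector_right_distrib C')
  moreover have "norm (x - ?y) \<le> \<sigma> * L1 * \<bar>t - s\<bar>"
    using \<sigma>(2)[of "p - C *v x"] mult_left_mono[OF p(2) less_imp_le[OF \<sigma>(1)]]
    by (simp add: norm_minus_commute mult.assoc)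
  ultimately show ?thesis by blast
qed

text \<open>Comparison with the single reference pair (t0, x0) bounds the selection everywhere: its
  error terms grow at most linearly in 1 + norm x, and the square root of E^2 + 2 k is replaced by
  the linear majorant E + 1 + 2 k.\<close>

lemma f_growth:
  assumes t0: "t0 \<in> {0..T}" and x0: "x0 \<in> S t0"
  shows "\<exists>k\<ge>0. \<forall>t\<in>{0..T}. \<forall>x\<in>S t. norm (f t x) \<le> k * (1 + norm x)"
proof -
  obtain CB where CB: "0 < CB" "\<And>x. norm (C *v x) \<le> CB * norm x"
    using linear_bounded_pos[OF matrix_vector_mul_linear[of C]] by blast
  obtain BB where BB: "0 < BB" "\<And>x. norm (B *v x) \<le> BB * norm x"
    using linear_bounded_pos[OF matrix_vector_mul_linear[of B]] by blast
  define p0 where "p0 = norm (\<psi> t0 x0 (C *v x0))"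
  define N where "N = norm x0"
  define a where "a = L1 * T + L2 * N + L2"
  define k1 where "k1 = (CB * (1 + N) + a) / c + 1 + 2 * (a * (1 + 2 * p0) / c) + p0"
  have T0: "0 \<le> T" using t0 by simp
  have a0: "0 \<le> a" using L T0 by (simp add: a_def N_def)
  have nn: "0 \<le> (CB * (1 + N) + a) / c" "0 \<le> a * (1 + 2 * p0) / c" "0 \<le> p0"
    using CB a0 c(1) by (simp_all add: N_def p0_def)
  have sel: "norm (\<psi> t x (C *v x)) \<le> k1 * (1 + norm x)" if t: "t \<in> {0..T}" and x: "x \<in> S t" for t x
  proof -
    define \<delta> where "\<delta> = L1 * \<bar>t - t0\<bar> + L2 * norm (x - x0)"
    define u where "u = 1 + norm x"
    have u: "1 \<le> u" by (simp add: u_def)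
    have "\<delta> \<le> L1 * T + L2 * (norm x + N)"
      unfolding \<delta>_def N_def using L t t0 norm_triangle_ineq4[of x x0] by (intro add_mono mult_left_mono) auto
    also have "\<dots> \<le> a * u"
    proof -
      have "0 \<le> (L1 * T + L2 * N) * norm x" using L T0 by (simp add: N_def)
      then show ?thesis using L by (simp add: a_def u_def algebra_simps)
    qed
    finally have \<delta>: "\<delta> \<le> a * u" .
    have \<delta>0: "0 \<le> \<delta>" using L by (simp add: \<delta>_def)
    have "norm (C *v x - C *v x0) \<le> CB * norm (x - x0)"
      using CB(2)[of "x - x0"] by (simp add: matrix_vector_mult_diff_distrib)
    also have "\<dots> \<le> CB * ((1 + N) * u)"
    proof (rule mult_left_mono)
      have "0 \<le> N * norm x" by (simp add: N_def)
      moreover have "(1 + N) * u = 1 + N + norm x + N * norm x" by (simp add: u_def algebra_simps)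
      ultimately show "norm (x - x0) \<le> (1 + N) * u"
        using norm_triangle_ineq4[of x x0] unfolding N_def by linarith
    qed (use CB in simp)
    finally have w: "norm (C *v x - C *v x0) \<le> CB * (1 + N) * u" by simp
    define E where "E = (norm (C *v x - C *v x0) + \<delta>) / c"
    define k where "k = \<delta> * (1 + 2 * p0) / c"
    have E0: "0 \<le> E" "0 \<le> k" using c(1) \<delta>0 nn(3) by (simp_all add: E_def k_def)
    have "(norm (\<psi> t x (C *v x) - \<psi> t0 x0 (C *v x0)))\<^sup>2 \<le> E\<^sup>2 + 2 * k"
      using sel_estimate[OF t t0, of "C *v x" "C *v x0" x x0] x x0
      by (simp add: S_def E_def k_def \<delta>_def p0_def)
    also have "\<dots> \<le> (E + (1 + 2 * k))\<^sup>2"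
    proof -
      have "0 \<le> E * (1 + 2 * k)" "0 \<le> k * k" using E0 by simp_all
      then show ?thesis using E0 by (simp add: power2_eq_square algebra_simps)
    qed
    finally have "norm (\<psi> t x (C *v x) - \<psi> t0 x0 (C *v x0)) \<le> E + (1 + 2 * k)"
      by (rule power2_le_imp_le) (use E0 in simp)
    then have "norm (\<psi> t x (C *v x)) \<le> E + (1 + 2 * k) + p0"
      using norm_triangle_sub[of "\<psi> t x (C *v x)" "\<psi> t0 x0 (C *v x0)"] by (simp add: p0_def)
    also have "\<dots> \<le> (CB * (1 + N) + a) / c * u + (1 * u + 2 * (a * (1 + 2 * p0) / c * u)) + p0 * u"
    proof (intro add_mono mult_left_mono)
      show "E \<le> (CB * (1 + N) + a) / c * u"
        unfolding E_def using w \<delta> c(1) by (simp add: divide_right_mono algebra_simps)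
      have "\<delta> * (1 + 2 * p0) \<le> a * u * (1 + 2 * p0)" using \<delta> nn(3) by (intro mult_right_mono) auto
      then show "k \<le> a * (1 + 2 * p0) / c * u"
        unfolding k_def using c(1) by (simp add: divide_right_mono mult_ac)
      show "p0 \<le> p0 * u" using nn(3) u mult_left_mono[OF u nn(3)] by simp
    qed (use u in auto)
    also have "\<dots> = k1 * u" by (simp add: k1_def algebra_simps)
    finally show ?thesis by (simp add: u_def)
  qed
  have k1: "0 \<le> k1" using nn by (simp add: k1_def)
  show ?thesis
  proof (intro exI[of _ "cg + BB * k1"] conjI ballI)
    show "0 \<le> cg + BB * k1" using cg(1) BB(1) k1 by simp
    fix t x assume t: "t \<in> {0..T}" and x: "x \<in> S t"
    have "norm (f t x) \<le> norm (g t x) + norm (B *v \<psi> t x (C *v x))" unfolding f_def by (rule norm_triangle_ineq4)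
    also have "\<dots> \<le> cg * (1 + norm x) + BB * (k1 * (1 + norm x))"
      using cg(2)[OF t, of x] BB(2)[of "\<psi> t x (C *v x)"] mult_left_mono[OF sel[OF t x] less_imp_le[OF BB(1)]] by linarith
    finally show "norm (f t x) \<le> (cg + BB * k1) * (1 + norm x)" by (simp add: algebra_simps)
  qed
qed

text \<open>The right side of \<open>sel_estimate\<close> is continuous in the first pair and
  vanishes when the pairs coincide.\<close>

lemma f_continuous: "continuous_on (SIGMA t:{0..T}. S t) (\<lambda>(t, x). f t x)"
proof -
  let ?A = "SIGMA t:{0..T}. S t"
  let ?w = "\<lambda>p. \<psi> (fst p) (snd p) (C *v snd p)"
  have "continuous_on ?A ?w"
    unfolding continuous_on_def
  proof
    fix q assume q: "q \<in> ?A"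
    define \<delta> where "\<delta> p = L1 * \<bar>fst p - fst q\<bar> + L2 * norm (snd p - snd q)" for p :: "real \<times> (real^'n)"
    define E where "E p = ((norm (C *v snd p - C *v snd q) + \<delta> p) / c)\<^sup>2 + 2 * (\<delta> p * (1 + 2 * norm (?w q)) / c)" for p
    have "continuous_on UNIV E"
      unfolding E_def \<delta>_def
      by (intro continuous_intros linear_continuous_on_compose[OF _ matrix_vector_mul_linear]) (use c in auto)
    then have "continuous_on UNIV (\<lambda>p. sqrt (E p))" by (rule continuous_on_real_sqrt)
    then have "((\<lambda>p. sqrt (E p)) \<longlongrightarrow> sqrt (E q)) (at q within ?A)"
      by (meson UNIV_I continuous_on_def subset_UNIV tendsto_within_subset)
    moreover have "E q = 0" by (simp add: E_def \<delta>_def)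
    ultimately have E: "((\<lambda>p. sqrt (E p)) \<longlongrightarrow> 0) (at q within ?A)" by simp
    have "\<forall>\<^sub>F p in at q within ?A. norm (?w p - ?w q) \<le> sqrt (E p)"
      unfolding eventually_at
    proof (intro exI[of _ 1] conjI ballI impI)
      fix p assume "p \<in> ?A"
      then show "norm (?w p - ?w q) \<le> sqrt (E p)"
        using sel_estimate[of "fst p" "fst q" "C *v snd p" "C *v snd q" "snd p" "snd q"] q
        by (intro real_le_rsqrt) (auto simp: E_def \<delta>_def S_def)
    qed simp
    from Lim_null_comparison[OF this E] show "(?w \<longlongrightarrow> ?w q) (at q within ?A)" by (simp add: LIM_zero_iff)
  qed
  then have "continuous_on ?A (\<lambda>p. B *v ?w p)"
    by (intro linear_continuous_on_compose[OF _ matrix_vector_mul_linear])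
  moreover have "continuous_on ?A (\<lambda>p. g (fst p) (snd p))"
    using continuous_on_subset[OF g_cont, of ?A] by (auto simp: case_prod_beta)
  ultimately show ?thesis unfolding f_def case_prod_beta by (intro continuous_intros)
qed

text \<open>The vector u = P (f - v) is normal to \<open>S t\<close>. As \<open>S t\<close> is
  invariant under ker C, \<open>u\<close> annihilates that kernel and therefore equals C^T n with
  \<open>n\<close> normal to \<open>Q t\<close> at C x. So \<open>n\<close> lies in \<open>K\<close>
  and \<open>\<psi> + n\<close> is a value of the operator; P B n = C^T n = u then gives B n = f -
  v.\<close>

lemma normal_velocity_imp_inclusion:
  assumes t: "t \<in> {0..T}" and x: "x \<in> S t"
    and v: "\<And>z. z \<in> S t \<Longrightarrow> (P *v (f t x - v)) \<bullet> (z - x) \<le> 0"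
  shows "v \<in> {g t x - B *v \<mu> | \<mu>. \<mu> \<in> lure_op (F t x) D (C *v x)}"
proof -
  define u where "u = P *v (f t x - v)"
  define n where "n = adjoint C' u"
  have n: "y \<bullet> n = C' y \<bullet> u" for y unfolding n_def by (rule adjoint_works[OF C'(1)])
  have Cx: "C *v x \<in> Q t" using x by (simp add: S_def)
  have ker: "u \<bullet> k = 0" if k: "C *v k = 0" for k
  proof -
    have "x + k \<in> S t" "x - k \<in> S t"
      using x k by (simp_all add: S_def matrix_vector_right_distrib matrix_vector_mult_diff_distrib)
    from v[OF this(1)] v[OF this(2)] show ?thesis by (simp add: u_def)
  qed
  have CTn: "transpose C *v n = u"
  proof (rule vector_eq_rdot[THEN iffD1], rule allI)
    fix z
    have "C *v (z - C' (C *v z)) = 0" by (simp add: matrix_vector_mult_diff_distrib C')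
    then have "u \<bullet> (z - C' (C *v z)) = 0" by (rule ker)
    then have "u \<bullet> z = u \<bullet> C' (C *v z)" by (simp add: inner_diff_right)
    also have "\<dots> = (C *v z) \<bullet> n" using n[of "C *v z"] by (metis inner_commute)
    also have "\<dots> = (transpose C *v n) \<bullet> z" unfolding inner_transpose_mult by (simp add: inner_commute)
    finally show "(transpose C *v n) \<bullet> z = u \<bullet> z" by simp
  qed
  have nn: "n \<bullet> (w' - C *v x) \<le> 0" if w': "w' \<in> Q t" for w'
  proof -
    have "x + C' (w' - C *v x) \<in> S t" using w' by (simp add: S_def matrix_vector_right_distrib C')
    from v[OF this] have "u \<bullet> C' (w' - C *v x) \<le> 0" by (simp add: u_def)
    then show ?thesis using n[of "w' - C *v x"] by (simp add: inner_commute)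
  qed
  have sel: "\<psi> t x (C *v x) + n \<in> lure_op (F t x) D (C *v x)" and nK: "n \<in> K"
    using lure_operator.sel_add_normal[OF op[OF t], of "C *v x" x n] Cx nn
    by (auto simp: Q_eq[OF t] \<psi>_def)
  have "(P ** B) *v n = transpose C *v n"
  proof -
    have "(P ** B - transpose C) *v n = 0" using P_ker nK by (auto simp: mat_ker_def)
    then show ?thesis unfolding matrix_vector_mult_diff_rdistrib by simp
  qed
  then have "P *v (B *v n - (f t x - v)) = 0"
    unfolding CTn u_def by (simp add: matrix_vector_mult_diff_distrib matrix_vector_mul_assoc)
  then have "\<alpha> * ((B *v n - (f t x - v)) \<bullet> (B *v n - (f t x - v))) \<le> 0"
    using \<alpha>(2)[of "B *v n - (f t x - v)"] by simp
  then have "(B *v n - (f t x - v)) \<bullet> (B *v n - (f t x - v)) \<le> 0" using \<alpha>(1) by (simp add: mult_le_0_iff)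
  then have "B *v n - (f t x - v) = 0" by (metis inner_eq_zero_iff inner_ge_zero order_antisym)
  then have "v = g t x - B *v (\<psi> t x (C *v x) + n)"
    by (simp add: f_def matrix_vector_right_distrib algebra_simps)
  with sel show ?thesis by blast
qed

lemma solution_exists:
  assumes t0: "t0 \<in> {0..T}" and x0: "lure_op (F t0 x0) D (C *v x0) \<noteq> {}"
  shows "\<exists>x. lure_solution g B C D F T t0 x0 x"
proof (cases "t0 = T")
  \<comment> \<open>A single instant is a null set, so the differential condition is void; the
    sweeping process asks for an interval with interior.\<close>
  case True
  have "AE t in lebesgue. t \<notin> {T}" using AE_not_in negligible_iff_null_sets negligible_sing by blast
  moreover have "abs_continuous_on t0 T (\<lambda>t. x0)"
    by (rule lipschitz_imp_abs_continuous_on[of 0]) (simp add: lipschitz_on_def)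
  ultimately have "lure_solution g B C D F T t0 x0 (\<lambda>t. x0)"
    unfolding lure_solution_def True
    by (intro conjI refl) (assumption | erule eventually_mono, simp)+
  then show ?thesis by blast
next
  case False
  have sub: "{t0..T} \<subseteq> {0..T}" using t0 by auto
  have x0S: "x0 \<in> S t0" using x0 by (simp add: S_def Q_eq[OF t0, of x0, symmetric] op_dom_def)
  obtain k where k: "0 \<le> k" "\<And>t x. t \<in> {0..T} \<Longrightarrow> x \<in> S t \<Longrightarrow> norm (f t x) \<le> k * (1 + norm x)"
    using f_growth[OF t0 x0S] by blast
  interpret sw: sweeping "(*v) P" S f \<alpha> t0 T "\<sigma> * L1" k x0
  proof
    show "continuous_on (SIGMA t:{t0..T}. S t) (\<lambda>(t, x). f t x)"
      by (rule continuous_on_subset[OF f_continuous]) (use sub in auto)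
  qed (use t0 False sub \<alpha> \<sigma> L k x0S S_closed S_convex S_lipschitz P_sym in
    \<open>auto simp: matrix_vector_right_distrib matrix_vector_mult_scaleR\<close>)
  obtain x M where x: "x t0 = x0" "M-lipschitz_on {t0..T} x" "\<And>t. t \<in> {t0..T} \<Longrightarrow> x t \<in> S t"
    "\<And>t z v. t \<in> {t0..<T} \<Longrightarrow> z \<in> S t \<Longrightarrow> (x has_vector_derivative v) (at t within {t0..T}) \<Longrightarrow>
      (P *v (f t (x t) - v)) \<bullet> (z - x t) \<le> 0"
    using sw.solution_exists by metis
  \<comment> \<open>The variational inequality rests on right derivatives and is available only
    before \<open>T\<close>; the end point is discarded as a null set.\<close>
  have "AE t in lebesgue. t \<notin> {T}" using AE_not_in negligible_iff_null_sets negligible_sing by blast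
  moreover note lipschitz_AE_vector_differentiable[OF x(2)]
  ultimately have "AE t in lebesgue. t \<in> {t0..T} \<longrightarrow>
      (\<exists>v. (x has_vector_derivative v) (at t within {t0..T}) \<and>
        v \<in> {g t (x t) - B *v \<mu> | \<mu>. \<mu> \<in> lure_op (F t (x t)) D (C *v x t)})"
  proof eventually_elim
    case (elim t)
    show ?case
    proof
      assume t: "t \<in> {t0..T}"
      then obtain v where v: "(x has_vector_derivative v) (at t within {t0..T})" using elim by blast
      have "v \<in> {g t (x t) - B *v \<mu> | \<mu>. \<mu> \<in> lure_op (F t (x t)) D (C *v x t)}"
        using t sub elim(1) by (intro normal_velocity_imp_inclusion x v) auto
      with v show "\<exists>v. (x has_vector_derivative v) (at t within {t0..T}) \<and>
        v \<in> {g t (x t) - B *v \<mu> | \<mu>. \<mu> \<in> lure_op (F t (x t)) D (C *v x t)}" by blast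
    qed
  qed
  then have "lure_solution g B C D F T t0 x0 x"
    unfolding lure_solution_def using x(1) lipschitz_imp_abs_continuous_on[OF x(2)] by blast
  then show ?thesis by blast
qed

section \<open>Uniqueness\<close>

lemma one_sided_lipschitz:
  assumes M: "0 < M"
  shows "\<exists>\<Lambda>\<ge>0. \<forall>t\<in>{0..T}. \<forall>x y v v'. norm x \<le> M \<longrightarrow> norm y \<le> M \<longrightarrow>
    v \<in> {g t x - B *v \<mu> | \<mu>. \<mu> \<in> lure_op (F t x) D (C *v x)} \<longrightarrow>
    v' \<in> {g t y - B *v \<mu> | \<mu>. \<mu> \<in> lure_op (F t y) D (C *v y)} \<longrightarrow>
    (P *v (v - v')) \<bullet> (x - y) \<le> \<Lambda> * ((x - y) \<bullet> (x - y))"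
proof -
  obtain CB where CB: "0 < CB" "\<And>x. norm (C *v x) \<le> CB * norm x"
    using linear_bounded_pos[OF matrix_vector_mul_linear[of C]] by blast
  define E where "E = P ** B - transpose C"
  obtain EB where EB: "0 < EB" "\<And>x. norm (E *v x) \<le> EB * norm x"
    using linear_bounded_pos[OF matrix_vector_mul_linear[of E]] by blast
  obtain l where l: "0 < l" "\<And>t x y. t \<in> {0..T} \<Longrightarrow> norm x \<le> M \<Longrightarrow> norm y \<le> M \<Longrightarrow>
      norm (g t x - g t y) \<le> l * norm (x - y)"
    using g_lip M unfolding lipschitz_on_bounded_sets_def by metis
  obtain l1 where l1: "0 < l1" "\<And>t x y. t \<in> {0..T} \<Longrightarrow> norm x \<le> M \<Longrightarrow> norm y \<le> M \<Longrightarrow>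
      norm (g1 t x - g1 t y) \<le> l1 * norm (x - y)"
    using g1_lip M unfolding lipschitz_on_bounded_sets_def by metis
  \<comment> \<open>Lipschitz constant of the selection over C x as a function of the state, at
    fixed time and for norms up to \<open>M\<close>.\<close>
  define k where "k = (CB + l1) / c"
  have k: "0 \<le> k" using CB l1 c(1) by (simp add: k_def)
  show ?thesis
  \<comment> \<open>The three summands stem from the drift \<open>g\<close>, from the defect P B -
    C^T, and from the dependence of the operator on the state.\<close>
  proof (intro exI[of _ "\<beta> * l + EB * k + k * l1"] conjI ballI allI impI)
    show "0 \<le> \<beta> * l + EB * k + k * l1" using \<beta> l l1 EB k by simp
    fix t x y v v' assume t: "t \<in> {0..T}" and xy: "norm x \<le> M" "norm y \<le> M"
      and "v \<in> {g t x - B *v \<mu> | \<mu>. \<mu> \<in> lure_op (F t x) D (C *v x)}"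
      and "v' \<in> {g t y - B *v \<mu> | \<mu>. \<mu> \<in> lure_op (F t y) D (C *v y)}"
    then obtain \<mu> \<mu>' where \<mu>: "\<mu> \<in> lure_op (F t x) D (C *v x)" "v = g t x - B *v \<mu>"
      and \<mu>': "\<mu>' \<in> lure_op (F t y) D (C *v y)" "v' = g t y - B *v \<mu>'" by blast
    define d where "d = x - y"
    define p where "p = \<psi> t x (C *v x) - \<psi> t y (C *v y)"
    define \<gamma> where "\<gamma> = g1 t x - g1 t y"
    have Q: "C *v x \<in> Q t" "C *v y \<in> Q t"
      using \<mu>(1) \<mu>'(1) Q_eq[OF t, of x] Q_eq[OF t, of y] by (auto simp: op_dom_def)
    have Cd: "C *v d = C *v x - C *v y" by (simp add: d_def matrix_vector_mult_diff_distrib)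
    have \<gamma>: "norm \<gamma> \<le> l1 * norm d" unfolding \<gamma>_def d_def by (rule l1(2)[OF t xy])
    have "norm p \<le> (norm (C *v d) + norm \<gamma>) / c"
      unfolding p_def \<gamma>_def Cd by (rule sel_lipschitz[OF t Q])
    also have "\<dots> \<le> (CB * norm d + l1 * norm d) / c"
      using CB(2)[of d] \<gamma> c(1) by (intro divide_right_mono) auto
    also have "\<dots> = k * norm d" by (simp add: k_def algebra_simps)
    finally have p: "norm p \<le> k * norm d" .
    have kK: "(\<mu> - \<mu>') - p \<in> K"
    proof -
      have "\<mu> - \<psi> t x (C *v x) \<in> K" "\<mu>' - \<psi> t y (C *v y) \<in> K"
        using lure_operator.diff_sel_ker[OF op[OF t]] \<mu>(1) \<mu>'(1) by (auto simp: \<psi>_def)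
      then show ?thesis by (simp add: p_def mat_ker_def matrix_vector_mult_diff_distrib)
    qed
    \<comment> \<open>The defect \<open>E\<close> vanishes on \<open>K\<close>, so the uncontrolled
      part of \<open>\<mu> - \<mu>'\<close> drops out and only the Lipschitz difference
      \<open>p\<close> remains.\<close>
    have "E *v ((\<mu> - \<mu>') - p) = 0" using P_ker kK by (auto simp: mat_ker_def E_def)
    then have "E *v (\<mu> - \<mu>') = E *v p" by (simp add: matrix_vector_mult_diff_distrib)
    then have PB: "P *v (B *v (\<mu> - \<mu>')) = E *v p + transpose C *v (\<mu> - \<mu>')"
      unfolding E_def matrix_vector_mult_diff_rdistrib matrix_vector_mul_assoc
      by (simp add: algebra_simps)
    have "v - v' = (g t x - g t y) - B *v (\<mu> - \<mu>')"
      by (simp add: \<mu>(2) \<mu>'(2) matrix_vector_mult_diff_distrib)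
    then have "(P *v (v - v')) \<bullet> d = (P *v (g t x - g t y)) \<bullet> d - (E *v p) \<bullet> d - (transpose C *v (\<mu> - \<mu>')) \<bullet> d"
      by (simp only: matrix_vector_mult_diff_distrib[of P "g t x - g t y"] PB inner_diff_left inner_add_left)
    also have "(transpose C *v (\<mu> - \<mu>')) \<bullet> d = (\<mu> - \<mu>') \<bullet> (C *v d)" by (rule inner_transpose_mult)
    finally have eq: "(P *v (v - v')) \<bullet> d = (P *v (g t x - g t y)) \<bullet> d - (E *v p) \<bullet> d - (\<mu> - \<mu>') \<bullet> (C *v d)"
      by simp
    have 1: "(P *v (g t x - g t y)) \<bullet> d \<le> \<beta> * l * (norm d * norm d)"
    proof -
      have "(P *v (g t x - g t y)) \<bullet> d \<le> norm (P *v (g t x - g t y)) * norm d" by (rule norm_cauchy_schwarz)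
      also have "\<dots> \<le> (\<beta> * (l * norm d)) * norm d"
        using \<beta>(2)[of "g t x - g t y"] mult_left_mono[OF l(2)[OF t xy] less_imp_le[OF \<beta>(1)]]
        by (intro mult_right_mono) (auto simp: d_def)
      finally show ?thesis by (simp add: mult_ac)
    qed
    have 2: "- ((E *v p) \<bullet> d) \<le> EB * k * (norm d * norm d)"
    proof -
      have "- ((E *v p) \<bullet> d) \<le> norm (E *v p) * norm d"
        using Cauchy_Schwarz_ineq2[of "E *v p" d] by linarith
      also have "\<dots> \<le> (EB * (k * norm d)) * norm d"
        using EB(2)[of p] mult_left_mono[OF p less_imp_le[OF EB(1)]] by (intro mult_right_mono) auto
      finally show ?thesis by (simp add: mult_ac)
    qed
    have 3: "- ((\<mu> - \<mu>') \<bullet> (C *v d)) \<le> k * l1 * (norm d * norm d)"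
    proof -
      \<comment> \<open>Moving \<open>\<mu>'\<close> to the operator of state \<open>x\<close> at a
        shifted argument brings both values under one monotone operator. The shift
        \<open>\<gamma>\<close> lies in \<open>R\<close>, so it pairs with \<open>p\<close>
        only.\<close>
      have "\<mu>' \<in> lure_op (F t x) D (C *v y + (g1 t y - g1 t x))"
        using \<mu>'(1) lure_op_shift[OF t, of y "C *v y" x] by simp
      then have "0 \<le> (\<mu> - \<mu>') \<bullet> (C *v x - (C *v y + (g1 t y - g1 t x)))"
        using lure_operator.lure_op_monotone[OF op[OF t] \<mu>(1)] lure_operator.D_nonneg[OF op[OF t]] order_trans
        by blast
      also have "C *v x - (C *v y + (g1 t y - g1 t x)) = C *v d + \<gamma>" by (simp add: Cd \<gamma>_def)
      finally have "- ((\<mu> - \<mu>') \<bullet> (C *v d)) \<le> (\<mu> - \<mu>') \<bullet> \<gamma>" by (simp add: inner_add_right)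
      also have "(\<mu> - \<mu>') \<bullet> \<gamma> = p \<bullet> \<gamma>"
      proof -
        have "\<gamma> \<in> R" unfolding \<gamma>_def using g1_rge[OF t] by (intro subspace_diff[OF mat_rge_subspace])
        then have "\<gamma> \<bullet> ((\<mu> - \<mu>') - p) = 0" by (rule rge_sym_part_orthogonal_ker[OF _ kK])
        then show ?thesis by (simp add: inner_diff_right inner_commute)
      qed
      also have "\<dots> \<le> norm p * norm \<gamma>" by (rule norm_cauchy_schwarz)
      also have "\<dots> \<le> (k * norm d) * (l1 * norm d)" using p \<gamma> k by (intro mult_mono) auto
      finally show ?thesis by (simp add: mult_ac)
    qed
    have "(P *v (v - v')) \<bullet> d \<le> (\<beta> * l + EB * k + k * l1) * (norm d * norm d)"
      using eq 1 2 3 by (simp add: distrib_right)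
    then show "(P *v (v - v')) \<bullet> (x - y) \<le> (\<beta> * l + EB * k + k * l1) * ((x - y) \<bullet> (x - y))"
      by (simp add: d_def dot_square_norm power2_eq_square)
  qed
qed

text \<open>Continuity on a compact interval bounds both trajectories, so the local one-sided
  Lipschitz estimate applies with one constant throughout.\<close>

lemma solution_unique:
  assumes t0: "t0 \<in> {0..T}" and x: "lure_solution g B C D F T t0 x0 x"
    and y: "lure_solution g B C D F T t0 x0 y" and t: "t \<in> {t0..T}"
  shows "x t = y t"
proof -
  have acx: "abs_continuous_on t0 T x" and acy: "abs_continuous_on t0 T y"
    using x y by (auto simp: lure_solution_def)
  have "bounded (x ` {t0..T} \<union> y ` {t0..T})"
    using acx acy by (intro bounded_Un[THEN iffD2] conjI compact_imp_bounded compact_continuous_image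
      abs_continuous_on_imp_continuous_on) auto
  then obtain M where M: "0 < M" "\<And>s. s \<in> {t0..T} \<Longrightarrow> norm (x s) \<le> M" "\<And>s. s \<in> {t0..T} \<Longrightarrow> norm (y s) \<le> M"
    unfolding bounded_pos by blast
  obtain \<Lambda> where \<Lambda>0: "0 \<le> \<Lambda> \<and> (\<forall>t\<in>{0..T}. \<forall>x y v v'. norm x \<le> M \<longrightarrow> norm y \<le> M \<longrightarrow>
    v \<in> {g t x - B *v \<mu> | \<mu>. \<mu> \<in> lure_op (F t x) D (C *v x)} \<longrightarrow>
    v' \<in> {g t y - B *v \<mu> | \<mu>. \<mu> \<in> lure_op (F t y) D (C *v y)} \<longrightarrow>
    (P *v (v - v')) \<bullet> (x - y) \<le> \<Lambda> * ((x - y) \<bullet> (x - y)))"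
    using one_sided_lipschitz[OF M(1)] by (rule exE)
  note \<Lambda> = conjunct1[OF \<Lambda>0] conjunct2[OF \<Lambda>0, rule_format]
  define V where "V s = (P *v (x s - y s)) \<bullet> (x s - y s)" for s
  have "V t = 0"
  \<comment> \<open>The factor 2 comes from differentiating the quadratic form, the division by
    \<open>\<alpha>\<close> from bounding the Euclidean norm by the P-norm.\<close>
  proof (rule abs_continuous_gronwall_zero[OF _ _ _ _ _ t, where L = "2 * \<Lambda> / \<alpha>"])
    show "abs_continuous_on t0 T V"
    proof (rule abs_continuous_on_dominated[OF acx acy])
      \<comment> \<open>The difference of the two quadratic forms factors as P (p - q) \<bullet> (p
        + q), and p + q combines four positions of norm at most \<open>M\<close>.\<close>
      show "0 \<le> \<beta> * (4 * M)" using \<beta> M by simp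
      fix u v assume uv: "u \<in> {t0..T}" "v \<in> {t0..T}" "u \<le> v"
      let ?du = "x u - y u" and ?dv = "x v - y v"
      have "(P *v p) \<bullet> p - (P *v q) \<bullet> q = (P *v (p - q)) \<bullet> (p + q)" for p q
        using P_sym[of p q]
        by (simp add: matrix_vector_mult_diff_distrib inner_diff_left inner_diff_right inner_add_left inner_add_right inner_commute)
      then have "V v - V u = (P *v (?dv - ?du)) \<bullet> (?dv + ?du)" unfolding V_def .
      then have "\<bar>V v - V u\<bar> \<le> norm (P *v (?dv - ?du)) * norm (?dv + ?du)"
        using Cauchy_Schwarz_ineq2 by metis
      also have "\<dots> \<le> (\<beta> * (norm (x v - x u) + norm (y v - y u))) * (4 * M)"
      proof (rule mult_mono)
        have "?dv - ?du = (x v - x u) - (y v - y u)" by simp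
        then have "norm (?dv - ?du) \<le> norm (x v - x u) + norm (y v - y u)" by (metis norm_triangle_ineq4)
        then show "norm (P *v (?dv - ?du)) \<le> \<beta> * (norm (x v - x u) + norm (y v - y u))"
          using \<beta>(2)[of "?dv - ?du"] \<beta>(1) by (meson less_imp_le mult_left_mono order_trans)
        show "norm (?dv + ?du) \<le> 4 * M"
          using norm_triangle_ineq[of ?dv ?du] norm_triangle_ineq4[of "x v" "y v"] norm_triangle_ineq4[of "x u" "y u"]
            M(2,3)[OF uv(1)] M(2,3)[OF uv(2)] by linarith
      qed (use \<beta> in auto)
      also have "\<dots> \<le> (\<beta> * (4 * M)) * (norm (x v - x u) + norm (y v - y u) + (v - u))"
        using \<beta> M uv by (simp add: algebra_simps)
      finally show "norm (V v - V u) \<le> (\<beta> * (4 * M)) * (norm (x v - x u) + norm (y v - y u) + (v - u))" by simp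
    qed
    show "V t0 = 0" using x y by (simp add: V_def lure_solution_def)
    show "0 \<le> V s" for s
      using \<alpha>(2)[of "x s - y s"] \<alpha>(1) unfolding V_def by (meson inner_ge_zero less_imp_le mult_nonneg_nonneg order_trans)
    show "0 \<le> 2 * \<Lambda> / \<alpha>" using \<Lambda>(1) \<alpha>(1) by simp
    have ex: "AE s in lebesgue. s \<in> {t0..T} \<longrightarrow> (\<exists>v. (x has_vector_derivative v) (at s within {t0..T}) \<and>
        v \<in> {g s (x s) - B *v \<mu> | \<mu>. \<mu> \<in> lure_op (F s (x s)) D (C *v x s)})"
      using x by (simp only: lure_solution_def)
    have ey: "AE s in lebesgue. s \<in> {t0..T} \<longrightarrow> (\<exists>v. (y has_vector_derivative v) (at s within {t0..T}) \<and>
        v \<in> {g s (y s) - B *v \<mu> | \<mu>. \<mu> \<in> lure_op (F s (y s)) D (C *v y s)})"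
      using y by (simp only: lure_solution_def)
    show "AE s in lebesgue. s \<in> {t0..T} \<longrightarrow>
      (\<exists>v. (V has_real_derivative v) (at s within {t0..T}) \<and> v \<le> 2 * \<Lambda> / \<alpha> * V s)"
      using ex ey
    proof eventually_elim
      case (elim s)
      show ?case
      proof
        assume s: "s \<in> {t0..T}"
        obtain v where v: "(x has_vector_derivative v) (at s within {t0..T})"
            "v \<in> {g s (x s) - B *v \<mu> | \<mu>. \<mu> \<in> lure_op (F s (x s)) D (C *v x s)}"
          using elim(1) s by blast
        obtain v' where v': "(y has_vector_derivative v') (at s within {t0..T})"
            "v' \<in> {g s (y s) - B *v \<mu> | \<mu>. \<mu> \<in> lure_op (F s (y s)) D (C *v y s)}"
          using elim(2) s by blast
        have dd: "((\<lambda>s. x s - y s) has_derivative (\<lambda>h. h *\<^sub>R (v - v'))) (at s within {t0..T})"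
          using has_vector_derivative_diff[OF v(1) v'(1)] by (simp only: has_vector_derivative_def)
        have dP: "((\<lambda>s. P *v (x s - y s)) has_derivative (\<lambda>h. P *v (h *\<^sub>R (v - v')))) (at s within {t0..T})"
          by (rule bounded_linear.has_derivative[OF matrix_vector_mul_bounded_linear dd])
        have "(V has_derivative (\<lambda>h. (P *v (x s - y s)) \<bullet> (h *\<^sub>R (v - v')) + (P *v (h *\<^sub>R (v - v'))) \<bullet> (x s - y s)))
            (at s within {t0..T})"
          unfolding V_def by (rule has_derivative_inner[OF dP dd])
        moreover have "(P *v (x s - y s)) \<bullet> (h *\<^sub>R (v - v')) + (P *v (h *\<^sub>R (v - v'))) \<bullet> (x s - y s)
            = 2 * ((P *v (v - v')) \<bullet> (x s - y s)) * h" for h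
          using P_sym[of "x s - y s" "v - v'"]
          by (simp only: matrix_vector_mult_scaleR inner_scaleR_left inner_scaleR_right)
            (simp add: inner_commute)
        ultimately have "(V has_real_derivative 2 * ((P *v (v - v')) \<bullet> (x s - y s))) (at s within {t0..T})"
          by (simp add: has_field_derivative_def)
        moreover have "2 * ((P *v (v - v')) \<bullet> (x s - y s)) \<le> 2 * \<Lambda> / \<alpha> * V s"
        proof -
          have sT: "s \<in> {0..T}" using s t0 by auto
          have "(P *v (v - v')) \<bullet> (x s - y s) \<le> \<Lambda> * ((x s - y s) \<bullet> (x s - y s))"
            by (rule \<Lambda>(2)[OF sT M(2)[OF s] M(3)[OF s] v(2) v'(2)])
          also have "\<dots> \<le> \<Lambda> * (V s / \<alpha>)"
            using \<alpha>(2)[of "x s - y s"] \<alpha>(1) \<Lambda>(1) unfolding V_def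
            by (intro mult_left_mono) (simp_all add: pos_le_divide_eq mult.commute)
          finally show ?thesis by simp
        qed
        ultimately show "\<exists>v. (V has_real_derivative v) (at s within {t0..T}) \<and> v \<le> 2 * \<Lambda> / \<alpha> * V s" by blast
      qed
    qed
  qed
  then have "\<alpha> * ((x t - y t) \<bullet> (x t - y t)) \<le> 0" using \<alpha>(2)[of "x t - y t"] by (simp add: V_def)
  then have "(x t - y t) \<bullet> (x t - y t) \<le> 0" using \<alpha>(1) by (simp add: mult_le_0_iff)
  then have "x t - y t = 0" by (metis inner_eq_zero_iff inner_ge_zero order_antisym)
  then show ?thesis by simp
qed

end

theorem theorem5p4:
  fixes T c2 t0 :: real
    and B :: "real^'m^'n" and C :: "real^'n^'m" and D :: "real^'m^'m"
    and g :: "real \<Rightarrow> real^'n \<Rightarrow> real^'n"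
    and F :: "real \<Rightarrow> real^'n \<Rightarrow> real^'m \<Rightarrow> (real^'m) set"
    and G :: "real \<Rightarrow> real^'m \<Rightarrow> (real^'m) set"
    and g1 :: "real \<Rightarrow> real^'n \<Rightarrow> real^'m"
    and x0 :: "real^'n"
  assumes T_pos: "T > 0"
    and F_max: "\<forall>t\<in>{0..T}. \<forall>x. maximal_monotone (F t x)"
    and c2: "smallest_pos_eigenvalue (transpose C ** C) c2"
    and F_dis: "\<exists>LF1 LF2. 0 \<le> LF1 \<and> 0 \<le> LF2 \<and> LF2 < c2 / mat_norm C \<and>
      (\<forall>t\<in>{0..T}. \<forall>s\<in>{0..T}. \<forall>x y.
        dis (F t x) (F s y) \<le> ereal (LF1 * \<bar>t - s\<bar> + LF2 * norm (x - y)))"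
    and D_psd: "pos_semidef_mat D"
    and C_rank: "rank (C ** transpose C) = CARD('m)"
    and P_ker: "\<exists>P :: real^'n^'n. sym_pos_def_mat P \<and>
      mat_ker (D + transpose D) \<subseteq> mat_ker (P ** B - transpose C)"
    and rge_D: "\<forall>t\<in>{0..T}. \<forall>x y. lure_op (F t y) D (C *v x) \<noteq> {} \<longrightarrow>
      mat_rge (D + transpose D) \<inter> lure_op (F t y) D (C *v x) \<noteq> {}"
    and rge_C: "\<forall>t\<in>{0..T}. \<forall>x.
      mat_rge C \<inter> rel_interior (op_rge (op_add_mat (op_inv (F t x)) D)) \<noteq> {}"
    and g_cont: "continuous_on ({0..T} \<times> UNIV) (\<lambda>(t, x). g t x)"
    and g_growth: "\<exists>cf>0. \<forall>t\<in>{0..T}. \<forall>x. norm (g t x) \<le> cf * (1 + norm x)"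
    and G_max: "\<forall>t\<in>{0..T}. maximal_monotone (G t)"
    and F_G: "\<forall>t\<in>{0..T}. \<forall>x z. F t x z = G t (z + g1 t x)"
    and g1_rge: "\<forall>t\<in>{0..T}. \<forall>x. g1 t x \<in> mat_rge (D + transpose D)"
    and g1_lip: "lipschitz_on_bounded_sets T g1"
    and g_lip: "lipschitz_on_bounded_sets T g"
    and t0: "t0 \<in> {0..T}"
    and x0: "lure_op (F t0 x0) D (C *v x0) \<noteq> {}"
  shows "(\<exists>x. lure_solution g B C D F T t0 x0 x) \<and>
    (\<forall>x x'. lure_solution g B C D F T t0 x0 x \<and> lure_solution g B C D F T t0 x0 x' \<longrightarrow>
      (\<forall>t\<in>{t0..T}. x t = x' t))"
proof -
  obtain LF1 LF2 where LF: "0 \<le> LF1" "0 \<le> LF2"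
    "\<forall>t\<in>{0..T}. \<forall>s\<in>{0..T}. \<forall>x y. dis (F t x) (F s y) \<le> ereal (LF1 * \<bar>t - s\<bar> + LF2 * norm (x - y))"
    using F_dis by blast
  obtain c where c: "0 < c" "\<And>x. x \<in> mat_rge (D + transpose D) \<Longrightarrow> c * (x \<bullet> x) \<le> (D *v x) \<bullet> x"
    using psd_coercive_on_rge[OF D_psd] by blast
  have "surj ((*v) (C ** transpose C))" using C_rank by (simp only: full_rank_surjective)
  then have "surj ((*v) C)"
    by (auto simp: surj_def simp flip: matrix_vector_mul_assoc)
  then obtain C' where C': "linear C'" "\<And>y. C *v C' y = y"
  proof -
    obtain h where "linear h" "(*v) C \<circ> h = id"
      using linear_surjective_right_inverse[OF matrix_vector_mul_linear \<open>surj ((*v) C)\<close>] by blast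
    then show thesis using that[of h] by (simp add: fun_eq_iff)
  qed
  obtain \<sigma> where \<sigma>: "0 < \<sigma>" "\<And>y. norm (C' y) \<le> \<sigma> * norm y"
    using linear_bounded_pos[OF C'(1)] by blast
  obtain P :: "real^'n^'n" where P: "sym_pos_def_mat P"
    "mat_ker (D + transpose D) \<subseteq> mat_ker (P ** B - transpose C)" using P_ker by blast
  have P_sym: "(P *v x) \<bullet> y = x \<bullet> (P *v y)" for x y
    using P(1) inner_transpose_mult[of P x y] by (simp add: sym_pos_def_mat_def del: transpose_matrix_vector)
  obtain \<alpha> where \<alpha>: "0 < \<alpha>" "\<And>x. \<alpha> * (x \<bullet> x) \<le> (P *v x) \<bullet> x"
    using coercive_on_subspace[OF matrix_vector_mul_linear subspace_UNIV, of P] P(1)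
    by (auto simp: sym_pos_def_mat_def)
  obtain \<beta> where \<beta>: "0 < \<beta>" "\<And>x. norm (P *v x) \<le> \<beta> * norm x"
    using linear_bounded_pos[OF matrix_vector_mul_linear[of P]] by blast
  obtain cg where cg: "0 < cg" "\<forall>t\<in>{0..T}. \<forall>x. norm (g t x) \<le> cg * (1 + norm x)"
    using g_growth by blast
  \<comment> \<open>Every \<open>w\<close> equals C x for x = C' w, so a condition on arguments of
    the form C x covers all arguments.\<close>
  have meets: "mat_rge (D + transpose D) \<inter> lure_op (F t y) D w \<noteq> {}"
    if "t \<in> {0..T}" "lure_op (F t y) D w \<noteq> {}" for t y w
    using rge_D that C'(2)[of w] by metis
  interpret lure_system T c LF1 LF2 B C D P g F G g1 C' \<sigma> \<alpha> \<beta> cg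
  proof (rule lure_system.intro)
    show "maximal_monotone (F t x)" if "t \<in> {0..T}" for t x using F_max that by blast
    show "dis (F t x) (F s y) \<le> ereal (LF1 * \<bar>t - s\<bar> + LF2 * norm (x - y))"
      if "t \<in> {0..T}" "s \<in> {0..T}" for t s x y using LF(3) that by blast
    show "0 \<le> cg" using cg(1) by simp
    show "norm (g t x) \<le> cg * (1 + norm x)" if "t \<in> {0..T}" for t x using cg(2) that by blast
    show "F t x z = G t (z + g1 t x)" if "t \<in> {0..T}" for t x z using F_G that by blast
    show "g1 t x \<in> mat_rge (D + transpose D)" if "t \<in> {0..T}" for t x using g1_rge that by blast
  qed (rule LF(1,2) D_psd c C' \<sigma> P_sym \<alpha> \<beta> P(2) meets g_cont g1_lip g_lip; assumption)+
  show ?thesis using solution_exists[OF t0 x0] solution_unique[OF t0] by blast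
qed

end
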